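(* Let $H$ be a graph having a vertex whose removal results in a nontrivial bipartite graph $B$ with $\mathrm{ex}(n,B)=O(n^{3/2})$. Then there is a constant $C>0$ such that $\mathrm{sp}(m,H)\ge C m^{4/5}$ for all $m\ge1$. Moreover, if such an $H$ contains a copy of $K_3$ or of $K_{3,3}$, then $\mathrm{sp}(m,H)=\Theta(m^{4/5})$, i.e. there is also a constant $C'>0$ with $\mathrm{sp}(m,H)\le C' m^{4/5}$ for all $m\ge 1$.
   Context: All graphs are finite and simple. For a graph $G$ with $m$ edges, $\mathrm{sp}(G)=\mathrm{mc}(G)-m/2$, where $\mathrm{mc}(G)$ is the maximum number of edges crossing a bipartition of $V(G)$. $\mathrm{sp}(m,H)$ is the minimum of $\mathrm{sp}(G)$ over all $H$-free graphs $G$ (no subgraph isomorphic to $H$) with $m$ edges. $\mathrm{ex}(n,F)$ is the maximum number of edges of an $n$-vertex $F$-free graph. *)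

theory Defs
  imports Complex_Main "HOL-Library.Landau_Symbols" "HOL-Library.Extended_Real"
begin

datatype 'a ugraph = Graph (verts: "'a set") (edges: "'a set set")

definition simple_graph :: "'a ugraph \<Rightarrow> bool" where
  "simple_graph G \<longleftrightarrow> finite (verts G) \<and> (\<forall>e\<in>edges G. e \<subseteq> verts G \<and> card e = 2)"

definition subgraph :: "'a ugraph \<Rightarrow> 'a ugraph \<Rightarrow> bool" where
  "subgraph S G \<longleftrightarrow> simple_graph S \<and> verts S \<subseteq> verts G \<and> edges S \<subseteq> edges G"

definition isomorphic :: "'a ugraph \<Rightarrow> 'b ugraph \<Rightarrow> bool" where
  "isomorphic G H \<longleftrightarrow>
    (\<exists>f. bij_betw f (verts G) (verts H) \<and> edges H = (\<lambda>e. f ` e) ` edges G)"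

text \<open>The subgraph need not be induced.\<close>

definition contains_copy :: "'a ugraph \<Rightarrow> 'b ugraph \<Rightarrow> bool" where
  "contains_copy G H \<longleftrightarrow> (\<exists>S. subgraph S G \<and> isomorphic S H)"

definition free_of :: "'b ugraph \<Rightarrow> 'a ugraph \<Rightarrow> bool" where
  "free_of H G \<longleftrightarrow> \<not> contains_copy G H"

definition delete_vertex :: "'a ugraph \<Rightarrow> 'a \<Rightarrow> 'a ugraph" where
  "delete_vertex G v = Graph (verts G - {v}) {e \<in> edges G. v \<notin> e}"

text \<open>A graph is trivial if it has at most one vertex. A nontrivial graph may thus be
  edgeless; every graph with an edge is nontrivial.\<close>

definition nontrivial :: "'a ugraph \<Rightarrow> bool" where
  "nontrivial G \<longleftrightarrow> card (verts G) \<ge> 2"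

definition bipartition :: "'a ugraph \<Rightarrow> 'a set \<Rightarrow> 'a set \<Rightarrow> bool" where
  "bipartition G X Y \<longleftrightarrow> X \<union> Y = verts G \<and> X \<inter> Y = {}"

definition crossing_edges :: "'a ugraph \<Rightarrow> 'a set \<Rightarrow> 'a set \<Rightarrow> 'a set set" where
  "crossing_edges G X Y = {e \<in> edges G. e \<inter> X \<noteq> {} \<and> e \<inter> Y \<noteq> {}}"

definition bipartite :: "'a ugraph \<Rightarrow> bool" where
  "bipartite G \<longleftrightarrow> (\<exists>X Y. bipartition G X Y \<and> crossing_edges G X Y = edges G)"

definition maxcut :: "'a ugraph \<Rightarrow> nat" where
  "maxcut G = Max {card (crossing_edges G X Y) | X Y. bipartition G X Y}"

definition surplus :: "'a ugraph \<Rightarrow> real" where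
  "surplus G = real (maxcut G) - real (card (edges G)) / 2"

text \<open>Graphs on natural numbers represent all finite graphs up to isomorphism. The surpluses of
  graphs with \<open>m\<close> edges form a finite set of reals, so the infimum is a minimum whenever an
  \<open>H\<close>-free graph with \<open>m\<close> edges exists. If there is none (e.g. if \<open>H\<close> has no edges and \<open>m\<close> is
  large), the value is \<open>\<infinity>\<close>.\<close>

definition sp :: "nat \<Rightarrow> 'b ugraph \<Rightarrow> ereal" where
  "sp m H = (INF G \<in> {G :: nat ugraph. simple_graph G \<and> free_of H G \<and> card (edges G) = m}.
      ereal (surplus G))"

text \<open>The supremum is over a finite set of natural numbers, hence a maximum unless the set is
  empty. The latter happens only if \<open>F\<close> is edgeless with at most \<open>n\<close> vertices; the value is
  then \<open>0\<close>.\<close>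

definition ex :: "nat \<Rightarrow> 'b ugraph \<Rightarrow> nat" where
  "ex n F = Sup {card (edges G) | G :: nat ugraph.
      simple_graph G \<and> card (verts G) = n \<and> free_of F G}"

definition complete_graph :: "nat \<Rightarrow> nat ugraph" where
  "complete_graph n = Graph {..<n} {e. e \<subseteq> {..<n} \<and> card e = 2}"

definition complete_bipartite_graph :: "nat \<Rightarrow> nat \<Rightarrow> (nat + nat) ugraph" where
  "complete_bipartite_graph s t =
    Graph ({..<s} <+> {..<t}) {{Inl i, Inr j} | i j. i < s \<and> j < t}"

end

theory Submission
  imports Defs "HOL-Real_Asymp.Real_Asymp" "HOL-Algebra.Algebraic_Closure_Type" "HOL-Library.Z2"
begin

text \<open>
  Lower bound. Attach to each vertex \<open>w\<close> a vector \<open>u w\<close> of norm at most 1 and round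
  \<open>sin \<langle>g, u w\<rangle>\<close>, \<open>g\<close> Gaussian, to a sign: edges whose endpoints have negatively correlated
  vectors are cut more often than not. Neighbourhoods in \<open>G\<close> are \<open>B\<close>-free, so they span
  \<open>O(d\<^bsup>3/2\<^esup>)\<close> edges. Let \<open>D\<close> be the degeneracy of \<open>G\<close>. In a degeneracy ordering,
  \<open>u w = e w - \<epsilon> / \<surd>D * (\<Sum> e x)\<close> over the earlier neighbours \<open>x\<close> of \<open>w\<close> yields surplus
  \<open>\<Omega>(m / \<surd>D)\<close>. A subgraph of minimum degree \<open>D\<close> on \<open>N\<close> vertices with \<open>N\<close> small against
  \<open>D\<^bsup>3/2\<^esup>\<close> yields surplus \<open>\<Omega>(D\<^sup>2)\<close>, using for \<open>u w\<close> the centred indicator of \<open>D\<close> neighbours of \<open>w\<close>.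
  One of the two is \<open>\<Omega>(m\<^bsup>4/5\<^esup>)\<close>, according to whether \<open>D\<close> is below or above \<open>m\<^bsup>2/5\<^esup>\<close>.

  Upper bound. With \<open>q\<close> a power of two, there are a triangle-free and a \<open>K\<^bsub>3,3\<^esub>\<close>-free graph with
  \<open>\<Theta>(q\<^sup>5)\<close> edges and surplus \<open>O(q\<^sup>4)\<close>, and disjoint unions of such graphs realise every number of
  edges. The triangle-free graph places a random complete bipartite graph on each line of a
  point-line geometry without triangles; a union bound over all cuts controls its surplus. The
  \<open>K\<^bsub>3,3\<^esub>\<close>-free graph is the projective norm graph; the square of its adjacency matrix is
  explicit, so its nontrivial eigenvalues have modulus at most \<open>q\<close>.
\<close>

section \<open>Cuts as sign vectors\<close>

text \<open>The exponent comes from balancing \<open>m / sqrt D\<close> against \<open>D^2\<close>,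
  which meet at \<open>D = m^(2/5)\<close>. Both lower bounds rest on one trade-off. For an edge
  \<open>w x\<close> the inner product of the two vectors has a negative part, built into the
  construction, and a positive part governed by common neighbours. Summed over the edges the
  positive part counts triangles, and sparse neighbourhoods hold it to \<open>O(sqrt D)\<close>
  triangles per edge. Sine is the rounding function because its Gaussian correlation is exact,
  \<open>exp (- (|u|^2 + |v|^2) / 2) * sinh <u, v>\<close>, and because for finitely many random
  signs the same computation gives products of cosines. In the upper bound both graphs have about
  \<open>q^3\<close> vertices and average degree of order \<open>q^2\<close>, while the surplus is
  only \<open>O(q)\<close> per vertex; this gives \<open>q^4\<close> against
  \<open>(q^5)^(4/5)\<close>. Powers of two are dense enough, as consecutive sizes differ by a
  bounded factor, and characteristic two removes all minus signs and the loops of the norm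
  graph.\<close>

definition cut_form :: "'a ugraph \<Rightarrow> ('a \<Rightarrow> real) \<Rightarrow> real" where
  "cut_form G y = (\<Sum>e\<in>edges G. \<Prod>v\<in>e. y v)"

lemma simple_graph_finite_edges: "simple_graph G \<Longrightarrow> finite (edges G)"
  unfolding simple_graph_def by (metis Pow_iff finite_Pow_iff finite_subset subsetI)

lemma simple_graph_edgeE:
  assumes "simple_graph G" "e \<in> edges G"
  obtains a b where "e = {a, b}" "a \<noteq> b" "a \<in> verts G" "b \<in> verts G"
  using assms unfolding simple_graph_def by (metis card_2_iff insert_subset)

lemma card_crossing_edges:
  assumes G: "simple_graph G" and s: "\<And>v. v \<in> verts G \<Longrightarrow> s v \<in> {1, -1}"
  shows "real (card (crossing_edges G {v \<in> verts G. s v = 1} {v \<in> verts G. s v = -1})) =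
    (real (card (edges G)) - cut_form G s) / 2"
proof -
  let ?X = "{v \<in> verts G. s v = 1}" and ?Y = "{v \<in> verts G. s v = -1}"
  have fin: "finite (edges G)" using G by (rule simple_graph_finite_edges)
  have "real (card (crossing_edges G ?X ?Y)) =
      (\<Sum>e\<in>edges G. if e \<inter> ?X \<noteq> {} \<and> e \<inter> ?Y \<noteq> {} then 1 else 0)"
    using fin by (simp add: crossing_edges_def sum.If_cases Int_def conj_commute)
  also have "\<dots> = (\<Sum>e\<in>edges G. (1 - (\<Prod>v\<in>e. s v)) / 2)"
  proof (rule sum.cong[OF refl])
    fix e assume "e \<in> edges G"
    then obtain a b where e: "e = {a, b}" "a \<noteq> b" "a \<in> verts G" "b \<in> verts G"
      using G simple_graph_edgeE by metis
    have "s a \<in> {1,-1}" "s b \<in> {1,-1}" using s e by auto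
    then show "(if e \<inter> ?X \<noteq> {} \<and> e \<inter> ?Y \<noteq> {} then 1 else 0) = (1 - (\<Prod>v\<in>e. s v)) / 2"
      using e by auto
  qed
  also have "\<dots> = (real (card (edges G)) - cut_form G s) / 2"
    by (simp add: cut_form_def sum_divide_distrib[symmetric] sum_subtractf)
  finally show ?thesis .
qed

lemma finite_cut_sizes:
  assumes "simple_graph G"
  shows "finite {card (crossing_edges G A B) | A B. bipartition G A B}"
proof (rule finite_subset)
  show "{card (crossing_edges G A B) | A B. bipartition G A B} \<subseteq> {..card (edges G)}"
    using simple_graph_finite_edges[OF assms] by (auto simp: crossing_edges_def intro!: card_mono)
qed simp

lemma surplus_ge_cut_form_signs:
  assumes G: "simple_graph G" and s: "\<And>v. v \<in> verts G \<Longrightarrow> s v \<in> {1, -1}"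
  shows "- cut_form G s / 2 \<le> surplus G"
proof -
  let ?X = "{v \<in> verts G. s v = 1}" and ?Y = "{v \<in> verts G. s v = -1}"
  have "bipartition G ?X ?Y" using s by (auto simp: bipartition_def)
  then have "card (crossing_edges G ?X ?Y) \<le> maxcut G"
    unfolding maxcut_def using finite_cut_sizes[OF G] by (intro Max_ge) auto
  then have "real (card (crossing_edges G ?X ?Y)) \<le> real (maxcut G)" by simp
  then show ?thesis using card_crossing_edges[OF G s] by (simp add: surplus_def field_simps)
qed

lemma surplus_attained:
  assumes G: "simple_graph G"
  obtains s where "\<And>v. s v \<in> {1, -1 :: real}" "surplus G = - cut_form G s / 2"
proof -
  have "bipartition G (verts G) {}" by (simp add: bipartition_def)
  then have "{card (crossing_edges G A B) | A B. bipartition G A B} \<noteq> {}" by blast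
  from Max_in[OF finite_cut_sizes[OF G] this] obtain A B
    where XY: "bipartition G A B" "maxcut G = card (crossing_edges G A B)"
    unfolding maxcut_def by auto
  define s :: "'a \<Rightarrow> real" where "s v = (if v \<in> A then 1 else -1)" for v
  have "{v \<in> verts G. s v = 1} = A" "{v \<in> verts G. s v = -1} = B"
    using XY(1) by (auto simp: s_def bipartition_def)
  then have "real (maxcut G) = (real (card (edges G)) - cut_form G s) / 2"
    using card_crossing_edges[OF G, of s] XY(2) by (simp add: s_def)
  then have "surplus G = - cut_form G s / 2" by (simp add: surplus_def field_simps)
  then show ?thesis using that[of s] by (auto simp: s_def)
qed

text \<open>An edge never repeats a vertex, so the form is affine in each coordinate and some
  endpoint of \<open>[-1, 1]\<close> does at least as well. Leaving \<open>s\<close> equal to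
  \<open>y\<close> off \<open>A\<close> lets the induction treat one vertex at a time.\<close>

lemma cut_form_round:
  assumes G: "simple_graph G" and A: "finite A" "\<And>v. v \<in> A \<Longrightarrow> \<bar>y v\<bar> \<le> 1"
  shows "\<exists>s. (\<forall>v\<in>A. s v \<in> {1, -1}) \<and> (\<forall>v. v \<notin> A \<longrightarrow> s v = y v) \<and> cut_form G s \<le> cut_form G y"
  using A
proof (induction A rule: finite_induct)
  case empty
  then show ?case by auto
next
  case (insert a A)
  then obtain s where s: "\<forall>v\<in>A. s v \<in> {1, -1}" "\<forall>v. v \<notin> A \<longrightarrow> s v = y v"
    "cut_form G s \<le> cut_form G y" by auto
  define c0 where "c0 = (\<Sum>e\<in>{e \<in> edges G. a \<notin> e}. \<Prod>v\<in>e. s v)"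
  define c1 where "c1 = (\<Sum>e\<in>{e \<in> edges G. a \<in> e}. \<Prod>v\<in>e - {a}. s v)"
  have finE: "finite (edges G)" using G by (rule simple_graph_finite_edges)
  have fine: "finite e" if "e \<in> edges G" for e
    using G that by (auto elim: simple_graph_edgeE)
  have aff: "cut_form G (s(a := t)) = c0 + t * c1" for t
  proof -
    have "cut_form G (s(a := t)) = (\<Sum>e\<in>{e \<in> edges G. a \<notin> e}. \<Prod>v\<in>e. (s(a := t)) v)
        + (\<Sum>e\<in>{e \<in> edges G. a \<in> e}. \<Prod>v\<in>e. (s(a := t)) v)"
      unfolding cut_form_def using finE
      by (subst sum.union_disjoint[symmetric]) (auto intro!: sum.cong)
    also have "(\<Sum>e\<in>{e \<in> edges G. a \<notin> e}. \<Prod>v\<in>e. (s(a := t)) v) = c0"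
      unfolding c0_def by (intro sum.cong prod.cong) auto
    also have "(\<Sum>e\<in>{e \<in> edges G. a \<in> e}. \<Prod>v\<in>e. (s(a := t)) v) = t * c1"
      unfolding c1_def sum_distrib_left
    proof (intro sum.cong refl)
      fix e assume e: "e \<in> {e \<in> edges G. a \<in> e}"
      then have "(\<Prod>v\<in>e. (s(a := t)) v) = t * (\<Prod>v\<in>e - {a}. (s(a := t)) v)"
        using fine[of e] by (subst prod.remove[of e a]) auto
      also have "(\<Prod>v\<in>e - {a}. (s(a := t)) v) = (\<Prod>v\<in>e - {a}. s v)"
        by (intro prod.cong) auto
      finally show "(\<Prod>v\<in>e. (s(a := t)) v) = t * (\<Prod>v\<in>e - {a}. s v)" .
    qed
    finally show ?thesis .
  qed
  have a: "s a = y a" "\<bar>y a\<bar> \<le> 1" using s insert by auto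
  \<comment> \<open>The endpoint opposite in sign to the slope \<open>c1\<close>.\<close>
  define t :: real where "t = (if c1 \<ge> 0 then -1 else 1)"
  have "t * c1 \<le> y a * c1"
    using a(2) by (auto simp: t_def mult_right_mono abs_le_iff)
      (metis minus_le_iff mult.commute mult_left_mono mult_minus1_right)
  moreover have "cut_form G s = c0 + y a * c1"
    using aff[of "s a"] a fun_upd_triv[of s a] by metis
  ultimately have "cut_form G (s(a := t)) \<le> cut_form G y" using aff[of t] s(3) by linarith
  moreover have "t \<in> {1,-1}" by (auto simp: t_def)
  ultimately show ?case using s(1,2) by (intro exI[of _ "s(a := t)"]) (auto simp del: fun_upd_apply simp: fun_upd_def)
qed

lemma surplus_ge_cut_form:
  assumes G: "simple_graph G" and y: "\<And>v. v \<in> verts G \<Longrightarrow> \<bar>y v\<bar> \<le> 1"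
  shows "- cut_form G y / 2 \<le> surplus G"
proof -
  have "finite (verts G)" using G by (simp add: simple_graph_def)
  then have "\<exists>s. (\<forall>v\<in>verts G. s v \<in> {1, -1}) \<and> (\<forall>v. v \<notin> verts G \<longrightarrow> s v = y v) \<and>
      cut_form G s \<le> cut_form G y"
    by (rule cut_form_round[OF G]) (rule y)
  then obtain s where
    s: "\<forall>v\<in>verts G. s v \<in> {1, -1}" and le: "cut_form G s \<le> cut_form G y" by metis
  have "- cut_form G s / 2 \<le> surplus G"
    by (rule surplus_ge_cut_form_signs[OF G]) (use s in blast)
  with le show ?thesis by linarith
qed

text \<open>Each edge is listed once as an ordered pair, since the later estimates of inner products
  treat the two ends of an edge differently.\<close>

definition orientation :: "('a \<times> 'a) set \<Rightarrow> 'a ugraph \<Rightarrow> bool" where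
  "orientation P G \<longleftrightarrow> bij_betw (\<lambda>(a, b). {a, b}) P (edges G)"

lemma orientation_verts:
  assumes "simple_graph G" "orientation P G" "(a, b) \<in> P"
  shows "a \<in> verts G" "b \<in> verts G" "a \<noteq> b"
proof -
  have "{a, b} \<in> edges G" using assms(2,3) by (force simp: orientation_def bij_betw_def)
  then have "{a, b} \<subseteq> verts G" "card {a, b} = 2" using assms(1) by (auto simp: simple_graph_def)
  then show "a \<in> verts G" "b \<in> verts G" "a \<noteq> b" by auto
qed

lemma cut_form_orientation:
  assumes "simple_graph G" "orientation P G"
  shows "cut_form G y = (\<Sum>(a, b)\<in>P. y a * y b)"
proof -
  have "cut_form G y = (\<Sum>p\<in>P. \<Prod>v\<in>(\<lambda>(a, b). {a, b}) p. y v)"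
    unfolding cut_form_def using assms(2)
    by (intro sum.reindex_bij_betw[symmetric]) (simp add: orientation_def)
  also have "\<dots> = (\<Sum>(a, b)\<in>P. y a * y b)"
  proof (rule sum.cong[OF refl])
    fix p assume "p \<in> P"
    then obtain a b where p: "p = (a, b)" "(a, b) \<in> P" by (cases p) auto
    then have "a \<noteq> b" using orientation_verts[OF assms] by blast
    then show "(\<Prod>v\<in>(case p of (a, b) \<Rightarrow> {a, b}). y v) = (case p of (a, b) \<Rightarrow> y a * y b)"
      using p by simp
  qed
  finally show ?thesis .
qed

section \<open>Averaging over random signs\<close>

text \<open>Sign vectors are encoded as subsets, so that an expectation over uniform signs is a sum
  over \<open>Pow K\<close> divided by \<open>2 ^ card K\<close>.\<close>

definition signvec :: "'k set \<Rightarrow> 'k \<Rightarrow> real" where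
  "signvec S k = (if k \<in> S then 1 else -1)"

lemma sum_Pow_insert:
  assumes "finite F" "a \<notin> F"
  shows "(\<Sum>S\<in>Pow (insert a F). h S) = (\<Sum>S\<in>Pow F. h S + h (insert a S))"
proof -
  have "(\<Sum>S\<in>Pow (insert a F). h S) = (\<Sum>S\<in>Pow F. h S) + (\<Sum>S\<in>insert a ` Pow F. h S)"
    unfolding Pow_insert using assms by (intro sum.union_disjoint) auto
  also have "(\<Sum>S\<in>insert a ` Pow F. h S) = (\<Sum>S\<in>Pow F. h (insert a S))"
    using assms by (subst sum.reindex) (auto simp: inj_on_def o_def)
  finally show ?thesis by (simp add: sum.distrib)
qed

lemma sum_sign_insert:
  assumes "finite F" "a \<notin> F" "S \<subseteq> F"
  shows "(\<Sum>k\<in>insert a F. signvec S k * c k) = (\<Sum>k\<in>F. signvec S k * c k) - c a"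
    and "(\<Sum>k\<in>insert a F. signvec (insert a S) k * c k) = (\<Sum>k\<in>F. signvec S k * c k) + c a"
proof -
  have "(\<Sum>k\<in>F. signvec (insert a S) k * c k) = (\<Sum>k\<in>F. signvec S k * c k)"
    using assms by (intro sum.cong) (auto simp: signvec_def)
  then show "(\<Sum>k\<in>insert a F. signvec (insert a S) k * c k) = (\<Sum>k\<in>F. signvec S k * c k) + c a"
    using assms by (simp add: signvec_def)
  show "(\<Sum>k\<in>insert a F. signvec S k * c k) = (\<Sum>k\<in>F. signvec S k * c k) - c a"
    using assms by (auto simp: signvec_def)
qed

text \<open>The characteristic function of a sum of independent signs. One more sign replaces
  \<open>cos x\<close> by \<open>cos (x - c) + cos (x + c)\<close>, which is
  \<open>2 * cos c * cos x\<close>.\<close>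

lemma sum_signs_cos:
  assumes "finite K"
  shows "(\<Sum>S\<in>Pow K. cos (\<Sum>k\<in>K. signvec S k * c k)) = 2 ^ card K * (\<Prod>k\<in>K. cos (c k))"
  using assms
proof (induction K rule: finite_induct)
  case empty
  then show ?case by simp
next
  case (insert a F)
  have "(\<Sum>S\<in>Pow (insert a F). cos (\<Sum>k\<in>insert a F. signvec S k * c k)) =
      (\<Sum>S\<in>Pow F. 2 * cos (c a) * cos (\<Sum>k\<in>F. signvec S k * c k))"
    unfolding sum_Pow_insert[OF insert(1,2)]
    using sum_sign_insert[OF insert(1,2), of _ c]
    by (intro sum.cong refl) (simp add: cos_add cos_diff)
  then show ?case using insert by (simp add: sum_distrib_left[symmetric])
qed

lemma sum_signs_sin_sin:
  assumes "finite K"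
  shows "(\<Sum>S\<in>Pow K. sin (\<Sum>k\<in>K. signvec S k * a k) * sin (\<Sum>k\<in>K. signvec S k * b k)) =
    2 ^ card K * (((\<Prod>k\<in>K. cos (a k - b k)) - (\<Prod>k\<in>K. cos (a k + b k))) / 2)"
proof -
  have "(\<Sum>S\<in>Pow K. sin (\<Sum>k\<in>K. signvec S k * a k) * sin (\<Sum>k\<in>K. signvec S k * b k)) =
    (\<Sum>S\<in>Pow K. (cos (\<Sum>k\<in>K. signvec S k * (a k - b k)) - cos (\<Sum>k\<in>K. signvec S k * (a k + b k))) / 2)"
    by (simp add: sin_times_sin right_diff_distrib distrib_left sum_subtractf sum.distrib)
  also have "\<dots> = (2 ^ card K * (\<Prod>k\<in>K. cos (a k - b k)) - 2 ^ card K * (\<Prod>k\<in>K. cos (a k + b k))) / 2"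
    by (simp only: sum_divide_distrib[symmetric] sum_subtractf sum_signs_cos[OF assms])
  finally show ?thesis by (simp add: algebra_simps)
qed

text \<open>First moment method: sines are admissible biases, so the average of the form over all
  sign vectors is a valid bound.\<close>

lemma surplus_ge_signs:
  assumes G: "simple_graph G" and P: "orientation P G" and K: "finite K"
  shows "- (\<Sum>(w, x)\<in>P. ((\<Prod>k\<in>K. cos (u w k - u x k)) - (\<Prod>k\<in>K. cos (u w k + u x k))) / 2) / 2
    \<le> surplus G" (is "- ?A / 2 \<le> _")
proof -
  let ?y = "\<lambda>S w. sin (\<Sum>k\<in>K. signvec S k * u w k)"
  have "(\<Sum>S\<in>Pow K. - cut_form G (?y S) / 2) \<le> (\<Sum>S\<in>Pow K. surplus G)"
    by (intro sum_mono surplus_ge_cut_form[OF G]) auto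
  also have "\<dots> = 2 ^ card K * surplus G" by (simp add: card_Pow K)
  also have "(\<Sum>S\<in>Pow K. - cut_form G (?y S) / 2) = - (\<Sum>S\<in>Pow K. cut_form G (?y S)) / 2"
    by (simp add: sum_divide_distrib sum_negf)
  also have "(\<Sum>S\<in>Pow K. cut_form G (?y S)) =
      (\<Sum>S\<in>Pow K. \<Sum>p\<in>P. ?y S (fst p) * ?y S (snd p))"
    unfolding cut_form_orientation[OF G P] by (simp add: case_prod_beta)
  also have "\<dots> = (\<Sum>p\<in>P. \<Sum>S\<in>Pow K. ?y S (fst p) * ?y S (snd p))"
    by (rule sum.swap)
  also have "\<dots> = 2 ^ card K * ?A"
    unfolding sum_signs_sin_sin[OF K] by (simp add: sum_distrib_left case_prod_beta)
  finally have "2 ^ card K * (- ?A / 2) \<le> 2 ^ card K * surplus G" by (simp add: algebra_simps)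
  then show ?thesis by (subst (asm) mult_le_cancel_left_pos) simp_all
qed

section \<open>From random signs to a Gaussian vector, by the central limit theorem for
  cosines\<close>

lemma cos_power_tendsto:
  fixes c :: real
  shows "(\<lambda>R::nat. cos (c / sqrt (real R)) ^ R) \<longlonglongrightarrow> exp (- c\<^sup>2 / 2)"
proof (cases "c = 0")
  case False
  then consider "c > 0" | "c < 0" by linarith
  then have "(\<lambda>R::nat. cos (c / sqrt (real R)) ^ R) \<longlonglongrightarrow> exp (- (c * c / 2))"
    by cases real_asymp+
  then show ?thesis by (simp add: power2_eq_square)
qed simp

text \<open>Rounding a vector \<open>u w\<close> to the bias \<open>sin \<langle>g, u w\<rangle>\<close> with a Gaussian \<open>g\<close>
  has an exact correlation formula. The Gaussian is the limit of normalised sums of \<open>R\<close>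
  random signs in each coordinate, so no integration is needed.\<close>

lemma surplus_ge_sinh:
  assumes G: "simple_graph G" and P: "orientation P G" and K: "finite K"
  shows "- (\<Sum>(w, x)\<in>P. exp (- ((\<Sum>k\<in>K. (u w k)\<^sup>2) + (\<Sum>k\<in>K. (u x k)\<^sup>2)) / 2) *
    sinh (\<Sum>k\<in>K. u w k * u x k)) / 2 \<le> surplus G"
proof -
  let ?f = "\<lambda>R w x. ((\<Prod>k\<in>K. cos ((u w k - u x k) / sqrt (real R)) ^ R) -
      (\<Prod>k\<in>K. cos ((u w k + u x k) / sqrt (real R)) ^ R)) / 2"
  have "- (\<Sum>(w, x)\<in>P. ?f R w x) / 2 \<le> surplus G" for R
  proof -
    \<comment> \<open>The \<open>R\<close> signs attached to a coordinate share its coefficient, so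
      their cosines combine into a power.\<close>
    have pr: "(\<Prod>p\<in>K \<times> {..<R}. cos (h (fst p))) = (\<Prod>k\<in>K. cos (h k) ^ R)" for h :: "_ \<Rightarrow> real"
    proof -
      have "(\<Prod>p\<in>K \<times> {..<R}. cos (h (fst p))) = (\<Prod>k\<in>K. \<Prod>j\<in>{..<R}. cos (h k))"
        unfolding prod.cartesian_product by (intro prod.cong) auto
      then show ?thesis by simp
    qed
    show ?thesis
      using surplus_ge_signs[OF G P, of "K \<times> {..<R}" "\<lambda>w p. u w (fst p) / sqrt (real R)"] K
      by (simp add: pr[of "\<lambda>k. (u _ k - u _ k) / sqrt (real R)"] pr[of "\<lambda>k. (u _ k + u _ k) / sqrt (real R)"]
        diff_divide_distrib[symmetric] add_divide_distrib[symmetric])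
  qed
  moreover have "(\<lambda>R. - (\<Sum>(w, x)\<in>P. ?f R w x) / 2) \<longlonglongrightarrow> - (\<Sum>(w, x)\<in>P.
     ((\<Prod>k\<in>K. exp (- (u w k - u x k)\<^sup>2 / 2)) - (\<Prod>k\<in>K. exp (- (u w k + u x k)\<^sup>2 / 2))) / 2) / 2"
    unfolding case_prod_beta
    by (intro tendsto_intros tendsto_sum tendsto_prod cos_power_tendsto) auto
  ultimately have "- (\<Sum>(w, x)\<in>P. ((\<Prod>k\<in>K. exp (- (u w k - u x k)\<^sup>2 / 2)) -
     (\<Prod>k\<in>K. exp (- (u w k + u x k)\<^sup>2 / 2))) / 2) / 2 \<le> surplus G"
    by (intro LIMSEQ_le_const2) auto
  also have "(\<Sum>(w, x)\<in>P. ((\<Prod>k\<in>K. exp (- (u w k - u x k)\<^sup>2 / 2)) -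
      (\<Prod>k\<in>K. exp (- (u w k + u x k)\<^sup>2 / 2))) / 2) =
    (\<Sum>(w, x)\<in>P. exp (- ((\<Sum>k\<in>K. (u w k)\<^sup>2) + (\<Sum>k\<in>K. (u x k)\<^sup>2)) / 2) *
    sinh (\<Sum>k\<in>K. u w k * u x k))"
  proof (rule sum.cong[OF refl], clarify)
    fix w x
    have "(\<Sum>k\<in>K. - (u w k - u x k)\<^sup>2 / 2) =
        - ((\<Sum>k\<in>K. (u w k)\<^sup>2) + (\<Sum>k\<in>K. (u x k)\<^sup>2)) / 2 + (\<Sum>k\<in>K. u w k * u x k)"
      unfolding sum.distrib[symmetric] sum_divide_distrib sum_negf[symmetric]
      by (intro sum.cong) (auto simp: power2_eq_square field_simps)
    moreover have "(\<Sum>k\<in>K. - (u w k + u x k)\<^sup>2 / 2) =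
        - ((\<Sum>k\<in>K. (u w k)\<^sup>2) + (\<Sum>k\<in>K. (u x k)\<^sup>2)) / 2 - (\<Sum>k\<in>K. u w k * u x k)"
      unfolding sum.distrib[symmetric] sum_divide_distrib sum_negf[symmetric] sum_subtractf[symmetric]
      by (intro sum.cong) (auto simp: power2_eq_square field_simps)
    ultimately show "((\<Prod>k\<in>K. exp (- (u w k - u x k)\<^sup>2 / 2)) -
      (\<Prod>k\<in>K. exp (- (u w k + u x k)\<^sup>2 / 2))) / 2 =
      exp (- ((\<Sum>k\<in>K. (u w k)\<^sup>2) + (\<Sum>k\<in>K. (u x k)\<^sup>2)) / 2) * sinh (\<Sum>k\<in>K. u w k * u x k)"
      using K by (simp only: exp_sum[symmetric] sinh_field_def diff_conv_add_uminus exp_add)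
        (simp add: algebra_simps)
  qed
  finally show ?thesis .
qed

text \<open>In the unit ball the correlation formula is linear up to constants. A negative inner
  product keeps at least a third of its size, a positive one at most doubles, and the surplus is
  minus half of the form; hence gains \<open>a\<close> count with \<open>1/6\<close> and losses
  \<open>b\<close> with \<open>1\<close>. They are kept apart because only their sums over all edges
  can be compared.\<close>

lemma surplus_ge_vectors:
  assumes G: "simple_graph G" and P: "orientation P G" and K: "finite K"
    and norm: "\<And>w. w \<in> verts G \<Longrightarrow> (\<Sum>k\<in>K. (u w k)\<^sup>2) \<le> 1"
    and inner: "\<And>w x. (w, x) \<in> P \<Longrightarrow> (\<Sum>k\<in>K. u w k * u x k) \<le> b w x - a w x"
    and nonneg: "\<And>w x. (w, x) \<in> P \<Longrightarrow> 0 \<le> a w x \<and> 0 \<le> b w x"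
  shows "(\<Sum>(w, x)\<in>P. a w x / 6 - b w x) \<le> surplus G"
proof -
  have pt: "exp (- ((\<Sum>k\<in>K. (u w k)\<^sup>2) + (\<Sum>k\<in>K. (u x k)\<^sup>2)) / 2) * sinh (\<Sum>k\<in>K. u w k * u x k)
      \<le> 2 * b w x - a w x / 3" if wx: "(w, x) \<in> P" for w x
  proof -
    define n where "n = ((\<Sum>k\<in>K. (u w k)\<^sup>2) + (\<Sum>k\<in>K. (u x k)\<^sup>2)) / 2"
    define t where "t = (\<Sum>k\<in>K. u w k * u x k)"
    have "w \<in> verts G" "x \<in> verts G" using orientation_verts[OF G P wx] by auto
    then have n: "0 \<le> n" "n \<le> 1" using norm[of w] norm[of x] by (auto simp: n_def sum_nonneg)
    \<comment> \<open>Here \<open>n\<close> is the mean of the two squared norms, so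
      \<open>t \<le> 1\<close> and the quadratic bound on \<open>exp t\<close> applies.\<close>
    have tn: "t \<le> n"
    proof -
      have "0 \<le> (\<Sum>k\<in>K. (u w k - u x k)\<^sup>2)" by (simp add: sum_nonneg)
      also have "\<dots> = 2 * n - 2 * t"
        by (simp add: n_def t_def power2_diff sum.distrib sum_subtractf sum_distrib_left[symmetric] mult.assoc)
      finally show ?thesis by simp
    qed
    have ab: "t \<le> b w x - a w x" "0 \<le> a w x" "0 \<le> b w x"
      using inner[OF wx] nonneg[OF wx] by (auto simp: t_def)
    have e3: "1 / 3 \<le> exp (- n)"
    proof -
      have "exp n \<le> 3" using n exp_le by (meson exp_le_cancel_iff order_trans)
      then show ?thesis by (simp add: exp_minus field_simps)
    qed
    have "exp (- n) * sinh t \<le> 2 * b w x - a w x / 3"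
    proof (cases "t \<ge> 0")
      case True
      have "exp t \<le> 1 + t + t\<^sup>2" using True n tn exp_bound by simp
      moreover have "exp (- t) \<ge> 1 - t" using exp_ge_add_one_self[of "- t"] by simp
      ultimately have "sinh t \<le> t + t\<^sup>2 / 2" by (simp add: sinh_field_def)
      also have "t\<^sup>2 \<le> t" using True n tn by (simp add: power2_eq_square mult_left_le)
      finally have "sinh t \<le> 2 * t" using True by simp
      moreover have "exp (- n) * sinh t \<le> 1 * sinh t"
        using n True by (intro mult_right_mono) auto
      ultimately show ?thesis using ab by linarith
    next
      case False
      then have "sinh t \<le> t"
        using real_le_x_sinh[of "- t"] by (simp add: sinh_field_def exp_minus)
      then have "exp (- n) * sinh t \<le> exp (- n) * t" by (simp add: mult_left_mono)
      also have "\<dots> \<le> (1 / 3) * t" using e3 False by (intro mult_right_mono_neg) auto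
      finally show ?thesis using ab by linarith
    qed
    then show ?thesis by (simp only: n_def t_def minus_divide_left)
  qed
  have "(\<Sum>(w, x)\<in>P. a w x / 6 - b w x) = - (\<Sum>(w, x)\<in>P. 2 * b w x - a w x / 3) / 2"
    unfolding sum_divide_distrib sum_negf[symmetric]
    by (intro sum.cong) (auto simp: field_simps)
  also have "\<dots> \<le> - (\<Sum>(w, x)\<in>P. exp (- ((\<Sum>k\<in>K. (u w k)\<^sup>2) + (\<Sum>k\<in>K. (u x k)\<^sup>2)) / 2) *
    sinh (\<Sum>k\<in>K. u w k * u x k)) / 2"
    using pt by (auto intro!: sum_mono)
  also have "\<dots> \<le> surplus G" by (rule surplus_ge_sinh[OF G P K])
  finally show ?thesis .
qed

section \<open>Graphs with sparse neighbourhoods\<close>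

definition nbh :: "'a ugraph \<Rightarrow> 'a \<Rightarrow> 'a set" where
  "nbh G w = {x. {w, x} \<in> edges G}"

lemma nbh_sym: "x \<in> nbh G w \<longleftrightarrow> w \<in> nbh G x"
  by (simp add: nbh_def insert_commute)

lemma nbh_simple:
  assumes "simple_graph G"
  shows "nbh G w \<subseteq> verts G" "w \<notin> nbh G w" "finite (nbh G w)"
    and "x \<in> nbh G w \<Longrightarrow> w \<in> verts G"
proof -
  have *: "x \<in> verts G \<and> w \<in> verts G \<and> x \<noteq> w" if "x \<in> nbh G w" for x w
  proof -
    have "{w, x} \<subseteq> verts G" "card {w, x} = 2"
      using that assms by (auto simp: nbh_def simple_graph_def)
    then show ?thesis by auto
  qed
  then show "nbh G w \<subseteq> verts G" "w \<notin> nbh G w" "x \<in> nbh G w \<Longrightarrow> w \<in> verts G" by blast+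
  then show "finite (nbh G w)" using assms by (auto simp: simple_graph_def intro: finite_subset)
qed

section \<open>Degeneracy orderings\<close>

lemma degeneracy_ordering:
  assumes "finite V" and "\<And>S. S \<subseteq> V \<Longrightarrow> S \<noteq> {} \<Longrightarrow> \<exists>w\<in>S. card (N w \<inter> S) \<le> D"
  shows "\<exists>r :: 'a \<Rightarrow> nat. inj_on r V \<and> (\<forall>w\<in>V. card {x \<in> N w \<inter> V. r x < r w} \<le> D)"
  using assms
proof (induction V rule: finite_psubset_induct)
  case (psubset V)
  show ?case
  proof (cases "V = {}")
    case False
    then obtain w where w: "w \<in> V" "card (N w \<inter> V) \<le> D" using psubset.prems by blast
    let ?V = "V - {w}"
    have "\<exists>r :: 'a \<Rightarrow> nat. inj_on r ?V \<and> (\<forall>w\<in>?V. card {x \<in> N w \<inter> ?V. r x < r w} \<le> D)"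
      by (rule psubset.IH) (use w psubset.prems in auto)
    then obtain r :: "'a \<Rightarrow> nat" where r: "inj_on r ?V" "\<And>z. z \<in> ?V \<Longrightarrow> card {x \<in> N z \<inter> ?V. r x < r z} \<le> D"
      by blast
    \<comment> \<open>The removed vertex \<open>w\<close>, of small degree, is ranked last: one more
      than the sum of the other ranks exceeds each of them.\<close>
    define r' where "r' = r(w := Suc (sum r ?V))"
    have less: "r' z < r' w" if "z \<in> ?V" for z
      using that psubset.hyps member_le_sum[of z ?V r] by (auto simp: r'_def)
    have same: "r' z = r z" if "z \<in> ?V" for z using that by (auto simp: r'_def)
    have "inj_on r' V"
    proof (rule inj_onI)
      fix a b assume ab: "a \<in> V" "b \<in> V" "r' a = r' b"
      show "a = b"
      proof (cases "a = w \<or> b = w")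
        case True
        then show ?thesis using ab less[of a] less[of b] by force
      next
        case False
        then show ?thesis using ab same[of a] same[of b] inj_onD[OF r(1), of a b] by simp
      qed
    qed
    moreover have "card {x \<in> N z \<inter> V. r' x < r' z} \<le> D" if z: "z \<in> V" for z
    proof (cases "z = w")
      case True
      have "card {x \<in> N z \<inter> V. r' x < r' z} \<le> card (N w \<inter> V)"
        using True psubset.hyps by (intro card_mono) auto
      then show ?thesis using w by simp
    next
      case False
      then have "{x \<in> N z \<inter> V. r' x < r' z} = {x \<in> N z \<inter> ?V. r x < r z}"
        using z less[of z] same[of z] less_not_sym by (auto simp: r'_def)
      then show ?thesis using r(2)[of z] z False by simp
    qed
    ultimately show ?thesis by blast
  qed auto
qed

definition lnbh :: "'a ugraph \<Rightarrow> ('a \<Rightarrow> nat) \<Rightarrow> 'a \<Rightarrow> 'a set" where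
  "lnbh G r w = {x \<in> nbh G w. r x < r w}"

definition arcs :: "'a ugraph \<Rightarrow> ('a \<Rightarrow> nat) \<Rightarrow> ('a \<times> 'a) set" where
  "arcs G r = {(w, x). x \<in> lnbh G r w}"

definition edges_in :: "'a ugraph \<Rightarrow> 'a set \<Rightarrow> 'a set set" where
  "edges_in G S = {e \<in> edges G. e \<subseteq> S}"

text \<open>\<open>sparse\<close> is what remains of the forbidden subgraph. It is required for all
  subsets of a neighbourhood, because it gets applied to the earlier neighbours only. The power
  \<open>3/2\<close> is split as \<open>n * sqrt n\<close> so that the root can be bounded by
  \<open>sqrt D\<close> while the factor \<open>n\<close> stays available for summation.\<close>

locale ranked_graph =
  fixes G :: "'a ugraph" and r :: "'a \<Rightarrow> nat" and D :: nat and C :: real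
  assumes G: "simple_graph G"
    and r_inj: "inj_on r (verts G)"
    and lnbh_le: "w \<in> verts G \<Longrightarrow> card (lnbh G r w) \<le> D"
    and D_pos: "D \<ge> 1"
    and C_ge: "C \<ge> 1"
    and sparse: "S \<subseteq> nbh G w \<Longrightarrow> real (card (edges_in G S)) \<le> C * (real (card S) * sqrt (real (card S)))"
begin

lemma finV: "finite (verts G)" using G by (simp add: simple_graph_def)

lemma finite_lnbh [simp]: "finite (lnbh G r w)"
  using nbh_simple[OF G] by (auto simp: lnbh_def)

lemma lnbh_verts: "lnbh G r w \<subseteq> verts G" "x \<in> lnbh G r w \<Longrightarrow> w \<in> verts G"
  using nbh_simple[OF G] by (auto simp: lnbh_def)

lemma arcs_Sigma: "arcs G r = (SIGMA w:verts G. lnbh G r w)"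
  using lnbh_verts by (auto simp: arcs_def)

lemma finite_arcs [simp]: "finite (arcs G r)"
  unfolding arcs_Sigma using finV by auto

lemma orientation_arcs: "orientation (arcs G r) G"
  unfolding orientation_def bij_betw_def
proof
  show "inj_on (\<lambda>(a, b). {a, b}) (arcs G r)"
    by (auto simp: inj_on_def arcs_def lnbh_def doubleton_eq_iff)
  show "(\<lambda>(a, b). {a, b}) ` arcs G r = edges G"
  proof (intro equalityI subsetI)
    fix e assume e: "e \<in> edges G"
    then obtain a b where ab: "e = {a, b}" "a \<noteq> b" "a \<in> verts G" "b \<in> verts G"
      using G simple_graph_edgeE by metis
    then have "r a \<noteq> r b" using r_inj by (auto simp: inj_on_def)
    then have "(a, b) \<in> arcs G r \<or> (b, a) \<in> arcs G r"
      using e ab by (auto simp: arcs_def lnbh_def nbh_def insert_commute)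
    then show "e \<in> (\<lambda>(a, b). {a, b}) ` arcs G r"
      using ab by (force simp: insert_commute)
  qed (auto simp: arcs_def lnbh_def nbh_def)
qed

lemma card_arcs: "card (arcs G r) = card (edges G)"
  using orientation_arcs bij_betw_same_card unfolding orientation_def by blast

lemma card_arcs_in: "card (arcs G r \<inter> S \<times> S) \<le> card (edges_in G S)"
proof (rule card_inj_on_le)
  show "inj_on (\<lambda>(a, b). {a, b}) (arcs G r \<inter> S \<times> S)"
    using orientation_arcs unfolding orientation_def bij_betw_def by (auto intro: inj_on_subset)
  show "(\<lambda>(a, b). {a, b}) ` (arcs G r \<inter> S \<times> S) \<subseteq> edges_in G S"
    by (auto simp: edges_in_def arcs_def lnbh_def nbh_def)
  show "finite (edges_in G S)" using simple_graph_finite_edges[OF G] by (auto simp: edges_in_def)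
qed

text \<open>Linear in \<open>card A\<close>: summed over \<open>w\<close>, the right-hand side
  becomes a multiple of the number of arcs.\<close>

lemma card_arcs_lnbh:
  assumes "w \<in> verts G" "A \<subseteq> lnbh G r w"
  shows "real (card (arcs G r \<inter> A \<times> A)) \<le> C * sqrt (real D) * real (card A)"
proof -
  have "A \<subseteq> nbh G w" using assms by (auto simp: lnbh_def)
  then have "real (card (arcs G r \<inter> A \<times> A)) \<le> C * (real (card A) * sqrt (real (card A)))"
    using sparse[of A w] card_arcs_in[of A] by linarith
  also have "card A \<le> D" using card_mono[OF finite_lnbh assms(2)] lnbh_le[OF assms(1)] by linarith
  then have "C * (real (card A) * sqrt (real (card A))) \<le> C * (real (card A) * sqrt (real D))"
    using C_ge by (intro mult_left_mono) auto
  finally show ?thesis by (simp add: mult_ac)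
qed

text \<open>An arc \<open>(w, x)\<close> has inner product \<open>- c / 2\<close> plus
  \<open>c^2 / 2\<close> times the number of common earlier neighbours. The latter numbers add up to
  the number of triangles, at most \<open>C * sqrt D\<close> per edge.\<close>

lemma surplus_degenerate: "real (card (edges G)) / (288 * C * sqrt (real D)) \<le> surplus G"
proof -
  \<comment> \<open>This makes the loss per edge, \<open>c^2 / 2 * C * sqrt D = c / 24\<close>, half
    of the gain \<open>(c / 2) / 6 = c / 12\<close>. What remains is \<open>c / 24\<close>, whence
    288 = 12 * 24.\<close>
  define c where "c = 1 / (12 * C) / sqrt (real D)"
  have sD: "sqrt (real D) \<ge> 1" using D_pos by simp
  have c: "0 < c" "c \<le> 1"
  proof -
    show "0 < c" using C_ge sD by (simp add: c_def)
    have "1 / (12 * C) \<le> 1" using C_ge by (simp add: field_simps)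
    then show "c \<le> 1" using sD C_ge unfolding c_def by (intro divide_le_eq_1[THEN iffD2]) linarith
  qed
  have cD: "c\<^sup>2 * real D \<le> 1"
  proof -
    have "c\<^sup>2 * real D = (1 / (12 * C))\<^sup>2" using D_pos by (simp add: c_def power_divide power_mult_distrib)
    also have "\<dots> \<le> 1" using C_ge by (intro power_le_one) (auto simp: field_simps)
    finally show ?thesis .
  qed
  \<comment> \<open>The factor \<open>1 / sqrt 2\<close> brings the squared norm, at most
    \<open>(1 + c^2 * D) / 2\<close>, below 1.\<close>
  define u :: "'a \<Rightarrow> 'a \<Rightarrow> real" where
    "u w k = (of_bool (k = w) - c * of_bool (k \<in> lnbh G r w)) / sqrt 2" for w k
  define T where "T = (\<Sum>(w, x)\<in>arcs G r. real (card (lnbh G r w \<inter> lnbh G r x)))"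
  have norm: "(\<Sum>k\<in>verts G. (u w k)\<^sup>2) \<le> 1" if w: "w \<in> verts G" for w
  proof -
    have "(\<Sum>k\<in>verts G. (u w k)\<^sup>2) = (\<Sum>k\<in>verts G. of_bool (k = w) / 2 + c\<^sup>2 / 2 * of_bool (k \<in> lnbh G r w))"
      by (intro sum.cong) (auto simp: u_def lnbh_def power_divide)
    also have "\<dots> = 1 / 2 + c\<^sup>2 / 2 * real (card (verts G \<inter> lnbh G r w))"
      using finV w by (simp add: sum.distrib sum_distrib_left[symmetric] sum_divide_distrib[symmetric])
    also have "verts G \<inter> lnbh G r w = lnbh G r w" using lnbh_verts by auto
    also have "c\<^sup>2 / 2 * real (card (lnbh G r w)) \<le> c\<^sup>2 / 2 * real D"
      using lnbh_le[OF w] by (intro mult_left_mono) auto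
    finally show ?thesis using cD by simp
  qed
  have inner: "(\<Sum>k\<in>verts G. u w k * u x k) \<le> c\<^sup>2 / 2 * real (card (lnbh G r w \<inter> lnbh G r x)) - c / 2"
    if wx: "(w, x) \<in> arcs G r" for w x
  proof -
    have x: "x \<in> verts G" "x \<in> lnbh G r w" using wx lnbh_verts by (auto simp: arcs_def)
    \<comment> \<open>The ranks decide the cross terms: \<open>x\<close> is an earlier neighbour of
      \<open>w\<close> and contributes \<open>- c / 2\<close>, while \<open>w\<close> is not one of
      \<open>x\<close>.\<close>
    have "(\<Sum>k\<in>verts G. u w k * u x k) = (\<Sum>k\<in>verts G.
        c\<^sup>2 / 2 * of_bool (k \<in> lnbh G r w \<inter> lnbh G r x) - c / 2 * of_bool (k = x))"
      using x by (intro sum.cong) (auto simp: u_def lnbh_def power2_eq_square)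
    also have "\<dots> = c\<^sup>2 / 2 * (\<Sum>k\<in>verts G. of_bool (k \<in> lnbh G r w \<inter> lnbh G r x))
        - c / 2 * (\<Sum>k\<in>verts G. of_bool (k = x))"
      by (simp only: sum_subtractf sum_distrib_left)
    also have "\<dots> = c\<^sup>2 / 2 * real (card (verts G \<inter> (lnbh G r w \<inter> lnbh G r x))) - c / 2"
      using finV x by (simp add: Int_def of_bool_def sum.delta sum.If_cases)
    also have "verts G \<inter> (lnbh G r w \<inter> lnbh G r x) = lnbh G r w \<inter> lnbh G r x"
      using lnbh_verts by auto
    finally show ?thesis by simp
  qed
  have T: "T \<le> C * sqrt (real D) * real (card (edges G))"
  proof -
    have "T = (\<Sum>w\<in>verts G. \<Sum>x\<in>lnbh G r w. real (card (lnbh G r w \<inter> lnbh G r x)))"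
      unfolding T_def arcs_Sigma using finV by (simp add: sum.Sigma)
    also have "\<dots> \<le> (\<Sum>w\<in>verts G. C * sqrt (real D) * real (card (lnbh G r w)))"
    proof (rule sum_mono)
      fix w assume w: "w \<in> verts G"
      let ?A = "lnbh G r w"
      have "(\<Sum>x\<in>?A. real (card (?A \<inter> lnbh G r x))) = real (card (SIGMA x:?A. ?A \<inter> lnbh G r x))"
        by simp
      \<comment> \<open>Each triangle is counted at its last vertex \<open>w\<close>, as an arc
        inside the earlier neighbourhood of \<open>w\<close>.\<close>
      also have "(SIGMA x:?A. ?A \<inter> lnbh G r x) = arcs G r \<inter> ?A \<times> ?A" by (auto simp: arcs_def)
      finally show "(\<Sum>x\<in>?A. real (card (?A \<inter> lnbh G r x))) \<le> C * sqrt (real D) * real (card ?A)"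
        using card_arcs_lnbh[OF w subset_refl] by simp
    qed
    also have "\<dots> = C * sqrt (real D) * real (card (arcs G r))"
      unfolding arcs_Sigma using finV by (simp add: sum_distrib_left)
    finally show ?thesis by (simp add: card_arcs)
  qed
  have "real (card (edges G)) * (c / 12) - c\<^sup>2 / 2 * T =
     (\<Sum>(w, x)\<in>arcs G r. (c / 2) / 6 - c\<^sup>2 / 2 * real (card (lnbh G r w \<inter> lnbh G r x)))"
    by (simp add: T_def case_prod_beta sum_subtractf sum_distrib_left card_arcs)
  also have "\<dots> \<le> surplus G"
    by (rule surplus_ge_vectors[OF G orientation_arcs finV norm inner]) (use c in auto)
  finally have "real (card (edges G)) * (c / 12) - c\<^sup>2 / 2 * T \<le> surplus G" .
  moreover have "c\<^sup>2 / 2 * T \<le> c\<^sup>2 / 2 * (C * sqrt (real D) * real (card (edges G)))"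
    using T by (intro mult_left_mono) auto
  moreover have "c\<^sup>2 / 2 * (C * sqrt (real D) * real (card (edges G))) = real (card (edges G)) * (c / 24)"
  proof -
    have "c * (C * sqrt (real D)) = 1 / 12" using C_ge sD by (simp add: c_def)
    moreover have "c\<^sup>2 / 2 * (C * sqrt (real D) * real (card (edges G))) =
        (c * (C * sqrt (real D))) * (c / 2) * real (card (edges G))"
      by (simp add: power2_eq_square)
    ultimately show ?thesis by (simp only:) simp
  qed
  moreover have "real (card (edges G)) / (288 * C * sqrt (real D)) = real (card (edges G)) * (c / 24)"
    by (simp add: c_def)
  moreover have "real (card (edges G)) * (c / 12) = real (card (edges G)) * (c / 24) + real (card (edges G)) * (c / 24)"
    by simp
  ultimately show ?thesis by linarith
qed

text \<open>Each triangle in \<open>S\<close> is counted once for each of its three edges, hence the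
  factor 3. Its last vertex sees the other two as an arc among earlier neighbours, and such arcs are
  bounded by \<open>card_arcs_lnbh\<close>.\<close>

lemma card_triangles:
  assumes S: "S \<subseteq> verts G"
  shows "real (card {((w, x), y). (w, x) \<in> arcs G r \<inter> S \<times> S \<and> y \<in> nbh G w \<inter> nbh G x \<inter> S}) \<le>
    3 * C * sqrt (real D) * real (card (arcs G r \<inter> S \<times> S))" (is "real (card ?Z) \<le> _")
proof -
  let ?L = "\<lambda>w. lnbh G r w \<inter> S"
  define U where "U = (SIGMA w:S. arcs G r \<inter> ?L w \<times> ?L w)"
  have finS: "finite S" using S finV finite_subset by blast
  have finU: "finite U" unfolding U_def using finS by (intro finite_SigmaI) auto
  have "?Z \<subseteq> (\<lambda>(w, x, y). ((w, x), y)) ` U \<union> (\<lambda>(w, y, x). ((w, x), y)) ` U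
      \<union> (\<lambda>(y, w, x). ((w, x), y)) ` U"
  proof (intro subsetI)
    fix z assume "z \<in> ?Z"
    then obtain w x y where z: "z = ((w, x), y)" "(w, x) \<in> arcs G r" "w \<in> S" "x \<in> S"
      "y \<in> nbh G w" "y \<in> nbh G x" "y \<in> S" by auto
    have ne: "w \<noteq> y" "x \<noteq> y" using z nbh_simple[OF G] by auto
    then have rne: "r w \<noteq> r y" "r x \<noteq> r y" using z S r_inj by (auto simp: inj_on_def)
    have wx: "x \<in> nbh G w" "r x < r w" using z by (auto simp: arcs_def lnbh_def)
    have sy: "w \<in> nbh G y" "x \<in> nbh G y" "w \<in> nbh G x" using z wx nbh_sym by fast+
    \<comment> \<open>The three maps above correspond to \<open>y\<close> being the first, the
      middle or the last vertex of the triangle.\<close>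
    consider "r y < r x" | "r x < r y" "r y < r w" | "r w < r y" using rne by linarith
    then show "z \<in> (\<lambda>(w, x, y). ((w, x), y)) ` U \<union> (\<lambda>(w, y, x). ((w, x), y)) ` U
      \<union> (\<lambda>(y, w, x). ((w, x), y)) ` U"
    proof cases
      case 1
      then have "(w, x, y) \<in> U" using z wx sy by (auto simp: U_def lnbh_def arcs_def)
      then show ?thesis using z(1) by force
    next
      case 2
      then have "(w, y, x) \<in> U" using z wx sy by (auto simp: U_def lnbh_def arcs_def)
      then show ?thesis using z(1) by force
    next
      case 3
      then have "(y, w, x) \<in> U" using z wx sy by (auto simp: U_def lnbh_def arcs_def)
      then show ?thesis using z(1) by force
    qed
  qed
  then have "card ?Z \<le> card ((\<lambda>(w, x, y). ((w, x), y)) ` U \<union> (\<lambda>(w, y, x). ((w, x), y)) ` U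
      \<union> (\<lambda>(y, w, x). ((w, x), y)) ` U)"
    using finU by (intro card_mono) auto
  also have "\<dots> \<le> card U + card U + card U"
    by (intro order_trans[OF card_Un_le] add_mono card_image_le finU)
  finally have "real (card ?Z) \<le> 3 * real (card U)" by linarith
  also have "real (card U) = (\<Sum>w\<in>S. real (card (arcs G r \<inter> ?L w \<times> ?L w)))"
    unfolding U_def using finS by simp
  also have "\<dots> \<le> (\<Sum>w\<in>S. C * sqrt (real D) * real (card (?L w)))"
    using S by (intro sum_mono card_arcs_lnbh) auto
  also have "\<dots> = C * sqrt (real D) * real (card (SIGMA w:S. ?L w))"
    using finS by (simp add: sum_distrib_left)
  also have "(SIGMA w:S. ?L w) = arcs G r \<inter> S \<times> S" by (auto simp: arcs_def)
  finally show ?thesis by simp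
qed

text \<open>Degree counting: a neighbouring pair in \<open>S\<close> is an arc in one of its two
  directions.\<close>

lemma card_arcs_core:
  assumes S: "S \<subseteq> verts G" and deg: "\<And>w. w \<in> S \<Longrightarrow> D \<le> card (nbh G w \<inter> S)"
  shows "card S * D \<le> 2 * card (arcs G r \<inter> S \<times> S)"
proof -
  have finS: "finite S" using S finV finite_subset by blast
  have "card S * D = (\<Sum>w\<in>S. D)" by simp
  also have "\<dots> \<le> (\<Sum>w\<in>S. card (nbh G w \<inter> S))" by (intro sum_mono deg)
  also have "\<dots> = card (SIGMA w:S. nbh G w \<inter> S)" using finS by simp
  also have "\<dots> \<le> card ((arcs G r \<inter> S \<times> S) \<union> prod.swap ` (arcs G r \<inter> S \<times> S))"
  proof (rule card_mono)
    show "(SIGMA w:S. nbh G w \<inter> S) \<subseteq> (arcs G r \<inter> S \<times> S) \<union> prod.swap ` (arcs G r \<inter> S \<times> S)"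
    proof clarify
      fix w x assume wx: "w \<in> S" "x \<in> nbh G w" "x \<in> S" "(w, x) \<notin> prod.swap ` (arcs G r \<inter> S \<times> S)"
      then have "w \<noteq> x" using nbh_simple[OF G] by auto
      then have "r w \<noteq> r x" using wx S r_inj by (auto simp: inj_on_def)
      moreover have "(x, w) \<notin> arcs G r" using wx by force
      moreover have "w \<in> nbh G x" using wx nbh_sym by fast
      ultimately show "(w, x) \<in> arcs G r \<inter> S \<times> S" using wx by (auto simp: arcs_def lnbh_def)
    qed
  qed auto
  also have "\<dots> \<le> card (arcs G r \<inter> S \<times> S) + card (arcs G r \<inter> S \<times> S)"
    by (intro order_trans[OF card_Un_le] add_mono card_image_le) auto
  finally show ?thesis by simp
qed

text \<open>Centring costs every inner product \<open>D / N\<close>, where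
  \<open>N = card S\<close>, so each of the \<open>m\<close> arcs in \<open>S\<close> gains
  \<open>D / (6 * N)\<close>. The overlaps \<open>card (T w \<inter> T x) / D\<close> lose at most
  \<open>3 * C * m / sqrt D\<close> in total, by counting triangles. The constant 36 makes this half
  of the total gain, and \<open>m \<ge> N * D / 2\<close> turns the other half,
  \<open>m * D / (12 * N)\<close>, into \<open>D^2 / 24\<close>.\<close>

lemma surplus_core:
  assumes S: "S \<subseteq> verts G" "S \<noteq> {}" and deg: "\<And>w. w \<in> S \<Longrightarrow> D \<le> card (nbh G w \<inter> S)"
    and small: "36 * C * real (card S) \<le> real D * sqrt (real D)"
  shows "(real D)\<^sup>2 / 24 \<le> surplus G"
proof -
  define N where "N = real (card S)"
  define m where "m = real (card (arcs G r \<inter> S \<times> S))"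
  have finS: "finite S" using S finV finite_subset by blast
  have N: "N > 0" using S finS by (auto simp: N_def card_gt_0_iff)
  have D: "real D > 0" using D_pos by simp
  \<comment> \<open>Trimming all neighbourhoods to the same size \<open>D\<close> makes the centring
    term \<open>D / N\<close> the same for all pairs.\<close>
  have "\<forall>w\<in>S. \<exists>T. T \<subseteq> nbh G w \<inter> S \<and> card T = D"
    using deg by (meson obtain_subset_with_card_n)
  then obtain T where T: "\<And>w. w \<in> S \<Longrightarrow> T w \<subseteq> nbh G w \<inter> S" "\<And>w. w \<in> S \<Longrightarrow> card (T w) = D"
    by metis
  define u :: "'a \<Rightarrow> 'a \<Rightarrow> real" where
    "u w k = of_bool (w \<in> S) * (of_bool (k \<in> T w) - real D / N) / sqrt (real D)" for w k
  define c where "c = real D / N"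
  have ip: "(\<Sum>k\<in>S. u w k * u x k) = real (card (T w \<inter> T x)) / real D - c"
    if wx: "w \<in> S" "x \<in> S" for w x
  proof -
    have "(\<Sum>k\<in>S. u w k * u x k) = (\<Sum>k\<in>S. (of_bool (k \<in> T w \<inter> T x) - c * of_bool (k \<in> T w)
        - c * of_bool (k \<in> T x) + c\<^sup>2) / real D)"
      using wx D by (intro sum.cong) (auto simp: u_def c_def[symmetric] field_simps power2_eq_square)
    also have "\<dots> = ((\<Sum>k\<in>S. of_bool (k \<in> T w \<inter> T x)) - c * (\<Sum>k\<in>S. of_bool (k \<in> T w))
        - c * (\<Sum>k\<in>S. of_bool (k \<in> T x)) + c\<^sup>2 * N) / real D"
      by (simp add: sum_divide_distrib[symmetric] sum_subtractf sum.distrib sum_distrib_left N_def)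
    also have "(\<Sum>k\<in>S. of_bool (k \<in> T w \<inter> T x)) = real (card (T w \<inter> T x))"
      using finS T wx by (subst sum_of_bool_eq) (auto intro!: arg_cong[where f = card])
    also have "(\<Sum>k\<in>S. of_bool (k \<in> T w)) = real D"
    proof -
      have "S \<inter> {k. k \<in> T w} = T w" using T(1)[OF wx(1)] by auto
      then show ?thesis using finS T(2)[OF wx(1)] by simp
    qed
    also have "(\<Sum>k\<in>S. of_bool (k \<in> T x)) = real D"
    proof -
      have "S \<inter> {k. k \<in> T x} = T x" using T(1)[OF wx(2)] by auto
      then show ?thesis using finS T(2)[OF wx(2)] by simp
    qed
    also have "(real (card (T w \<inter> T x)) - c * real D - c * real D + c\<^sup>2 * N) / real D =
        real (card (T w \<inter> T x)) / real D - c"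
      using N D by (simp add: c_def power2_eq_square field_simps)
    finally show ?thesis .
  qed
  have u0: "u w k = 0" if "w \<notin> S" for w k using that by (simp add: u_def)
  have c: "c > 0" using N D by (simp add: c_def)
  have norm: "(\<Sum>k\<in>S. (u w k)\<^sup>2) \<le> 1" if "w \<in> verts G" for w
  proof (cases "w \<in> S")
    case True
    then show ?thesis using ip[OF True True] T(2)[OF True] D c by (simp add: power2_eq_square)
  qed (simp add: u0)
  define a where "a w x = (of_bool ((w, x) \<in> S \<times> S) * c :: real)" for w x
  define b where "b w x = of_bool ((w, x) \<in> S \<times> S) * real (card (T w \<inter> T x)) / real D" for w x
  have "(\<Sum>(w, x)\<in>arcs G r. a w x / 6 - b w x) \<le> surplus G"
  proof (rule surplus_ge_vectors[OF G orientation_arcs finS norm])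
    fix w x
    show "(\<Sum>k\<in>S. u w k * u x k) \<le> b w x - a w x"
      by (cases "w \<in> S"; cases "x \<in> S") (auto simp: ip u0 a_def b_def)
    show "0 \<le> a w x \<and> 0 \<le> b w x" using c by (auto simp: a_def b_def)
  qed
  also have "(\<Sum>(w, x)\<in>arcs G r. a w x / 6 - b w x) =
      (\<Sum>(w, x)\<in>arcs G r \<inter> S \<times> S. c / 6 - real (card (T w \<inter> T x)) / real D)"
  proof -
    have "(\<Sum>(w, x)\<in>arcs G r. a w x / 6 - b w x) = (\<Sum>(w, x)\<in>arcs G r \<inter> S \<times> S. a w x / 6 - b w x)"
    proof (rule sum.mono_neutral_right)
      show "\<forall>p\<in>arcs G r - arcs G r \<inter> S \<times> S. (case p of (w, x) \<Rightarrow> a w x / 6 - b w x) = 0"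
      proof
        fix p assume "p \<in> arcs G r - arcs G r \<inter> S \<times> S"
        then obtain w x where "p = (w, x)" "(w, x) \<notin> S \<times> S" by (cases p) auto
        then show "(case p of (w, x) \<Rightarrow> a w x / 6 - b w x) = 0" by (auto simp: a_def b_def)
      qed
    qed auto
    also have "\<dots> = (\<Sum>(w, x)\<in>arcs G r \<inter> S \<times> S. c / 6 - real (card (T w \<inter> T x)) / real D)"
      by (rule sum.cong) (auto simp: a_def b_def)
    finally show ?thesis .
  qed
  also have "\<dots> = m * c / 6 - (\<Sum>(w, x)\<in>arcs G r \<inter> S \<times> S. real (card (T w \<inter> T x))) / real D"
    by (simp add: m_def case_prod_beta sum_subtractf sum_divide_distrib)
  finally have main: "m * c / 6 - (\<Sum>(w, x)\<in>arcs G r \<inter> S \<times> S. real (card (T w \<inter> T x))) / real D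
    \<le> surplus G" .
  have "(\<Sum>(w, x)\<in>arcs G r \<inter> S \<times> S. real (card (T w \<inter> T x))) =
      real (card (SIGMA p:arcs G r \<inter> S \<times> S. T (fst p) \<inter> T (snd p)))"
  proof -
    have "finite (T w)" if "w \<in> S" for w using T(1)[OF that] finS finite_subset by blast
    then show ?thesis by (subst card_SigmaI) (auto simp: case_prod_beta)
  qed
  also have "\<dots> \<le> real (card {((w, x), y). (w, x) \<in> arcs G r \<inter> S \<times> S \<and> y \<in> nbh G w \<inter> nbh G x \<inter> S})"
  proof (rule of_nat_mono, rule card_mono)
    have "finite ((arcs G r \<inter> S \<times> S) \<times> S)" using finS by auto
    then show "finite {((w, x), y). (w, x) \<in> arcs G r \<inter> S \<times> S \<and> y \<in> nbh G w \<inter> nbh G x \<inter> S}"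
      by (rule rev_finite_subset) auto
    show "(SIGMA p:arcs G r \<inter> S \<times> S. T (fst p) \<inter> T (snd p)) \<subseteq>
        {((w, x), y). (w, x) \<in> arcs G r \<inter> S \<times> S \<and> y \<in> nbh G w \<inter> nbh G x \<inter> S}"
      using T(1) by fastforce
  qed
  also have "\<dots> \<le> 3 * C * sqrt (real D) * m" unfolding m_def by (rule card_triangles[OF S(1)])
  finally have "(\<Sum>(w, x)\<in>arcs G r \<inter> S \<times> S. real (card (T w \<inter> T x))) / real D
      \<le> (3 * C * sqrt (real D) * m) / real D"
    using D by (intro divide_right_mono) auto
  also have "\<dots> \<le> m * c / 12"
  proof -
    have "36 * C * N * sqrt (real D) \<le> real D * sqrt (real D) * sqrt (real D)"
      using small by (intro mult_right_mono) (auto simp: N_def)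
    also have "\<dots> = real D * real D" by (simp add: mult.assoc)
    finally have "(3 * C * sqrt (real D)) / real D \<le> c / 12"
      using N D by (simp add: c_def field_simps)
    then have "m * ((3 * C * sqrt (real D)) / real D) \<le> m * (c / 12)"
      by (intro mult_left_mono) (auto simp: m_def)
    then show ?thesis by (simp add: mult_ac)
  qed
  finally have "m * c / 12 \<le> surplus G" using main by linarith
  moreover have "(real D)\<^sup>2 / 24 \<le> m * c / 12"
  proof -
    have "real (card S * D) \<le> real (2 * card (arcs G r \<inter> S \<times> S))"
      using card_arcs_core[OF S(1) deg] of_nat_le_iff by blast
    then have "N * real D \<le> 2 * m" by (simp add: N_def m_def)
    then have "N * real D * c \<le> 2 * m * c" using c by (intro mult_right_mono) auto
    moreover have "N * real D * c = (real D)\<^sup>2" using N by (simp add: c_def power2_eq_square)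
    ultimately show ?thesis by simp
  qed
  ultimately show ?thesis by linarith
qed

end


section \<open>Balancing the two lower bounds\<close>

lemma powr_four_fifths_le_square:
  assumes "0 < m" "0 \<le> d" "m \<le> d\<^sup>2 * sqrt d"
  shows "m powr (4/5) \<le> d\<^sup>2"
proof -
  have d: "d > 0"
  proof (rule ccontr)
    assume "\<not> d > 0"
    then have "d = 0" using assms(2) by simp
    then show False using assms by simp
  qed
  have "m powr (4/5) \<le> (d\<^sup>2 * sqrt d) powr (4/5)" using assms by (intro powr_mono2) auto
  also have "d\<^sup>2 * sqrt d = d powr (5/2)"
    using d powr_add[of d 2 "1/2"] by (simp add: powr_half_sqrt)
  also have "(d powr (5/2)) powr (4/5) = d powr 2" by (simp add: powr_powr)
  also have "\<dots> = d\<^sup>2" using d by simp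
  finally show ?thesis .
qed

text \<open>The degeneracy \<open>D\<close> serves both bounds: it gives an ordering with at most
  \<open>D\<close> earlier neighbours, and its minimality gives a subgraph of minimum degree at
  least \<open>D\<close>.\<close>

theorem surplus_sparse_nbh:
  fixes G :: "'a ugraph"
  assumes G: "simple_graph G" and C: "C \<ge> 1" and m: "edges G \<noteq> {}"
    and sparse: "\<And>w S. S \<subseteq> nbh G w \<Longrightarrow>
      real (card (edges_in G S)) \<le> C * (real (card S) * sqrt (real (card S)))"
  shows "real (card (edges G)) powr (4/5) / (20736 * C\<^sup>2) \<le> surplus G"
proof -
  define ok where "ok d \<longleftrightarrow> (\<forall>S\<subseteq>verts G. S \<noteq> {} \<longrightarrow> (\<exists>w\<in>S. card (nbh G w \<inter> S) \<le> d))" for d :: nat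
  define D where "D = (LEAST d. ok d)"
  define M where "M = real (card (edges G))"
  have finV: "finite (verts G)" using G by (simp add: simple_graph_def)
  have finE: "finite (edges G)" using G by (rule simple_graph_finite_edges)
  have M: "M \<ge> 1" using m finE by (simp add: M_def Suc_leI card_gt_0_iff)
  have "ok (card (verts G))"
    unfolding ok_def
  proof (intro allI impI)
    fix S assume S: "S \<subseteq> verts G" "S \<noteq> {}"
    then obtain w where "w \<in> S" by blast
    moreover have "card (nbh G w \<inter> S) \<le> card (verts G)" using S finV by (intro card_mono) auto
    ultimately show "\<exists>w\<in>S. card (nbh G w \<inter> S) \<le> card (verts G)" by blast
  qed
  then have okD: "ok D" unfolding D_def by (rule LeastI)
  obtain e where "e \<in> edges G" using m by blast
  then obtain a b where ab: "{a, b} \<in> edges G" "a \<noteq> b" "a \<in> verts G" "b \<in> verts G"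
    using G simple_graph_edgeE by metis
  have D1: "D \<ge> 1"
  proof (rule ccontr)
    assume "\<not> D \<ge> 1"
    then obtain w where w: "w \<in> {a, b}" "card (nbh G w \<inter> {a, b}) = 0"
      using okD ab unfolding ok_def by (metis empty_not_insert empty_subsetI insert_subset le_zero_eq less_one not_le)
    moreover have "b \<in> nbh G a" "a \<in> nbh G b" using ab by (auto simp: nbh_def insert_commute)
    ultimately show False by auto
  qed
  have "\<not> ok (D - 1)" using D1 not_less_Least[of "D - 1" ok] by (simp add: D_def)
  then obtain S where S: "S \<subseteq> verts G" "S \<noteq> {}" "\<forall>w\<in>S. \<not> card (nbh G w \<inter> S) \<le> D - 1"
    unfolding ok_def by metis
  have S3: "D \<le> card (nbh G w \<inter> S)" if "w \<in> S" for w
    using S(3) that by force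
  have "\<exists>r :: 'a \<Rightarrow> nat. inj_on r (verts G) \<and> (\<forall>w\<in>verts G. card {x \<in> nbh G w \<inter> verts G. r x < r w} \<le> D)"
    using okD by (intro degeneracy_ordering finV) (auto simp: ok_def)
  then obtain r :: "'a \<Rightarrow> nat" where r: "inj_on r (verts G)"
    "\<And>w. w \<in> verts G \<Longrightarrow> card {x \<in> nbh G w \<inter> verts G. r x < r w} \<le> D" by blast
  have "nbh G w \<inter> verts G = nbh G w" for w using nbh_simple(1)[OF G] by blast
  with r interpret ranked_graph G r D C
    by unfold_locales (use G D1 C sparse in \<open>auto simp: lnbh_def\<close>)
  show ?thesis
  \<comment> \<open>The threshold is what \<open>surplus_core\<close> asks for:
    \<open>card S * D \<le> 2 * M\<close> then yields
    \<open>36 * C * card S \<le> D * sqrt D\<close>.\<close>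
  proof (cases "72 * C * M \<le> (real D)\<^sup>2 * sqrt (real D)")
    case True
    have "real (card S) * real D \<le> 2 * M"
    proof -
      have "card S * D \<le> 2 * card (arcs G r \<inter> S \<times> S)" using S(1) S3 by (rule card_arcs_core)
      also have "card (arcs G r \<inter> S \<times> S) \<le> card (arcs G r)" by (intro card_mono) auto
      finally have "card S * D \<le> 2 * card (edges G)" by (simp add: card_arcs)
      then have "real (card S * D) \<le> real (2 * card (edges G))" using of_nat_le_iff by blast
      then show ?thesis by (simp add: M_def)
    qed
    then have "36 * C * (real (card S) * real D) \<le> 36 * C * (2 * M)"
      using C by (intro mult_left_mono) auto
    also have "\<dots> \<le> (real D)\<^sup>2 * sqrt (real D)" using True by simp
    finally have "(36 * C * real (card S)) * real D \<le> (real D * sqrt (real D)) * real D"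
      by (simp add: power2_eq_square mult_ac)
    then have small: "36 * C * real (card S) \<le> real D * sqrt (real D)"
      using D1 by (subst (asm) mult_le_cancel_right_pos) auto
    have "(real D)\<^sup>2 / 24 \<le> surplus G" using S(1,2) S3 small by (rule surplus_core)
    moreover have "M powr (4/5) \<le> (real D)\<^sup>2"
    proof (rule powr_four_fifths_le_square)
      have "1 * M \<le> 72 * C * M" using C M by (intro mult_right_mono) auto
      then show "M \<le> (real D)\<^sup>2 * sqrt (real D)" using True by simp
    qed (use M in auto)
    moreover have "M powr (4/5) / (20736 * C\<^sup>2) \<le> M powr (4/5) / 24"
    proof (rule divide_left_mono)
      have "1 \<le> C\<^sup>2" using C by simp
      then show "24 \<le> 20736 * C\<^sup>2" by linarith
    qed (use C in auto)
    ultimately show ?thesis unfolding M_def by linarith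
  next
    case False
    define q where "q = 72 * C * M"
    have q: "q > 0" using C M by (simp add: q_def)
    have D0: "real D > 0" using D1 by simp
    have "real D powr (5/2) \<le> q"
      using False D0 powr_add[of "real D" 2 "1/2"] by (simp add: q_def powr_half_sqrt)
    then have "(real D powr (5/2)) powr (1/5) \<le> q powr (1/5)" by (intro powr_mono2) auto
    then have "sqrt (real D) \<le> q powr (1/5)" by (simp add: powr_powr powr_half_sqrt[symmetric])
    also have "q powr (1/5) = (72 * C) powr (1/5) * M powr (1/5)"
      using C M by (simp add: q_def powr_mult)
    \<comment> \<open>A crude bound on \<open>(72 * C) powr (1/5)\<close>, which leaves the constant
      20736 = 288 * 72.\<close>
    also have "\<dots> \<le> (72 * C) * M powr (1/5)"
      using C powr_mono[of "1/5" 1 "72 * C"] by (intro mult_right_mono) auto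
    finally have "M / (288 * C * ((72 * C) * M powr (1/5))) \<le> M / (288 * C * sqrt (real D))"
      using C M D0 by (intro divide_left_mono mult_left_mono mult_pos_pos) auto
    also have "\<dots> \<le> surplus G" unfolding M_def by (rule surplus_degenerate)
    also have "M / (288 * C * ((72 * C) * M powr (1/5))) = M powr (4/5) / (20736 * C\<^sup>2)"
    proof -
      have "M = M powr (4/5) * M powr (1/5)" using M by (simp add: powr_add[symmetric])
      then have "M / (288 * C * ((72 * C) * M powr (1/5))) =
        (M powr (4/5) * M powr (1/5)) / ((20736 * C\<^sup>2) * M powr (1/5))"
        by (simp add: power2_eq_square mult_ac)
      then show ?thesis using M by simp
    qed
    finally show ?thesis by (simp add: M_def)
  qed
qed

section \<open>Copies of graphs\<close>

text \<open>Copies as injective homomorphisms, the form in which they compose, extend and pull back.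
  The condition on \<open>verts H\<close> takes care of isolated vertices.\<close>

lemma contains_copy_iff:
  assumes H: "simple_graph H"
  shows "contains_copy G H \<longleftrightarrow>
    (\<exists>g. inj_on g (verts H) \<and> g ` verts H \<subseteq> verts G \<and> (\<forall>e\<in>edges H. g ` e \<in> edges G))"
proof
  assume "contains_copy G H"
  then obtain S f where S: "subgraph S G" "bij_betw f (verts S) (verts H)" "edges H = (\<lambda>e. f ` e) ` edges S"
    unfolding contains_copy_def isomorphic_def by blast
  let ?g = "inv_into (verts S) f"
  have bij: "bij_betw ?g (verts H) (verts S)" using S(2) by (rule bij_betw_inv_into)
  have "?g ` e \<in> edges G" if e: "e \<in> edges H" for e
  proof -
    obtain e' where e': "e = f ` e'" "e' \<in> edges S" using S(3) e by auto
    have "e' \<subseteq> verts S" using S(1) e' by (auto simp: subgraph_def simple_graph_def)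
    then have "?g ` e = e'" using e'(1) S(2) by (simp add: bij_betw_def inv_into_image_cancel)
    then show ?thesis using e' S(1) by (auto simp: subgraph_def)
  qed
  moreover have "?g ` verts H \<subseteq> verts G" using bij S(1) by (auto simp: bij_betw_def subgraph_def)
  ultimately show "\<exists>g. inj_on g (verts H) \<and> g ` verts H \<subseteq> verts G \<and> (\<forall>e\<in>edges H. g ` e \<in> edges G)"
    using bij unfolding bij_betw_def by blast
next
  assume "\<exists>g. inj_on g (verts H) \<and> g ` verts H \<subseteq> verts G \<and> (\<forall>e\<in>edges H. g ` e \<in> edges G)"
  then obtain g where g: "inj_on g (verts H)" "g ` verts H \<subseteq> verts G" "\<And>e. e \<in> edges H \<Longrightarrow> g ` e \<in> edges G"
    by blast
  let ?S = "Graph (g ` verts H) ((\<lambda>e. g ` e) ` edges H)"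
  have sub: "e \<subseteq> verts H" "card e = 2" if "e \<in> edges H" for e
    using H that by (auto simp: simple_graph_def)
  have "card (g ` e) = 2" if "e \<in> edges H" for e
    using sub[OF that] g(1) by (metis card_image inj_on_subset)
  then have "subgraph ?S G" using g sub H by (fastforce simp: subgraph_def simple_graph_def)
  moreover have "isomorphic ?S H" unfolding isomorphic_def
  proof (intro exI conjI)
    show "bij_betw (inv_into (verts H) g) (verts ?S) (verts H)"
      using g(1) by (simp add: bij_betw_inv_into inj_on_imp_bij_betw)
    have "inv_into (verts H) g ` (g ` e) = e" if "e \<in> edges H" for e
      using sub[OF that] g(1) by (simp add: inv_into_image_cancel)
    then show "edges H = (\<lambda>e. inv_into (verts H) g ` e) ` edges ?S" by (force simp: image_image)
  qed
  ultimately show "contains_copy G H" unfolding contains_copy_def by blast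
qed

lemma contains_copy_trans:
  assumes "simple_graph H" "simple_graph K" "contains_copy G H" "contains_copy H K"
  shows "contains_copy G K"
proof -
  obtain g where g: "inj_on g (verts H)" "g ` verts H \<subseteq> verts G" "\<forall>e\<in>edges H. g ` e \<in> edges G"
    using assms contains_copy_iff by metis
  obtain h where h: "inj_on h (verts K)" "h ` verts K \<subseteq> verts H" "\<forall>e\<in>edges K. h ` e \<in> edges H"
    using assms contains_copy_iff by metis
  have "inj_on (g \<circ> h) (verts K)" using g(1) h(1,2) by (meson comp_inj_on inj_on_subset)
  moreover have "(g \<circ> h) ` verts K \<subseteq> verts G" using g(2) h(2) by fastforce
  moreover have "\<forall>e\<in>edges K. (g \<circ> h) ` e \<in> edges G" using g(3) h(3) by (simp only: image_comp[symmetric]) blast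
  ultimately show ?thesis using contains_copy_iff[OF assms(2)] by blast
qed

text \<open>A copy of \<open>H\<close> minus \<open>v\<close> among neighbours of \<open>w\<close>
  would extend to a copy of \<open>H\<close> by sending \<open>v\<close> to
  \<open>w\<close>.\<close>

lemma free_of_nbh:
  assumes G: "simple_graph G" and H: "simple_graph H" "v \<in> verts H"
    and free: "free_of H G" and S: "S \<subseteq> nbh G w" and w: "w \<in> verts G"
  shows "free_of (delete_vertex H v) (Graph S (edges_in G S))"
  unfolding free_of_def
proof
  let ?B = "delete_vertex H v"
  have B: "simple_graph ?B" using H by (auto simp: simple_graph_def delete_vertex_def)
  assume "contains_copy (Graph S (edges_in G S)) ?B"
  then obtain g where g: "inj_on g (verts H - {v})" "g ` (verts H - {v}) \<subseteq> S"
    "\<And>e. e \<in> edges H \<Longrightarrow> v \<notin> e \<Longrightarrow> g ` e \<in> edges G"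
    unfolding contains_copy_iff[OF B] by (auto simp: delete_vertex_def edges_in_def)
  have wS: "w \<notin> S" "S \<subseteq> verts G" using S nbh_simple[OF G] by blast+
  show False
  proof -
    let ?h = "g(v := w)"
    have "inj_on ?h (verts H)"
    proof -
      have "inj_on ?h (insert v (verts H - {v}))"
        using g(1,2) wS by (auto simp: inj_on_def)
      then show ?thesis using H(2) by (simp add: insert_absorb)
    qed
    moreover have "?h ` verts H \<subseteq> verts G" using g(2) wS w by auto
    moreover have "?h ` e \<in> edges G" if e: "e \<in> edges H" for e
    proof (cases "v \<in> e")
      case True
      obtain a b where "e = {a, b}" "a \<noteq> b" "a \<in> verts H" "b \<in> verts H"
        using simple_graph_edgeE[OF H(1) e] .
      with True obtain x where x: "e = {v, x}" "x \<noteq> v" "x \<in> verts H" by auto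
      then have "g x \<in> nbh G w" using g(2) S by auto
      then show ?thesis using x by (simp add: nbh_def insert_commute)
    next
      case False
      then have "?h ` e = g ` e" by (intro image_cong) auto
      then show ?thesis using g(3) e False by simp
    qed
    ultimately have "contains_copy G H" unfolding contains_copy_iff[OF H(1)] by blast
    then show False using free by (simp add: free_of_def)
  qed
qed


lemma card_edges_le_ex:
  fixes G :: "nat ugraph"
  assumes "simple_graph G" "free_of F G"
  shows "card (edges G) \<le> ex (card (verts G)) F"
  unfolding ex_def
proof (rule cSup_upper)
  show "bdd_above {card (edges G') | G' :: nat ugraph.
      simple_graph G' \<and> card (verts G') = card (verts G) \<and> free_of F G'}"
  proof (rule bdd_aboveI)
    fix k assume "k \<in> {card (edges G') | G' :: nat ugraph.
      simple_graph G' \<and> card (verts G') = card (verts G) \<and> free_of F G'}"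
    then obtain G' :: "nat ugraph" where G': "k = card (edges G')" "simple_graph G'" "card (verts G') = card (verts G)"
      by blast
    have "card (edges G') \<le> card (Pow (verts G'))"
      using G'(2) by (intro card_mono) (auto simp: simple_graph_def)
    then show "k \<le> 2 ^ card (verts G)" using G' by (simp add: card_Pow simple_graph_def)
  qed
qed (use assms in blast)

lemma sparse_nbh_of_free:
  fixes H :: "'a ugraph"
  assumes H: "simple_graph H" "v \<in> verts H"
    and O: "(\<lambda>n. real (ex n (delete_vertex H v))) \<in> O(\<lambda>n. real n powr (3/2))"
  obtains C where "C \<ge> 1" "\<And>(G :: nat ugraph) w S. simple_graph G \<Longrightarrow> free_of H G \<Longrightarrow> S \<subseteq> nbh G w \<Longrightarrow>
      real (card (edges_in G S)) \<le> C * (real (card S) * sqrt (real (card S)))"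
proof -
  obtain c where c: "c > 0"
    "eventually (\<lambda>n. norm (real (ex n (delete_vertex H v))) \<le> c * norm (real n powr (3/2))) at_top"
    using O by (rule landau_o.bigE)
  then obtain n0 where n0: "\<And>n. n \<ge> n0 \<Longrightarrow> real (ex n (delete_vertex H v)) \<le> c * (real n powr (3/2))"
    by (auto simp: eventually_at_top_linorder)
  \<comment> \<open>The asymptotic bound is silent below \<open>n0\<close>; there
    \<open>2 ^ n0\<close> bounds the number of all subsets of \<open>S\<close>, hence of its
    edges.\<close>
  define C where "C = max c (2 ^ n0)"
  have C: "C \<ge> 1" "C \<ge> c" "C \<ge> 2 ^ n0" by (auto simp: C_def le_max_iff_disj)
  show ?thesis
  proof (rule that[OF C(1)])
    fix G :: "nat ugraph" and w S
    assume G: "simple_graph G" "free_of H G" "S \<subseteq> nbh G w"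
    let ?n = "card S"
    have finS: "finite S" using G nbh_simple(3)[OF G(1)] finite_subset by blast
    show "real (card (edges_in G S)) \<le> C * (real ?n * sqrt (real ?n))"
    proof (cases "S = {}")
      case True
      have "edges_in G {} = {}" using G(1) by (auto simp: edges_in_def simple_graph_def)
      then show ?thesis using True by simp
    next
      case False
      then have n1: "?n \<ge> 1" using finS by (simp add: Suc_leI card_gt_0_iff)
      obtain x where "x \<in> nbh G w" using False G(3) by blast
      then have w: "w \<in> verts G" by (rule nbh_simple(4)[OF G(1)])
      have "1 * 1 \<le> real ?n * sqrt (real ?n)" using n1 by (intro mult_mono) auto
      then have n1': "1 \<le> real ?n * sqrt (real ?n)" by simp
      show ?thesis
      proof (cases "?n \<ge> n0")
        case True
        have "simple_graph (Graph S (edges_in G S))"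
          using G(1) finS by (auto simp: simple_graph_def edges_in_def)
        from card_edges_le_ex[OF this free_of_nbh[OF G(1) H G(2,3) w]]
        have "real (card (edges_in G S)) \<le> real (ex ?n (delete_vertex H v))" by simp
        also have "\<dots> \<le> c * (real ?n powr (3/2))" by (rule n0[OF True])
        also have "real ?n powr (3/2) = real ?n * sqrt (real ?n)"
          using n1 powr_add[of "real ?n" 1 "1/2"] by (simp add: powr_half_sqrt)
        also have "c * (real ?n * sqrt (real ?n)) \<le> C * (real ?n * sqrt (real ?n))"
          using C by (intro mult_right_mono) auto
        finally show ?thesis .
      next
        case False
        have "card (edges_in G S) \<le> card (Pow S)"
          using finS by (intro card_mono) (auto simp: edges_in_def)
        also have "\<dots> \<le> 2 ^ n0" using False finS by (simp add: card_Pow)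
        finally have "real (card (edges_in G S)) \<le> 2 ^ n0"
          by (metis of_nat_le_iff of_nat_numeral of_nat_power)
        also have "\<dots> \<le> C * 1" using C by simp
        also have "\<dots> \<le> C * (real ?n * sqrt (real ?n))" using n1' C by (intro mult_left_mono) auto
        finally show ?thesis .
      qed
    qed
  qed
qed

theorem sp_lower_bound:
  fixes H :: "'a ugraph"
  assumes H: "simple_graph H" "v \<in> verts H"
    and O: "(\<lambda>n. real (ex n (delete_vertex H v))) \<in> O(\<lambda>n. real n powr (3/2))"
  shows "\<exists>C>0. \<forall>m\<ge>1. sp m H \<ge> ereal (C * real m powr (4/5))"
proof -
  obtain C where C: "C \<ge> 1" "\<And>(G :: nat ugraph) w S. simple_graph G \<Longrightarrow> free_of H G \<Longrightarrow> S \<subseteq> nbh G w \<Longrightarrow>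
      real (card (edges_in G S)) \<le> C * (real (card S) * sqrt (real (card S)))"
    using sparse_nbh_of_free[OF assms] by blast
  show ?thesis
  proof (intro exI conjI allI impI)
    show "1 / (20736 * C\<^sup>2) > 0" using C(1) by simp
    fix m :: nat assume m: "m \<ge> 1"
    show "ereal (1 / (20736 * C\<^sup>2) * real m powr (4/5)) \<le> sp m H"
      unfolding sp_def
    proof (rule INF_greatest)
      fix G :: "nat ugraph"
      assume "G \<in> {G. simple_graph G \<and> free_of H G \<and> card (edges G) = m}"
      then have G: "simple_graph G" "free_of H G" "card (edges G) = m" by auto
      then have "edges G \<noteq> {}" using m by auto
      from surplus_sparse_nbh[OF G(1) C(1) this C(2)[OF G(1,2)]]
      show "ereal (1 / (20736 * C\<^sup>2) * real m powr (4/5)) \<le> ereal (surplus G)"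
        using G(3) by simp
    qed
  qed
qed

section \<open>Assembling graphs with small surplus\<close>

text \<open>Phrased for the graph \<open>K\<close> inside \<open>H\<close> (a triangle or
  \<open>K_{3,3}\<close>): every \<open>K\<close>-free graph is \<open>H\<close>-free, and
  \<open>K\<close> is connected, so disjoint unions stay \<open>K\<close>-free.\<close>

definition attains :: "'b ugraph \<Rightarrow> nat \<Rightarrow> real \<Rightarrow> bool" where
  "attains K m t \<longleftrightarrow>
    (\<exists>G :: nat ugraph. simple_graph G \<and> free_of K G \<and> card (edges G) = m \<and> surplus G \<le> t)"

definition map_graph :: "('a \<Rightarrow> 'b) \<Rightarrow> 'a ugraph \<Rightarrow> 'b ugraph" where
  "map_graph f G = Graph (f ` verts G) ((\<lambda>e. f ` e) ` edges G)"

lemma map_graph: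
  assumes G: "simple_graph G" and f: "inj_on f (verts G)" and K: "simple_graph K"
  shows "simple_graph (map_graph f G)" "card (edges (map_graph f G)) = card (edges G)"
    "surplus (map_graph f G) \<le> surplus G" "free_of K G \<Longrightarrow> free_of K (map_graph f G)"
proof -
  have sub: "e \<subseteq> verts G" "card e = 2" if "e \<in> edges G" for e
    using G that by (auto simp: simple_graph_def)
  have inj: "inj_on (\<lambda>e. f ` e) (edges G)"
    using sub(1) f by (intro inj_onI) (simp add: inj_on_image_eq_iff)
  have "card (f ` e) = 2" if "e \<in> edges G" for e
    using sub[OF that] f by (metis card_image inj_on_subset)
  then show simple: "simple_graph (map_graph f G)"
    using G sub by (fastforce simp: simple_graph_def map_graph_def)
  show "card (edges (map_graph f G)) = card (edges G)"
    using inj by (simp add: map_graph_def card_image)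
  obtain s where s: "\<And>v. s v \<in> {1, -1 :: real}" "surplus (map_graph f G) = - cut_form (map_graph f G) s / 2"
    using surplus_attained[OF simple] by blast
  have "cut_form (map_graph f G) s = cut_form G (s \<circ> f)"
  proof -
    have "cut_form (map_graph f G) s = (\<Sum>e\<in>edges G. \<Prod>v\<in>f ` e. s v)"
      using inj by (simp add: cut_form_def map_graph_def sum.reindex)
    also have "\<dots> = (\<Sum>e\<in>edges G. \<Prod>v\<in>e. s (f v))"
    proof (rule sum.cong[OF refl])
      fix e assume "e \<in> edges G"
      then have "inj_on f e" using sub(1) f inj_on_subset by blast
      then show "(\<Prod>v\<in>f ` e. s v) = (\<Prod>v\<in>e. s (f v))" by (simp add: prod.reindex)
    qed
    finally show ?thesis by (simp add: cut_form_def)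
  qed
  moreover have "- cut_form G (s \<circ> f) / 2 \<le> surplus G"
    by (rule surplus_ge_cut_form_signs[OF G]) (use s(1) in auto)
  ultimately show "surplus (map_graph f G) \<le> surplus G" using s(2) by simp
  show "free_of K (map_graph f G)" if free: "free_of K G"
    unfolding free_of_def
  proof
    assume "contains_copy (map_graph f G) K"
    then obtain g where g: "inj_on g (verts K)" "g ` verts K \<subseteq> f ` verts G"
      "\<And>e. e \<in> edges K \<Longrightarrow> g ` e \<in> (\<lambda>e. f ` e) ` edges G"
      unfolding contains_copy_iff[OF K] by (auto simp: map_graph_def)
    let ?h = "inv_into (verts G) f \<circ> g"
    have "inj_on ?h (verts K)"
      using g(1,2) by (intro comp_inj_on) (auto intro: inj_on_subset inj_on_inv_into)
    moreover have "?h ` verts K \<subseteq> verts G"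
      using g(2) by (auto intro!: inv_into_into)
    moreover have "?h ` e \<in> edges G" if e: "e \<in> edges K" for e
    proof -
      obtain e' where e': "e' \<in> edges G" "g ` e = f ` e'" using g(3)[OF e] by auto
      then have "?h ` e = e'"
        using sub(1) f by (simp only: image_comp[symmetric]) (simp add: inv_into_image_cancel)
      then show ?thesis using e' by simp
    qed
    ultimately have "contains_copy G K" unfolding contains_copy_iff[OF K] by blast
    then show False using free by (simp add: free_of_def)
  qed
qed

lemma attainsI:
  fixes G :: "'a ugraph"
  assumes G: "simple_graph G" and K: "simple_graph K" and free: "free_of K G"
    and "card (edges G) = m" "surplus G \<le> t"
  shows "attains K m t"
proof -
  have "finite (verts G)" using G by (simp add: simple_graph_def)
  then obtain f :: "'a \<Rightarrow> nat" where "inj_on f (verts G)"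
    using finite_imp_inj_to_nat_seg by blast
  from map_graph[OF G this K] assms(3-) show ?thesis
    unfolding attains_def by fastforce
qed

text \<open>Connectedness without paths: no edge leaves \<open>A\<close> only if \<open>A\<close> is
  trivial.\<close>

definition linked :: "'b ugraph \<Rightarrow> bool" where
  "linked K \<longleftrightarrow> (\<forall>A\<subseteq>verts K. (\<forall>e\<in>edges K. e \<subseteq> A \<or> e \<inter> A = {}) \<longrightarrow> A = {} \<or> A = verts K)"

text \<open>The vertices that a copy of \<open>K\<close> sends into \<open>G1\<close> are separated
  from the rest by no edge, so the copy lies on one side.\<close>

lemma free_of_disjoint_union:
  assumes K: "simple_graph K" "linked K"
    and G: "simple_graph G1" "simple_graph G2" "verts G1 \<inter> verts G2 = {}"
    and free: "free_of K G1" "free_of K G2"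
  shows "free_of K (Graph (verts G1 \<union> verts G2) (edges G1 \<union> edges G2))"
  unfolding free_of_def
proof
  assume "contains_copy (Graph (verts G1 \<union> verts G2) (edges G1 \<union> edges G2)) K"
  then obtain g where g: "inj_on g (verts K)" "g ` verts K \<subseteq> verts G1 \<union> verts G2"
    "\<And>e. e \<in> edges K \<Longrightarrow> g ` e \<in> edges G1 \<union> edges G2"
    unfolding contains_copy_iff[OF K(1)] by auto
  have sub: "e \<subseteq> verts G1" if "e \<in> edges G1" for e using G that by (auto simp: simple_graph_def)
  have sub2: "e \<subseteq> verts G2" if "e \<in> edges G2" for e using G that by (auto simp: simple_graph_def)
  have K': "e \<subseteq> verts K" "e \<noteq> {}" if "e \<in> edges K" for e
    using K that by (auto simp: simple_graph_def)
  define A where "A = {x \<in> verts K. g x \<in> verts G1}"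
  have side: "e \<subseteq> A \<and> g ` e \<in> edges G1 \<or> e \<inter> A = {} \<and> g ` e \<in> edges G2" if e: "e \<in> edges K" for e
    using g(3)[OF e] sub[of "g ` e"] sub2[of "g ` e"] K'(1)[OF e] G(3) by (auto simp: A_def)
  have "A \<subseteq> verts K" by (auto simp: A_def)
  moreover have "\<forall>e\<in>edges K. e \<subseteq> A \<or> e \<inter> A = {}" using side by metis
  ultimately have "A = {} \<or> A = verts K" using K(2) unfolding linked_def by metis
  then show False
  proof
    assume A: "A = {}"
    have "g ` verts K \<subseteq> verts G2" using g(2) A by (auto simp: A_def)
    moreover have "g ` e \<in> edges G2" if e: "e \<in> edges K" for e using side[OF e] K'[OF e] A by auto
    ultimately show False using g(1) free(2) unfolding free_of_def contains_copy_iff[OF K(1)] by blast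
  next
    assume A: "A = verts K"
    have "g ` verts K \<subseteq> verts G1" using A by (auto simp: A_def)
    moreover have "g ` e \<in> edges G1" if e: "e \<in> edges K" for e using side[OF e] K'[OF e] A by auto
    ultimately show False using g(1) free(1) unfolding free_of_def contains_copy_iff[OF K(1)] by blast
  qed
qed

text \<open>An optimal cut of a disjoint union restricts to cuts of both parts. Relabelling by even
  and odd numbers makes the parts disjoint.\<close>

lemma attains_add:
  assumes K: "simple_graph K" "linked K" and "attains K m1 t1" "attains K m2 t2"
  shows "attains K (m1 + m2) (t1 + t2)"
proof -
  obtain G1 G2 :: "nat ugraph" where G: "simple_graph G1" "free_of K G1" "card (edges G1) = m1" "surplus G1 \<le> t1"
    "simple_graph G2" "free_of K G2" "card (edges G2) = m2" "surplus G2 \<le> t2"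
    using assms unfolding attains_def by blast
  define H1 where "H1 = map_graph (\<lambda>n. 2 * n) G1"
  define H2 where "H2 = map_graph (\<lambda>n. Suc (2 * n)) G2"
  have "inj_on (\<lambda>n. 2 * n :: nat) (verts G1)" "inj_on (\<lambda>n. Suc (2 * n)) (verts G2)"
    by (auto simp: inj_on_def)
  note m1 = map_graph[OF G(1) this(1) K(1), folded H1_def]
    and m2 = map_graph[OF G(5) this(2) K(1), folded H2_def]
  have H1: "simple_graph H1" "free_of K H1" "card (edges H1) = m1" "surplus H1 \<le> t1"
    using m1 G by auto
  have H2: "simple_graph H2" "free_of K H2" "card (edges H2) = m2" "surplus H2 \<le> t2"
    using m2 G by auto
  have disj: "verts H1 \<inter> verts H2 = {}" by (auto simp: H1_def H2_def map_graph_def) presburger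
  let ?G = "Graph (verts H1 \<union> verts H2) (edges H1 \<union> edges H2)"
  have "e \<notin> edges H2" if "e \<in> edges H1" for e
  proof
    assume "e \<in> edges H2"
    then have "e \<subseteq> verts H1 \<inter> verts H2" "card e = 2"
      using that H1(1) H2(1) by (auto simp: simple_graph_def)
    then show False using disj by simp
  qed
  then have disjE: "edges H1 \<inter> edges H2 = {}" by blast
  have fin: "finite (edges H1)" "finite (edges H2)"
    using H1(1) H2(1) simple_graph_finite_edges by blast+
  have simple: "simple_graph ?G" using H1(1) H2(1) by (auto simp: simple_graph_def)
  obtain s where s: "\<And>v. s v \<in> {1, -1 :: real}" "surplus ?G = - cut_form ?G s / 2"
    using surplus_attained[OF simple] by blast
  have "cut_form ?G s = cut_form H1 s + cut_form H2 s"
    using fin disjE by (simp add: cut_form_def sum.union_disjoint)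
  moreover have "- cut_form H1 s / 2 \<le> surplus H1" "- cut_form H2 s / 2 \<le> surplus H2"
    by (rule surplus_ge_cut_form_signs[OF H1(1) s(1)], rule surplus_ge_cut_form_signs[OF H2(1) s(1)])
  ultimately have "surplus ?G \<le> t1 + t2" using s(2) H1(4) H2(4) by simp
  moreover have "card (edges ?G) = m1 + m2"
    using fin disjE H1(3) H2(3) by (simp add: card_Un_disjoint)
  moreover have "free_of K ?G" by (rule free_of_disjoint_union[OF K H1(1) H2(1) disj H1(2) H2(2)])
  ultimately show ?thesis using simple unfolding attains_def by blast
qed

lemma surplus_le_edges:
  assumes G: "simple_graph G"
  shows "surplus G \<le> real (card (edges G)) / 2"
proof -
  obtain s where s: "\<And>v. s v \<in> {1, -1 :: real}" "surplus G = - cut_form G s / 2"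
    using surplus_attained[OF G] by blast
  have "(\<Prod>v\<in>e. s v) \<ge> -1" for e
  proof -
    have "\<bar>s v\<bar> = 1" for v using s(1)[of v] by auto
    then have "\<bar>\<Prod>v\<in>e. s v\<bar> = 1" by (simp add: abs_prod)
    then show ?thesis by linarith
  qed
  then have "(\<Sum>e\<in>edges G. -1) \<le> cut_form G s" unfolding cut_form_def by (intro sum_mono) auto
  then show ?thesis using s(2) by simp
qed

lemma attains_few_vertices:
  assumes K: "simple_graph K" "card (verts K) \<ge> 3"
  shows "attains K 0 0" "attains K 1 1"
proof -
  have free: "free_of K G" if "finite (verts G)" "card (verts G) < 3" for G :: "nat ugraph"
    unfolding free_of_def contains_copy_iff[OF K(1)]
    using card_inj_on_le[of _ "verts K" "verts G"] that K(2) by fastforce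
  let ?G = "Graph {} {} :: nat ugraph"
  have "simple_graph ?G" "card (edges ?G) = 0" by (auto simp: simple_graph_def)
  then show "attains K 0 0"
    using surplus_le_edges[of ?G] free[of ?G] unfolding attains_def by force
  let ?G = "Graph {0, 1} {{0, 1}} :: nat ugraph"
  have "simple_graph ?G" "card (edges ?G) = 1" by (auto simp: simple_graph_def)
  then show "attains K 1 1"
    using surplus_le_edges[of ?G] free[of ?G] unfolding attains_def by force
qed

section \<open>Realising every number of edges\<close>

lemma powr_four_fifths_le:
  fixes t :: real
  assumes "0 \<le> t" "t \<le> 1"
  shows "(1 - t) powr (4/5) \<le> 1 - 2 * t / 5"
proof (cases "t = 1")
  case False
  then have t: "0 < 1 - t" using assms by simp
  \<comment> \<open>Concavity would give slope \<open>4/5\<close>. Half of it is enough later and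
    already follows from \<open>1 + x \<le> exp x\<close>.\<close>
  define x where "x = 4 * t / 5"
  have x: "0 \<le> x" "x \<le> 1" using assms by (auto simp: x_def)
  have "ln (1 - t) \<le> - t" using ln_le_minus_one[OF t] by simp
  then have "(1 - t) powr (4/5) \<le> exp (- x)" using t by (simp add: powr_def x_def)
  also have "exp (- x) \<le> 1 / (1 + x)"
    using exp_ge_add_one_self[of x] x by (simp add: exp_minus field_simps)
  also have "\<dots> \<le> 1 - x / 2"
  proof -
    have "1 \<le> (1 - x / 2) * (1 + x)" using x mult_left_le[of x x] by (simp add: algebra_simps)
    then show ?thesis using x by (simp add: divide_le_eq)
  qed
  finally show ?thesis by (simp add: x_def)
qed simp

text \<open>Peel off a positive proportion of the edges at each step; the resulting
  sum is dominated by a geometric series.\<close>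

lemma attains_all_sizes:
  assumes K: "simple_graph K" "linked K" and zero: "attains K 0 0"
    and c: "c > 0" and R: "R \<ge> 1"
    and step: "\<And>m. m \<ge> 1 \<Longrightarrow> \<exists>e. 1 \<le> e \<and> e \<le> m \<and> real m \<le> R * real e \<and> attains K e (c * real e powr (4/5))"
  shows "\<exists>C>0. \<forall>m\<ge>1. attains K m (C * real m powr (4/5))"
proof -
  \<comment> \<open>With \<open>t = e / m \<ge> 1 / R\<close>, the piece of \<open>e\<close> edges
    costs \<open>c * t powr (4/5) \<le> c * R * t\<close>, and removing it lowers the bound by at
    least \<open>C * 2 * t / 5\<close>. This \<open>C\<close> makes the two equal.\<close>
  define C where "C = 5 * c * R / 2"
  have C: "C > 0" using c R by (simp add: C_def)
  have "attains K m (C * real m powr (4/5))" for m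
  proof (induction m rule: less_induct)
    case (less m)
    show ?case
    proof (cases "m = 0")
      case False
      then obtain e where e: "1 \<le> e" "e \<le> m" "real m \<le> R * real e" "attains K e (c * real e powr (4/5))"
        using step[of m] by auto
      have "attains K (e + (m - e)) (c * real e powr (4/5) + C * real (m - e) powr (4/5))"
        using less.IH[of "m - e"] e by (intro attains_add K) auto
      moreover have "c * real e powr (4/5) + C * real (m - e) powr (4/5) \<le> C * real m powr (4/5)"
      proof -
        define t where "t = real e / real m"
        have m: "real m > 0" using False by simp
        have t: "0 < t" "t \<le> 1" using e False by (auto simp: t_def)
        have et: "real e = t * real m" "real (m - e) = (1 - t) * real m"
          using m e by (auto simp: t_def of_nat_diff field_simps)
        have "1 \<le> R * t" using e m by (simp add: t_def field_simps)
        have "c * t powr (4/5) \<le> C * (2 * t / 5)"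
        proof -
          have "t powr (4/5) = t * t powr (-1/5)" using t powr_add[of t 1 "-1/5"] by simp
          also have "t powr (-1/5) = (1 / t) powr (1/5)" using t by (simp add: powr_divide powr_minus_divide)
          also have "\<dots> \<le> R powr (1/5)" using t \<open>1 \<le> R * t\<close> by (intro powr_mono2) (auto simp: field_simps)
          also have "\<dots> \<le> R" using R powr_mono[of "1/5" 1 R] by simp
          finally have "t powr (4/5) \<le> t * R" using t by simp
          then have "c * t powr (4/5) \<le> c * (t * R)" using c by (intro mult_left_mono) auto
          then show ?thesis by (simp add: C_def mult_ac)
        qed
        moreover have "C * (1 - t) powr (4/5) \<le> C * (1 - 2 * t / 5)"
          using powr_four_fifths_le[of t] t C by (intro mult_left_mono) auto
        ultimately have "c * t powr (4/5) + C * (1 - t) powr (4/5) \<le> C" by (simp add: algebra_simps)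
        then have "(c * t powr (4/5) + C * (1 - t) powr (4/5)) * real m powr (4/5) \<le> C * real m powr (4/5)"
          by (intro mult_right_mono) auto
        moreover have "real e powr (4/5) = t powr (4/5) * real m powr (4/5)"
          "real (m - e) powr (4/5) = (1 - t) powr (4/5) * real m powr (4/5)"
          unfolding et using t m by (simp_all add: powr_mult)
        ultimately show ?thesis by (simp add: distrib_right mult.assoc)
      qed
      ultimately show ?thesis using e unfolding attains_def by fastforce
    qed (use zero in simp)
  qed
  then show ?thesis using C by blast
qed

text \<open>For the largest \<open>k\<close> with \<open>(2 ^ k) ^ 5 / 2 \<le> m\<close> the member
  of the family fits into \<open>m\<close> and has more than \<open>m / 128\<close> edges, since the
  next threshold is 32 times larger. The cost constant 8 comes from
  \<open>q ^ 4 \<le> (8 * e) powr (4/5)\<close>, where \<open>q = 2 ^ k\<close>.\<close>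

lemma attains_of_family:
  assumes K: "simple_graph K" "linked K" "card (verts K) \<ge> 3"
    and fam: "\<And>k. k \<ge> 4 \<Longrightarrow> \<exists>e. (2 ^ k) ^ 5 / 8 \<le> real e \<and> real e \<le> (2 ^ k) ^ 5 / 2 \<and>
      attains K e ((2 ^ k) ^ 4)"
  shows "\<exists>C>0. \<forall>m\<ge>1. attains K m (C * real m powr (4/5))"
proof (rule attains_all_sizes[OF K(1,2) attains_few_vertices(1)[OF K(1,3)], of 8 "2 ^ 20"])
  fix m :: nat assume m: "m \<ge> 1"
  show "\<exists>e. 1 \<le> e \<and> e \<le> m \<and> real m \<le> 2 ^ 20 * real e \<and> attains K e (8 * real e powr (4/5))"
  proof (cases "real m \<le> 2 ^ 20")
    case True
    \<comment> \<open>Below \<open>2 ^ 20\<close> a single edge is peeled off; above it,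
      \<open>k = 4\<close> is already admissible, as \<open>16 ^ 5 / 2 = 2 ^ 19\<close>.\<close>
    have "attains K 1 8" using attains_few_vertices(2)[OF K(1,3)] unfolding attains_def by fastforce
    then show ?thesis using True m by (intro exI[of _ 1]) auto
  next
    case False
    define P where "P k \<longleftrightarrow> (2 ^ k) ^ 5 / 2 \<le> real m" for k :: nat
    have "P 4" using False by (simp add: P_def)
    have bound: "k \<le> m" if Pk: "P k" for k
    proof (cases "k = 0")
      case False
      have "k < 2 ^ k" by (rule less_exp)
      then have "real k \<le> 2 ^ k" by (metis less_imp_le of_nat_le_iff of_nat_numeral of_nat_power)
      also have "(2::real) ^ k \<le> (2 ^ k) ^ 5 / 2"
      proof -
        have "(2::real) ^ Suc k \<le> 2 ^ (k * 5)" using False by (intro power_increasing) auto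
        then show ?thesis by (simp add: power_mult)
      qed
      also have "\<dots> \<le> real m" using Pk by (simp add: P_def)
      finally show ?thesis by simp
    qed simp
    define k where "k = Greatest P"
    have k: "P k" unfolding k_def using \<open>P 4\<close> bound by (rule GreatestI_nat)
    have k4: "k \<ge> 4" unfolding k_def using \<open>P 4\<close> bound by (rule Greatest_le_nat)
    have "\<not> P (Suc k)" unfolding k_def using bound Greatest_le_nat[of P "Suc (Greatest P)" m] by force
    then have up: "real m < 16 * (2 ^ k) ^ 5" by (simp add: P_def power_mult_distrib)
    obtain e where e: "(2 ^ k) ^ 5 / 8 \<le> real e" "real e \<le> (2 ^ k) ^ 5 / 2" "attains K e ((2 ^ k) ^ 4)"
      using fam[OF k4] by blast
    have "((2::real) ^ k) ^ 4 \<le> 8 * real e powr (4/5)"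
    proof -
      have "((2::real) ^ k) ^ 4 = (((2 ^ k) ^ 5) powr (4/5))"
        by (simp add: powr_realpow[symmetric] powr_powr mult.commute)
      also have "\<dots> \<le> (8 * real e) powr (4/5)" using e by (intro powr_mono2) auto
      also have "\<dots> = 8 powr (4/5) * real e powr (4/5)" by (simp add: powr_mult)
      also have "\<dots> \<le> 8 * real e powr (4/5)"
        using powr_mono[of "4/5" 1 "8 :: real"] by (intro mult_right_mono) auto
      finally show ?thesis .
    qed
    then have "attains K e (8 * real e powr (4/5))" using e(3) unfolding attains_def by fastforce
    moreover have "e \<le> m" using e(2) k by (simp add: P_def)
    moreover have "real m \<le> 2 ^ 20 * real e" using up e(1) by simp
    moreover have "1 \<le> e"
    proof (rule ccontr)
      assume "\<not> 1 \<le> e"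
      then have "real e = 0" by simp
      moreover have "(0::real) < (2 ^ k) ^ 5 / 8" by simp
      ultimately show False using e(1) by linarith
    qed
    ultimately show ?thesis by blast
  qed
qed auto

lemma sp_le_of_attains:
  assumes "attains K m t" "simple_graph H" "simple_graph K" "contains_copy H K"
  shows "sp m H \<le> ereal t"
proof -
  obtain G :: "nat ugraph" where G: "simple_graph G" "free_of K G" "card (edges G) = m" "surplus G \<le> t"
    using assms(1) unfolding attains_def by blast
  have "free_of H G" using G(2) contains_copy_trans[OF assms(2,3) _ assms(4)] by (auto simp: free_of_def)
  then have "sp m H \<le> ereal (surplus G)" unfolding sp_def using G by (intro INF_lower) auto
  also have "\<dots> \<le> ereal t" using G(4) by simp
  finally show ?thesis .
qed

section \<open>The triangle and the complete bipartite graph $K_{3,3}$\<close>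

lemma triangle_graph:
  "simple_graph (complete_graph 3)" "linked (complete_graph 3)" "card (verts (complete_graph 3)) = 3"
proof -
  show "simple_graph (complete_graph 3)" by (auto simp: simple_graph_def complete_graph_def)
  have "{0, 1} \<in> edges (complete_graph 3)" "{0, 2} \<in> edges (complete_graph 3)"
    by (auto simp: complete_graph_def)
  moreover have V: "verts (complete_graph 3) = {0, 1, 2}" by (auto simp: complete_graph_def)
  ultimately have "A = {} \<or> A = verts (complete_graph 3)"
    if "A \<subseteq> verts (complete_graph 3)" "\<forall>e\<in>edges (complete_graph 3). e \<subseteq> A \<or> e \<inter> A = {}" for A
  proof -
    have "{0, 1} \<subseteq> A \<or> {0, 1} \<inter> A = {}" "{0, 2} \<subseteq> A \<or> {0, 2} \<inter> A = {}"
      using that(2) \<open>{0, 1} \<in> _\<close> \<open>{0, 2} \<in> _\<close> by metis+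
    then show ?thesis using that(1) V by auto
  qed
  then show "linked (complete_graph 3)" unfolding linked_def by metis
qed (simp add: complete_graph_def)

lemma free_of_triangleI:
  assumes "simple_graph G"
    and "\<And>a b c. {a, b} \<in> edges G \<Longrightarrow> {b, c} \<in> edges G \<Longrightarrow> {a, c} \<in> edges G \<Longrightarrow> False"
  shows "free_of (complete_graph 3) G"
  unfolding free_of_def contains_copy_iff[OF triangle_graph(1)]
proof (rule notI, elim exE conjE)
  fix g assume g: "\<forall>e\<in>edges (complete_graph 3). g ` e \<in> edges G"
  have "{0, 1} \<in> edges (complete_graph 3)" "{1, 2} \<in> edges (complete_graph 3)" "{0, 2} \<in> edges (complete_graph 3)"
    by (auto simp: complete_graph_def)
  then have "g ` {0, 1} \<in> edges G" "g ` {1, 2} \<in> edges G" "g ` {0, 2} \<in> edges G" using g by blast+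
  then show False using assms(2)[of "g 0" "g 1" "g 2"] by simp
qed

lemma K33_graph:
  "simple_graph (complete_bipartite_graph 3 3)" "linked (complete_bipartite_graph 3 3)"
  "card (verts (complete_bipartite_graph 3 3)) \<ge> 3"
proof -
  let ?K = "complete_bipartite_graph 3 3"
  show "simple_graph ?K" by (auto simp: simple_graph_def complete_bipartite_graph_def)
  show "card (verts ?K) \<ge> 3" by (simp add: complete_bipartite_graph_def card_Plus)
  show "linked ?K" unfolding linked_def
  proof (intro allI impI)
    fix A assume A: "A \<subseteq> verts ?K" "\<forall>e\<in>edges ?K. e \<subseteq> A \<or> e \<inter> A = {}"
    have *: "Inl i \<in> A \<longleftrightarrow> Inr j \<in> A" if "i < 3" "j < 3" for i j
    proof -
      have "{Inl i, Inr j} \<in> edges ?K" using that by (auto simp: complete_bipartite_graph_def)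
      then have "{Inl i, Inr j} \<subseteq> A \<or> {Inl i, Inr j} \<inter> A = {}" using A(2) by metis
      then show ?thesis by auto
    qed
    have "x \<in> A \<longleftrightarrow> Inl 0 \<in> A" if "x \<in> verts ?K" for x
      using that *[of _ 0] *[of 0] by (auto simp: complete_bipartite_graph_def)
    then show "A = {} \<or> A = verts ?K" using A(1) by blast
  qed
qed

lemma free_of_K33I:
  assumes "\<And>(a :: nat \<Rightarrow> 'a) (b :: nat \<Rightarrow> 'a). inj_on a {..<3} \<Longrightarrow> inj_on b {..<3} \<Longrightarrow>
      (\<And>i j. i < 3 \<Longrightarrow> j < 3 \<Longrightarrow> {a i, b j} \<in> edges G) \<Longrightarrow> False"
  shows "free_of (complete_bipartite_graph 3 3) G"
  unfolding free_of_def contains_copy_iff[OF K33_graph(1)]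
proof (rule notI, elim exE conjE)
  fix g assume g: "inj_on g (verts (complete_bipartite_graph 3 3))"
    "\<forall>e\<in>edges (complete_bipartite_graph 3 3). g ` e \<in> edges G"
  show False
  proof (rule assms[of "g \<circ> Inl" "g \<circ> Inr"])
    show "inj_on (g \<circ> Inl) {..<3}" "inj_on (g \<circ> Inr) {..<3}"
      using g(1) by (auto simp: inj_on_def complete_bipartite_graph_def)
    fix i j :: nat assume "i < 3" "j < 3"
    then have "{Inl i, Inr j} \<in> edges (complete_bipartite_graph 3 3)"
      by (auto simp: complete_bipartite_graph_def)
    then have "g ` {Inl i, Inr j} \<in> edges G" using g(2) by blast
    then show "{(g \<circ> Inl) i, (g \<circ> Inr) j} \<in> edges G" by simp
  qed
qed

section \<open>A triangle-free graph from a generalised quadrangle\<close>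

lemma cosh_le_exp_square:
  fixes t :: real
  assumes "\<bar>t\<bar> \<le> 1"
  shows "exp t + exp (- t) \<le> 2 * exp (t\<^sup>2)"
proof -
  have *: "exp t + exp (- t) \<le> 2 * (1 + t\<^sup>2)" if t: "0 \<le> t" "t \<le> 1" for t :: real
  proof -
    have "exp t \<le> 1 + t + t\<^sup>2" using t exp_bound by simp
    moreover have "exp (- t) \<le> 1 / (1 + t)"
      using exp_ge_add_one_self[of t] t by (simp add: exp_minus field_simps)
    moreover have "1 / (1 + t) \<le> 1 - t + t\<^sup>2"
    proof -
      have "(1 - t + t\<^sup>2) * (1 + t) = 1 + t ^ 3" by (simp add: algebra_simps power2_eq_square power3_eq_cube)
      then have "1 \<le> (1 - t + t\<^sup>2) * (1 + t)" using t by simp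
      then show ?thesis using t by (simp add: divide_le_eq)
    qed
    ultimately show ?thesis by simp
  qed
  have "exp t + exp (- t) \<le> 2 * (1 + t\<^sup>2)" using *[of t] *[of "- t"] assms by (cases "t \<ge> 0") auto
  then show ?thesis using exp_ge_add_one_self[of "t\<^sup>2"] by (smt (verit))
qed

text \<open>Each further sign turns \<open>exp (c\<^sup>2 / \<mu>)\<close> into at most
  \<open>exp (1 / \<mu>) * exp (c\<^sup>2 / (\<mu> - 4))\<close>, so the induction moves \<open>\<mu>\<close>.\<close>

lemma sum_signs_exp_square:
  fixes x :: "'v \<Rightarrow> real"
  assumes "finite T" "\<And>p. p \<in> T \<Longrightarrow> x p \<in> {1, -1}" "4 * real (card T) < \<mu>"
  shows "(\<Sum>S\<in>Pow T. exp ((\<Sum>p\<in>T. signvec S p * x p)\<^sup>2 / \<mu>)) \<le>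
    2 ^ card T * exp (real (card T) / (\<mu> - 4 * real (card T)))"
  using assms
proof (induction T arbitrary: \<mu> rule: finite_induct)
  case empty
  then show ?case by simp
next
  case (insert a T)
  let ?n = "real (card T)"
  have n: "real (card (insert a T)) = ?n + 1" using insert by simp
  have mu: "4 * ?n + 4 < \<mu>" using insert.prems(2) n by simp
  then have mu0: "\<mu> > 4" by (rule le_less_trans[rotated]) simp
  have xa: "x a = 1 \<or> x a = -1" using insert.prems(1)[of a] by auto
  have step: "exp ((c - x a)\<^sup>2 / \<mu>) + exp ((c + x a)\<^sup>2 / \<mu>) \<le> 2 * exp (1 / \<mu>) * exp (c\<^sup>2 / (\<mu> - 4))"
    if c: "\<bar>c\<bar> \<le> ?n" for c
  proof -
    let ?t = "2 * c / \<mu>"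
    \<comment> \<open>Keeping \<open>\<mu>\<close> above four times the number of signs is what
      keeps this argument small.\<close>
    have t: "\<bar>?t\<bar> \<le> 1" using c mu mu0 by (simp add: abs_divide abs_mult divide_le_eq)
    have "exp ((c - x a)\<^sup>2 / \<mu>) + exp ((c + x a)\<^sup>2 / \<mu>) =
        exp (1 / \<mu>) * exp (c\<^sup>2 / \<mu>) * (exp ?t + exp (- ?t))"
      using xa by (auto simp: power2_diff power2_sum distrib_left mult_exp_exp add_divide_distrib diff_divide_distrib algebra_simps)
    also have "\<dots> \<le> exp (1 / \<mu>) * exp (c\<^sup>2 / \<mu>) * (2 * exp (?t\<^sup>2))"
      by (intro mult_left_mono cosh_le_exp_square t) auto
    also have "\<dots> = 2 * exp (1 / \<mu>) * exp (c\<^sup>2 / \<mu> + ?t\<^sup>2)" by (simp add: exp_add)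
    also have "c\<^sup>2 / \<mu> + ?t\<^sup>2 \<le> c\<^sup>2 / (\<mu> - 4)"
    proof -
      \<comment> \<open>After clearing denominators this is
        \<open>(\<mu> + 4) * (\<mu> - 4) \<le> \<mu>^2\<close>; it is the reason for the shift by
        4.\<close>
      have "1 / \<mu> + 4 / \<mu>\<^sup>2 \<le> 1 / (\<mu> - 4)"
        using mu0 by (simp add: field_simps power2_eq_square)
      then have "c\<^sup>2 * (1 / \<mu> + 4 / \<mu>\<^sup>2) \<le> c\<^sup>2 * (1 / (\<mu> - 4))" by (intro mult_left_mono) auto
      then show ?thesis by (simp add: power_divide power_mult_distrib algebra_simps)
    qed
    then have "2 * exp (1 / \<mu>) * exp (c\<^sup>2 / \<mu> + ?t\<^sup>2) \<le> 2 * exp (1 / \<mu>) * exp (c\<^sup>2 / (\<mu> - 4))"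
      by (intro mult_left_mono) auto
    finally show ?thesis .
  qed
  have "(\<Sum>S\<in>Pow (insert a T). exp ((\<Sum>p\<in>insert a T. signvec S p * x p)\<^sup>2 / \<mu>)) =
     (\<Sum>S\<in>Pow T. exp (((\<Sum>p\<in>T. signvec S p * x p) - x a)\<^sup>2 / \<mu>) + exp (((\<Sum>p\<in>T. signvec S p * x p) + x a)\<^sup>2 / \<mu>))"
    unfolding sum_Pow_insert[OF insert.hyps(1,2)]
    by (intro sum.cong refl) (simp only: sum_sign_insert[OF insert.hyps(1,2)] Pow_iff)
  also have "\<dots> \<le> (\<Sum>S\<in>Pow T. 2 * exp (1 / \<mu>) * exp ((\<Sum>p\<in>T. signvec S p * x p)\<^sup>2 / (\<mu> - 4)))"
  proof (intro sum_mono step)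
    fix S
    have "\<bar>\<Sum>p\<in>T. signvec S p * x p\<bar> \<le> (\<Sum>p\<in>T. \<bar>signvec S p * x p\<bar>)" by (rule sum_abs)
    also have "\<dots> \<le> (\<Sum>p\<in>T. 1)"
    proof (rule sum_mono)
      fix p assume "p \<in> T"
      then have "x p = 1 \<or> x p = -1" using insert.prems(1)[of p] by auto
      then show "\<bar>signvec S p * x p\<bar> \<le> 1" by (auto simp: signvec_def)
    qed
    finally show "\<bar>\<Sum>p\<in>T. signvec S p * x p\<bar> \<le> ?n" by simp
  qed
  also have "\<dots> = 2 * exp (1 / \<mu>) * (\<Sum>S\<in>Pow T. exp ((\<Sum>p\<in>T. signvec S p * x p)\<^sup>2 / (\<mu> - 4)))"
    by (simp add: sum_distrib_left)
  also have "\<dots> \<le> 2 * exp (1 / \<mu>) * (2 ^ card T * exp (?n / ((\<mu> - 4) - 4 * ?n)))"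
    using mu insert.prems(1) by (intro mult_left_mono insert.IH) auto
  also have "\<dots> = 2 ^ card (insert a T) * exp (1 / \<mu> + ?n / ((\<mu> - 4) - 4 * ?n))"
    using insert.hyps by (simp add: exp_add)
  also have "\<dots> \<le> 2 ^ card (insert a T) * exp (real (card (insert a T)) / (\<mu> - 4 * real (card (insert a T))))"
  proof -
    \<comment> \<open>Each sign contributes a factor \<open>exp (1 / \<mu>)\<close> with its own
      \<open>\<mu>\<close>; all of them are bounded by the one with the final, smallest
      value.\<close>
    have "1 / \<mu> \<le> 1 / (\<mu> - 4 - 4 * ?n)" using mu mu0 by (intro divide_left_mono) auto
    then have "1 / \<mu> + ?n / ((\<mu> - 4) - 4 * ?n) \<le> (?n + 1) / (\<mu> - 4 - 4 * ?n)"
      by (simp add: add_divide_distrib)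
    also have "\<dots> = real (card (insert a T)) / (\<mu> - 4 * real (card (insert a T)))"
      unfolding n by (simp add: diff_diff_eq add.commute)
    finally show ?thesis by (intro mult_left_mono) simp_all
  qed
  finally show ?case .
qed

text \<open>A partial linear space in which three pairwise collinear points share a line. Having as
  many lines as points is what makes the union bound work: the \<open>2 ^ card V\<close> cuts are
  paid for by a constant factor per line.\<close>

locale triangle_free_lines =
  fixes V :: "'p set" and L :: "'l set" and pts :: "'l \<Rightarrow> 'p set" and q :: nat
  assumes finV: "finite V" and finL: "finite L"
    and pts_sub: "l \<in> L \<Longrightarrow> pts l \<subseteq> V"
    and card_pts: "l \<in> L \<Longrightarrow> card (pts l) = q"
    and card_eq: "card V = card L"
    and two_points: "l \<in> L \<Longrightarrow> l' \<in> L \<Longrightarrow> a \<in> pts l \<inter> pts l' \<Longrightarrow> b \<in> pts l \<inter> pts l' \<Longrightarrow> a \<noteq> b \<Longrightarrow> l = l'"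
    and no_triangle: "l \<in> L \<Longrightarrow> l' \<in> L \<Longrightarrow> l'' \<in> L \<Longrightarrow> a \<in> pts l \<inter> pts l' \<Longrightarrow> b \<in> pts l' \<inter> pts l'' \<Longrightarrow>
      c \<in> pts l'' \<inter> pts l \<Longrightarrow> a \<noteq> b \<Longrightarrow> b \<noteq> c \<Longrightarrow> a \<noteq> c \<Longrightarrow> l = l'"
    and q_pos: "q > 0"
begin

text \<open>Choose an independent uniform subset of each line. For a fixed cut the moment
  \<open>exp (s / (8 * q))\<close> of the sum \<open>s\<close> of squares averages to at most
  \<open>exp (1 / 4)\<close> per line. Summing over all cuts gives a choice whose total is at most
  \<open>(2 * exp (1 / 4)) ^ card V\<close>, and this bounds every single cut.\<close>

lemma good_signs:
  obtains f where "\<And>l. l \<in> L \<Longrightarrow> f l \<subseteq> pts l"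
    "\<And>x :: 'p \<Rightarrow> real. (\<And>v. v \<in> V \<Longrightarrow> x v \<in> {1, -1}) \<Longrightarrow>
      (\<Sum>l\<in>L. (\<Sum>p\<in>pts l. signvec (f l) p * x p)\<^sup>2) \<le> 8 * real q * real (card V)"
proof -
  let ?N = "card V"
  let ?c = "\<lambda>S W l. \<Sum>p\<in>pts l. signvec S p * signvec W p :: real"
  let ?F = "PiE L (\<lambda>l. Pow (pts l))"
  \<comment> \<open>A product over lines, so that the sum over all choices \<open>f\<close>
    factorises.\<close>
  define w where "w f W = (\<Prod>l\<in>L. exp ((?c (f l) W l)\<^sup>2 / (8 * real q)))" for f W
  have fin: "finite (pts l)" if "l \<in> L" for l using pts_sub[OF that] finV finite_subset by blast
  have finF: "finite ?F" using finL fin by (intro finite_PiE) auto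
  have cardF: "card ?F = (2 ^ q) ^ ?N"
    using finL fin card_pts by (simp add: card_PiE card_Pow card_eq)
  have "(\<Sum>f\<in>?F. \<Sum>W\<in>Pow V. w f W) = (\<Sum>W\<in>Pow V. \<Sum>f\<in>?F. w f W)" by (rule sum.swap)
  also have "\<dots> \<le> (\<Sum>W\<in>Pow V. ((2 ^ q) * exp (1 / 4)) ^ ?N)"
  proof (rule sum_mono)
    fix W
    have "(\<Sum>f\<in>?F. w f W) = (\<Prod>l\<in>L. \<Sum>S\<in>Pow (pts l). exp ((?c S W l)\<^sup>2 / (8 * real q)))"
      unfolding w_def using finL fin by (subst prod_sum_PiE) auto
    also have "\<dots> \<le> (\<Prod>l\<in>L. (2 ^ q) * exp (1 / 4))"
    proof (rule prod_mono, intro conjI)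
      fix l assume l: "l \<in> L"
      \<comment> \<open>The parameter \<open>\<mu> = 8 * q\<close> gives the exponent
        \<open>q / (8 * q - 4 * q) = 1 / 4\<close>.\<close>
      have "(\<Sum>S\<in>Pow (pts l). exp ((?c S W l)\<^sup>2 / (8 * real q))) \<le>
          2 ^ card (pts l) * exp (real (card (pts l)) / (8 * real q - 4 * real (card (pts l))))"
        using q_pos by (intro sum_signs_exp_square fin l) (auto simp: signvec_def card_pts l)
      then show "(\<Sum>S\<in>Pow (pts l). exp ((?c S W l)\<^sup>2 / (8 * real q))) \<le> 2 ^ q * exp (1 / 4)"
        using q_pos by (simp add: card_pts l)
    qed (simp add: sum_nonneg)
    also have "\<dots> = ((2 ^ q) * exp (1 / 4)) ^ ?N" by (simp add: card_eq)
    finally show "(\<Sum>f\<in>?F. w f W) \<le> ((2 ^ q) * exp (1 / 4)) ^ ?N" .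
  qed
  also have "\<dots> = (\<Sum>f\<in>?F. (2 * exp (1 / 4)) ^ ?N)"
    using finV by (simp add: cardF card_Pow power_mult_distrib)
  finally have sum: "(\<Sum>f\<in>?F. \<Sum>W\<in>Pow V. w f W) \<le> (\<Sum>f\<in>?F. (2 * exp (1 / 4)) ^ ?N)" .
  have "\<exists>f\<in>?F. (\<Sum>W\<in>Pow V. w f W) \<le> (2 * exp (1 / 4)) ^ ?N"
  proof (rule ccontr)
    assume "\<not> ?thesis"
    then have "(\<Sum>f\<in>?F. (2 * exp (1 / 4)) ^ ?N) < (\<Sum>f\<in>?F. \<Sum>W\<in>Pow V. w f W)"
      using finF cardF by (intro sum_strict_mono) (auto simp: not_le card_gt_0_iff[symmetric])
    then show False using sum by linarith
  qed
  then obtain f where f: "f \<in> ?F" "(\<Sum>W\<in>Pow V. w f W) \<le> (2 * exp (1 / 4)) ^ ?N" by blast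
  show ?thesis
  proof (rule that)
    show "f l \<subseteq> pts l" if "l \<in> L" for l using f(1) that by auto
    fix x :: "'p \<Rightarrow> real" assume x: "\<And>v. v \<in> V \<Longrightarrow> x v \<in> {1, -1}"
    define W where "W = {v \<in> V. x v = 1}"
    have xW: "x v = signvec W v" if "v \<in> V" for v using x[OF that] that by (auto simp: W_def signvec_def)
    define s where "s = (\<Sum>l\<in>L. (\<Sum>p\<in>pts l. signvec (f l) p * x p)\<^sup>2)"
    have "s = (\<Sum>l\<in>L. (?c (f l) W l)\<^sup>2)"
      unfolding s_def using pts_sub xW
      by (intro sum.cong refl arg_cong[where f = "\<lambda>y. y\<^sup>2"]) (auto intro!: sum.cong)
    then have "exp (s / (8 * real q)) = w f W"
      unfolding w_def using finL by (simp add: exp_sum sum_divide_distrib)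
    also have "\<dots> \<le> (\<Sum>W\<in>Pow V. w f W)"
      using finV by (intro member_le_sum) (auto simp: W_def w_def prod_nonneg)
    also have "\<dots> \<le> (2 * exp (1 / 4)) ^ ?N" by (rule f(2))
    also have "\<dots> = exp (real ?N * (ln 2 + 1 / 4))"
      by (simp add: exp_of_nat_mult exp_add)
    also have "\<dots> \<le> exp (real ?N * 1)"
    proof -
      \<comment> \<open>A bound \<open>ln 2 \<le> 3 / 4\<close>, so that
        \<open>ln 2 + 1 / 4 \<le> 1\<close>.\<close>
      have "(1 + 1 / 8 :: real) ^ 6 \<le> exp (1 / 8) ^ 6" by (intro power_mono exp_ge_add_one_self) simp
      moreover have "(2::real) \<le> (1 + 1 / 8) ^ 6" by (simp add: power_divide)
      moreover have "exp (1 / 8 :: real) ^ 6 = exp (3 / 4)" by (simp add: exp_of_nat_mult[symmetric])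
      ultimately have "(2::real) \<le> exp (3 / 4)" by (metis order_trans)
      then have "ln 2 \<le> (3 / 4 :: real)" by (simp add: ln_le_cancel_iff[symmetric] del: ln_le_cancel_iff)
      then have "real ?N * (ln 2 + 1 / 4) \<le> real ?N * 1" by (intro mult_left_mono) auto
      then show ?thesis by simp
    qed
    finally have "s / (8 * real q) \<le> real ?N" by simp
    then show "s \<le> 8 * real q * real ?N" using q_pos by (simp add: divide_le_eq mult_ac)
  qed
qed

text \<open>Two uses of the same choice of subsets: the signs of an optimal cut bound the surplus,
  and the constant vector 1 shows that the subsets are balanced enough to leave many edges.\<close>

lemma attains_triangle:
  obtains e where "attains (complete_graph 3) e (real q * real (card V))"
    "real (card V) * (real q - 8) * real q / 4 \<le> real e" "real e \<le> real (card V) * (real q)\<^sup>2 / 4"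
proof -
  obtain f where f: "\<And>l. l \<in> L \<Longrightarrow> f l \<subseteq> pts l"
    "\<And>x :: 'p \<Rightarrow> real. (\<And>v. v \<in> V \<Longrightarrow> x v \<in> {1, -1}) \<Longrightarrow>
      (\<Sum>l\<in>L. (\<Sum>p\<in>pts l. signvec (f l) p * x p)\<^sup>2) \<le> 8 * real q * real (card V)"
    using good_signs by blast
  have fin: "finite (pts l)" if "l \<in> L" for l using pts_sub[OF that] finV finite_subset by blast
  define P where "P = (\<Union>l\<in>L. f l \<times> (pts l - f l))"
  define G where "G = Graph V ((\<lambda>(a, b). {a, b}) ` P)"
  have PE: "\<exists>l\<in>L. a \<in> f l \<and> b \<in> pts l - f l \<and> a \<in> pts l \<and> b \<in> pts l \<and> a \<noteq> b" if "(a, b) \<in> P" for a b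
    using that f(1) unfolding P_def by blast
  have simple: "simple_graph G"
    unfolding simple_graph_def
  proof (intro conjI ballI)
    show "finite (verts G)" using finV by (simp add: G_def)
    fix e assume "e \<in> edges G"
    then obtain a b where ab: "e = {a, b}" "(a, b) \<in> P" by (auto simp: G_def)
    then show "e \<subseteq> verts G" "card e = 2" using PE[OF ab(2)] pts_sub by (auto simp: G_def)
  qed
  have orient: "orientation P G"
    unfolding orientation_def bij_betw_def
  proof
    show "inj_on (\<lambda>(a, b). {a, b}) P"
    proof (rule inj_onI, clarify)
      fix a b c d assume ab: "(a, b) \<in> P" and cd: "(c, d) \<in> P" and eq: "{a, b} = {c, d}"
      show "a = c \<and> b = d"
      proof (rule ccontr)
        assume "\<not> (a = c \<and> b = d)"
        then have "c = b" "d = a" using eq by (auto simp: doubleton_eq_iff)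
        obtain l where l: "l \<in> L" "a \<in> f l" "b \<in> pts l - f l" "a \<in> pts l"
          using PE[OF ab] by blast
        obtain l' where l': "l' \<in> L" "c \<in> f l'" "d \<in> pts l' - f l'" "c \<in> pts l'" "c \<noteq> d"
          using PE[OF cd] by blast
        note l' = l'[unfolded \<open>c = b\<close> \<open>d = a\<close>]
        have "l = l'" by (rule two_points[of l l' a b]) (use l l' in auto)
        then show False using l l' by blast
      qed
    qed
  qed (simp add: G_def)
  \<comment> \<open>Between the parts of a line the form is a product \<open>a * b\<close>, and
    \<open>4 * a * b = (a + b)^2 - (a - b)^2\<close>. Only the second square, the one controlled by
    \<open>good_signs\<close>, can make the form negative.\<close>
  have cf: "cut_form G y = (\<Sum>l\<in>L. ((\<Sum>p\<in>pts l. y p)\<^sup>2 - (\<Sum>p\<in>pts l. signvec (f l) p * y p)\<^sup>2) / 4)" for y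
  proof -
    have "cut_form G y = (\<Sum>(a, b)\<in>P. y a * y b)" by (rule cut_form_orientation[OF simple orient])
    also have "\<dots> = (\<Sum>l\<in>L. \<Sum>(a, b)\<in>f l \<times> (pts l - f l). y a * y b)"
      unfolding P_def
    proof (rule sum.UNION_disjoint[OF finL])
      have "finite (f l \<times> (pts l - f l))" if "l \<in> L" for l
        using finite_subset[OF f(1)[OF that] fin[OF that]] fin[OF that] by simp
      then show "\<forall>l\<in>L. finite (f l \<times> (pts l - f l))" ..
      show "\<forall>l\<in>L. \<forall>l'\<in>L. l \<noteq> l' \<longrightarrow> f l \<times> (pts l - f l) \<inter> f l' \<times> (pts l' - f l') = {}"
      proof (intro ballI impI)
        fix l l' assume l: "l \<in> L" "l' \<in> L" "l \<noteq> l'"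
        show "f l \<times> (pts l - f l) \<inter> f l' \<times> (pts l' - f l') = {}"
        proof (rule ccontr)
          assume "f l \<times> (pts l - f l) \<inter> f l' \<times> (pts l' - f l') \<noteq> {}"
          then obtain a b where ab: "a \<in> f l" "a \<in> f l'" "b \<in> pts l" "b \<in> pts l'" "b \<notin> f l" by blast
          have "l = l'" by (rule two_points[OF l(1,2), of a b]) (use ab f(1) l in auto)
          then show False using l(3) by simp
        qed
      qed
    qed
    also have "\<dots> = (\<Sum>l\<in>L. ((\<Sum>p\<in>pts l. y p)\<^sup>2 - (\<Sum>p\<in>pts l. signvec (f l) p * y p)\<^sup>2) / 4)"
    proof (rule sum.cong[OF refl])
      fix l assume l: "l \<in> L"
      let ?a = "\<Sum>p\<in>f l. y p" and ?b = "\<Sum>p\<in>pts l - f l. y p"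
      have "(\<Sum>(a, b)\<in>f l \<times> (pts l - f l). y a * y b) = ?a * ?b"
        by (simp add: sum_product sum.cartesian_product)
      moreover have "(\<Sum>p\<in>pts l. y p) = ?b + ?a"
        by (rule sum.subset_diff[OF f(1)[OF l] fin[OF l]])
      moreover have "(\<Sum>p\<in>pts l. signvec (f l) p * y p) = ?a - ?b"
        unfolding sum.subset_diff[OF f(1)[OF l] fin[OF l], of "\<lambda>p. signvec (f l) p * y p"]
        by (simp add: signvec_def sum_negf)
      ultimately show "(\<Sum>(a, b)\<in>f l \<times> (pts l - f l). y a * y b) =
          ((\<Sum>p\<in>pts l. y p)\<^sup>2 - (\<Sum>p\<in>pts l. signvec (f l) p * y p)\<^sup>2) / 4"
        by (simp add: power2_sum power2_diff)
    qed
    finally show ?thesis .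
  qed
  have "free_of (complete_graph 3) G"
  proof (rule free_of_triangleI[OF simple])
    fix a b c assume e: "{a, b} \<in> edges G" "{b, c} \<in> edges G" "{a, c} \<in> edges G"
    have line: "\<exists>l\<in>L. u \<in> pts l \<and> v \<in> pts l \<and> u \<noteq> v \<and> (u \<in> f l \<longleftrightarrow> v \<notin> f l)" if "{u, v} \<in> edges G" for u v
    proof -
      have "(u, v) \<in> P \<or> (v, u) \<in> P" using that by (auto simp: G_def doubleton_eq_iff)
      then show ?thesis using PE[of u v] PE[of v u] by blast
    qed
    obtain l1 where l1: "l1 \<in> L" "a \<in> pts l1" "b \<in> pts l1" "a \<noteq> b" "a \<in> f l1 \<longleftrightarrow> b \<notin> f l1" using line[OF e(1)] by blast
    obtain l2 where l2: "l2 \<in> L" "b \<in> pts l2" "c \<in> pts l2" "b \<noteq> c" "b \<in> f l2 \<longleftrightarrow> c \<notin> f l2" using line[OF e(2)] by blast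
    obtain l3 where l3: "l3 \<in> L" "a \<in> pts l3" "c \<in> pts l3" "a \<noteq> c" "a \<in> f l3 \<longleftrightarrow> c \<notin> f l3" using line[OF e(3)] by blast
    \<comment> \<open>A triangle must lie on one line, where the edges form a bipartite
      graph.\<close>
    have "l1 = l2" using no_triangle[of l1 l2 l3 b c a] l1 l2 l3 by auto
    then have "l1 = l3" using two_points[of l1 l3 a c] l1 l2 l3 by auto
    then show False using \<open>l1 = l2\<close> l1 l2 l3 by blast
  qed
  moreover have "surplus G \<le> real q * real (card V)"
  proof -
    obtain s where s: "\<And>v. s v \<in> {1, -1 :: real}" "surplus G = - cut_form G s / 2"
      using surplus_attained[OF simple] by blast
    have "- (8 * real q * real (card V)) / 4 \<le> - (\<Sum>l\<in>L. (\<Sum>p\<in>pts l. signvec (f l) p * s p)\<^sup>2) / 4"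
      using f(2)[of s] s(1) by (simp del: insert_iff)
    also have "\<dots> = (\<Sum>l\<in>L. - (\<Sum>p\<in>pts l. signvec (f l) p * s p)\<^sup>2 / 4)"
      by (simp add: sum_negf sum_divide_distrib)
    also have "\<dots> \<le> cut_form G s" unfolding cf by (intro sum_mono) simp
    finally show ?thesis using s(2) by simp
  qed
  moreover have edges: "real (card (edges G)) = (real (card V) * (real q)\<^sup>2 - (\<Sum>l\<in>L. (\<Sum>p\<in>pts l. signvec (f l) p * 1)\<^sup>2)) / 4"
  proof -
    have "real (card (edges G)) = cut_form G (\<lambda>_. 1)" by (simp add: cut_form_def)
    also have "\<dots> = (\<Sum>l\<in>L. ((real q)\<^sup>2 - (\<Sum>p\<in>pts l. signvec (f l) p * 1)\<^sup>2) / 4)"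
      unfolding cf by (intro sum.cong) (auto simp: card_pts)
    also have "\<dots> = (real (card V) * (real q)\<^sup>2 - (\<Sum>l\<in>L. (\<Sum>p\<in>pts l. signvec (f l) p * 1)\<^sup>2)) / 4"
      by (simp add: sum_subtractf sum_divide_distrib[symmetric] card_eq)
    finally show ?thesis .
  qed
  ultimately have "attains (complete_graph 3) (card (edges G)) (real q * real (card V))"
    using attainsI[OF simple triangle_graph(1)] by blast
  moreover have "real (card V) * (real q - 8) * real q / 4 \<le> real (card (edges G))"
  proof -
    have "(\<Sum>l\<in>L. (\<Sum>p\<in>pts l. signvec (f l) p * 1)\<^sup>2) \<le> 8 * real q * real (card V)"
      using f(2)[of "\<lambda>_. 1"] by simp
    moreover have "real (card V) * (real q - 8) * real q =
        real (card V) * (real q)\<^sup>2 - 8 * real q * real (card V)"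
      by (simp add: power2_eq_square algebra_simps)
    ultimately show ?thesis unfolding edges by (intro divide_right_mono) simp_all
  qed
  moreover have "real (card (edges G)) \<le> real (card V) * (real q)\<^sup>2 / 4"
    unfolding edges by (simp add: sum_nonneg)
  ultimately show ?thesis by (rule that)
qed

end


text \<open>The Lazebnik--Ustimenko incidence structure: the points on a line are determined by
  their first coordinate, and so are the lines through a point.\<close>

lemma attains_triangle_field:
  fixes F :: "'a :: field set"
  assumes F: "finite F" "card F = q" "q \<ge> 16"
    and closed: "\<And>x y z. x \<in> F \<Longrightarrow> y \<in> F \<Longrightarrow> z \<in> F \<Longrightarrow> x * y - z \<in> F"
  shows "\<exists>e. real q ^ 5 / 8 \<le> real e \<and> real e \<le> real q ^ 5 / 2 \<and> attains (complete_graph 3) e (real q ^ 4)"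
proof -
  define pt where "pt l x = (case l of (l1, l2, l3) \<Rightarrow> (x, x * l1 - l2, x * l2 - l3))" for l :: "'a \<times> 'a \<times> 'a" and x
  define pts where "pts l = pt l ` F" for l
  define V where "V = F \<times> F \<times> F"
  have mem: "(p1, p2, p3) \<in> pts (l1, l2, l3) \<longleftrightarrow> p1 \<in> F \<and> p2 = p1 * l1 - l2 \<and> p3 = p1 * l2 - l3" for p1 p2 p3 l1 l2 l3
    by (auto simp: pts_def pt_def)
  have two: "l = l'" if "a \<in> pts l \<inter> pts l'" "b \<in> pts l \<inter> pts l'" "a \<noteq> b" for l l' a b
  proof -
    obtain a1 a2 a3 b1 b2 b3 l1 l2 l3 m1 m2 m3
      where eqs: "a = (a1, a2, a3)" "b = (b1, b2, b3)" "l = (l1, l2, l3)" "l' = (m1, m2, m3)"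
      by (metis prod.exhaust)
    have h: "a1 * l1 - l2 = a1 * m1 - m2" "b1 * l1 - l2 = b1 * m1 - m2"
      "a1 * l2 - l3 = a1 * m2 - m3"
      using that(1,2) unfolding eqs mem Int_iff by auto
    \<comment> \<open>On a given line the first coordinate determines the point.\<close>
    have "a1 \<noteq> b1" using that unfolding eqs mem Int_iff by auto
    moreover have "(a1 - b1) * (l1 - m1) = (a1 * l1 - l2) - (a1 * m1 - m2) - ((b1 * l1 - l2) - (b1 * m1 - m2))"
      by (simp add: algebra_simps)
    then have "(a1 - b1) * (l1 - m1) = 0" unfolding h by simp
    ultimately have "l1 = m1" by simp
    then show ?thesis using h unfolding eqs by auto
  qed
  have tri: "l = l'" if "a \<in> pts l \<inter> pts l'" "b \<in> pts l' \<inter> pts l''" "c \<in> pts l'' \<inter> pts l"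
    "a \<noteq> b" "b \<noteq> c" "a \<noteq> c" for l l' l'' a b c
  proof -
    obtain a1 a2 a3 b1 b2 b3 c1 c2 c3 l1 l2 l3 m1 m2 m3 n1 n2 n3
      where eqs: "a = (a1, a2, a3)" "b = (b1, b2, b3)" "c = (c1, c2, c3)"
        "l = (l1, l2, l3)" "l' = (m1, m2, m3)" "l'' = (n1, n2, n3)"
      by (metis prod.exhaust)
    have h: "a1 * l1 - l2 = a1 * m1 - m2" "a1 * l2 - l3 = a1 * m2 - m3"
        "b1 * m1 - m2 = b1 * n1 - n2" "b1 * m2 - m3 = b1 * n2 - n3"
        "c1 * n1 - n2 = c1 * l1 - l2" "c1 * n2 - n3 = c1 * l2 - l3"
      using that(1-3) unfolding eqs mem Int_iff by auto
    have ne: "a1 \<noteq> b1" "b1 \<noteq> c1" "a1 \<noteq> c1" using that unfolding eqs mem Int_iff by auto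
    have d: "l2 - m2 = a1 * (l1 - m1)" "m2 - n2 = b1 * (m1 - n1)" "n2 - l2 = c1 * (n1 - l1)"
      "l3 - m3 = a1 * (l2 - m2)" "m3 - n3 = b1 * (m2 - n2)" "n3 - l3 = c1 * (n2 - l2)"
      using h by (simp_all add: algebra_simps)
    have "a1 * (l1 - m1) + b1 * (m1 - n1) + c1 * (n1 - l1) = 0"
      unfolding d(1-3)[symmetric] by simp
    moreover have "a1 * (a1 * (l1 - m1)) + b1 * (b1 * (m1 - n1)) + c1 * (c1 * (n1 - l1)) = 0"
      unfolding d(1-3)[symmetric] d(4-6)[symmetric] by simp
    \<comment> \<open>A Vandermonde system in \<open>l1 - m1\<close>, \<open>m1 - n1\<close>,
      \<open>n1 - l1\<close>: these sum to zero, also with weights \<open>a1\<close>,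
      \<open>b1\<close>, \<open>c1\<close> and with the squared weights. The identity eliminates the
      last two unknowns.\<close>
    moreover have "(a1 - b1) * (a1 - c1) * (l1 - m1) =
        (a1 * (a1 * (l1 - m1)) + b1 * (b1 * (m1 - n1)) + c1 * (c1 * (n1 - l1)))
        - (b1 + c1) * (a1 * (l1 - m1) + b1 * (m1 - n1) + c1 * (n1 - l1))"
      by (simp add: algebra_simps)
    ultimately have "(a1 - b1) * (a1 - c1) * (l1 - m1) = 0" by simp
    then have "l1 = m1" using ne by simp
    then show ?thesis using d(1,4) unfolding eqs by simp
  qed
  interpret triangle_free_lines V V pts q
  proof
    show "finite V" using F(1) by (auto simp: V_def)
    show "pts l \<subseteq> V" if "l \<in> V" for l
      using that closed unfolding V_def pts_def pt_def by auto
    show "card (pts l) = q" if "l \<in> V" for l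
    proof -
      have "inj_on (pt l) F" by (auto simp: inj_on_def pt_def split: prod.splits)
      then show ?thesis by (simp add: pts_def card_image F(2))
    qed
    show "l = l'" if "l \<in> V" "l' \<in> V" "a \<in> pts l \<inter> pts l'" "b \<in> pts l \<inter> pts l'" "a \<noteq> b" for l l' a b
      using two[OF that(3-5)] .
    show "l = l'" if "l \<in> V" "l' \<in> V" "l'' \<in> V" "a \<in> pts l \<inter> pts l'" "b \<in> pts l' \<inter> pts l''"
      "c \<in> pts l'' \<inter> pts l" "a \<noteq> b" "b \<noteq> c" "a \<noteq> c" for l l' l'' a b c
      using tri[OF that(4-9)] .
    show "q > 0" using F(3) by simp
  qed auto
  have V: "real (card V) = real q ^ 3" by (simp add: V_def card_cartesian_product F(2) power3_eq_cube)
  obtain e where e: "attains (complete_graph 3) e (real q * real (card V))"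
    "real (card V) * (real q - 8) * real q / 4 \<le> real e" "real e \<le> real (card V) * (real q)\<^sup>2 / 4"
    by (rule attains_triangle)
  have "real q ^ 5 / 8 \<le> real e"
  proof -
    \<comment> \<open>This is where \<open>q \<ge> 16\<close> enters, and it explains the 8 in
      \<open>q ^ 5 / 8\<close>.\<close>
    have "real q / 2 \<le> real q - 8" using F(3) by simp
    then have "real q ^ 4 * (real q / 2) \<le> real q ^ 4 * (real q - 8)" by (intro mult_left_mono) auto
    moreover have "real q ^ 4 * (real q / 2) = real q ^ 5 / 2" by (simp add: power_eq_if[of _ 5])
    moreover have "real (card V) * (real q - 8) * real q = real q ^ 4 * (real q - 8)"
      unfolding V by (simp add: power_eq_if[of _ 4] power3_eq_cube)
    ultimately have "real q ^ 5 / 2 \<le> real (card V) * (real q - 8) * real q" by metis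
    then show ?thesis using e(2) by linarith
  qed
  moreover have "real e \<le> real q ^ 5 / 2"
  proof -
    have "real (card V) * (real q)\<^sup>2 = real q ^ 5" unfolding V by (simp add: power_add[symmetric])
    moreover have "0 \<le> real q ^ 5" by simp
    ultimately show ?thesis using e(3) by linarith
  qed
  moreover have "real q * real (card V) = real q ^ 4" unfolding V by (simp add: power_eq_if[of _ 4] power3_eq_cube)
  ultimately show ?thesis using e(1) by metis
qed

section \<open>Finite fields of characteristic two\<close>

text \<open>Splitting off a root \<open>x\<close> from \<open>p\<close> leaves \<open>r\<close> with
  \<open>r(x) = p'(x)\<close>, so simple roots never recur. The sizes of the finite fields and of
  the norm fibres below are such root counts.\<close>

lemma card_roots_separable:
  fixes p :: "'a :: alg_closed_field poly"
  assumes "p \<noteq> 0" "\<And>x. poly p x = 0 \<Longrightarrow> poly (pderiv p) x \<noteq> 0"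
  shows "card {x. poly p x = 0} = degree p"
  using assms
proof (induction "degree p" arbitrary: p rule: less_induct)
  case less
  show ?case
  proof (cases "degree p = 0")
    case True
    then obtain c where "p = [:c:]" by (rule degree_eq_zeroE)
    then show ?thesis using less.prems by simp
  next
    case False
    then obtain x where x: "poly p x = 0" using alg_closed_imp_poly_has_root by blast
    then obtain r where r: "p = [:- x, 1:] * r" by (auto simp: poly_eq_0_iff_dvd)
    have r0: "r \<noteq> 0" using r less.prems(1) by auto
    have deg: "degree p = Suc (degree r)" unfolding r using r0 by (subst degree_mult_eq) auto
    have pd: "pderiv p = r + [:- x, 1:] * pderiv r" unfolding r pderiv_mult by (simp add: pderiv_pCons)
    have rx: "poly r x \<noteq> 0" using less.prems(2)[OF x] by (simp add: pd)
    have "card {y. poly r y = 0} = degree r"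
    proof (rule less.hyps)
      fix y assume y: "poly r y = 0"
      then have "poly p y = 0" by (simp add: r)
      from less.prems(2)[OF this] show "poly (pderiv r) y \<noteq> 0" using y by (auto simp: pd)
    qed (use deg r0 in auto)
    moreover have "{y. poly p y = 0} = insert x {y. poly r y = 0}" by (auto simp: r)
    moreover have "finite {y. poly r y = 0}" using r0 by (rule poly_roots_finite)
    ultimately show ?thesis using rx deg by simp
  qed
qed

text \<open>One algebraically closed field contains all fields of order \<open>2 ^ k\<close> as
  subsets, so field extensions become inclusions.\<close>

type_synonym gf2 = "bit alg_closure"

lemma gf2_add_self [simp]: "(x :: gf2) + x = 0"
proof -
  have "(1 :: gf2) + 1 = to_ac (1 + 1 :: bit)" by (simp only: to_ac_add to_ac_1)
  also have "\<dots> = 0" by simp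
  finally show ?thesis by (metis distrib_left mult_1_right mult_zero_right)
qed

lemma gf2_two [simp]: "(2 :: gf2) = 0"
  by (metis gf2_add_self one_add_one)

lemma gf2_uminus [simp]: "- (x :: gf2) = x"
  by (simp add: minus_unique)

text \<open>As a rewrite rule it removes all subtraction, so that ring normalisation plus
  cancellation of equal summands decides identities in characteristic two.\<close>

lemma gf2_diff [simp]: "(x :: gf2) - y = x + y"
  by (simp add: diff_conv_add_uminus del: add_uminus_conv_diff)

lemma gf2_add_eq_0_iff [simp]: "(x :: gf2) + y = 0 \<longleftrightarrow> x = y"
  by (metis gf2_diff right_minus_eq)

lemma gf2_of_nat_even: "even n \<Longrightarrow> of_nat n = (0 :: gf2)"
  by (auto elim!: evenE simp: mult_2)

lemma gf2_frobenius: "((x :: gf2) + y) ^ (2 ^ k) = x ^ (2 ^ k) + y ^ (2 ^ k)"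
proof (induction k)
  case (Suc k)
  have sq: "(a + b)\<^sup>2 = a\<^sup>2 + b\<^sup>2" for a b :: gf2
  proof -
    have "(a + b)\<^sup>2 = a\<^sup>2 + b\<^sup>2 + (a * b + a * b)" by (simp add: power2_eq_square algebra_simps)
    then show ?thesis by simp
  qed
  have "(x + y) ^ (2 ^ Suc k) = ((x + y) ^ (2 ^ k))\<^sup>2" by (simp add: power_mult[symmetric] mult.commute)
  also have "\<dots> = (x ^ (2 ^ k))\<^sup>2 + (y ^ (2 ^ k))\<^sup>2" by (simp add: Suc sq)
  finally show ?case by (simp add: power_mult[symmetric] mult.commute)
qed simp

text \<open>For \<open>n\<close> a power of two these are the fixed points of a power of the
  Frobenius map, that is, the subfield of order \<open>n\<close>.\<close>

definition GF :: "nat \<Rightarrow> gf2 set" where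
  "GF n = {x. x ^ n = x}"

locale field_pair =
  fixes k q :: nat
  assumes k_pos: "k > 0" and q_def: "q = 2 ^ k"
begin

lemma q_ge: "q \<ge> 2"
proof -
  have "(2::nat) ^ 1 \<le> 2 ^ k" using k_pos by (intro power_increasing) auto
  then show ?thesis by (simp add: q_def)
qed

lemma frob: "(x + y :: gf2) ^ q = x ^ q + y ^ q"
  unfolding q_def by (rule gf2_frobenius)

lemma frob2: "(x + y :: gf2) ^ (q\<^sup>2) = x ^ (q\<^sup>2) + y ^ (q\<^sup>2)"
  unfolding q_def by (simp add: power_mult[symmetric] gf2_frobenius)

text \<open>For even \<open>n\<close> the polynomial \<open>X^n + X\<close> has derivative 1, so its
  roots are simple.\<close>

lemma card_GF:
  assumes "even n" "n \<ge> 2"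
  shows "card (GF n) = n" "finite (GF n)"
proof -
  let ?p = "monom 1 n + monom 1 1 :: gf2 poly"
  have roots: "{x. poly ?p x = 0} = GF n" by (auto simp: GF_def poly_monom)
  have deg: "degree ?p = n"
    using assms by (subst degree_add_eq_left) (auto simp: degree_monom_eq)
  have "pderiv ?p = 1"
    using assms(1) by (simp add: pderiv_add pderiv_monom gf2_of_nat_even monom_0 one_pCons)
  moreover have "?p \<noteq> 0" using deg assms(2) by (metis degree_0 not_numeral_le_zero)
  ultimately have "card {x. poly ?p x = 0} = degree ?p" by (intro card_roots_separable) auto
  then show "card (GF n) = n" by (simp only: roots deg)
  then show "finite (GF n)" using assms(2) by (metis card.infinite not_numeral_le_zero)
qed

abbreviation F where "F \<equiv> GF q"
abbreviation E where "E \<equiv> GF (q\<^sup>2)"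

lemma q_even: "even q" using k_pos by (simp add: q_def)

lemma card_F: "card F = q" "finite F"
  using card_GF[of q] q_ge q_even by auto

lemma card_E: "card E = q\<^sup>2" "finite E"
proof -
  have "q\<^sup>2 \<ge> 2" using q_ge self_le_power[of q 2] by linarith
  then show "card E = q\<^sup>2" "finite E" using card_GF[of "q\<^sup>2"] q_even by auto
qed

lemma F_closed: "0 \<in> F" "1 \<in> F" "x \<in> F \<Longrightarrow> y \<in> F \<Longrightarrow> x + y \<in> F" "x \<in> F \<Longrightarrow> y \<in> F \<Longrightarrow> x * y \<in> F"
  "x \<in> F \<Longrightarrow> y \<in> F \<Longrightarrow> x / y \<in> F"
  using q_ge by (auto simp: GF_def frob power_mult_distrib power_divide)

lemma E_closed: "0 \<in> E" "1 \<in> E" "x \<in> E \<Longrightarrow> y \<in> E \<Longrightarrow> x + y \<in> E" "x \<in> E \<Longrightarrow> y \<in> E \<Longrightarrow> x * y \<in> E"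
  "x \<in> E \<Longrightarrow> y \<in> E \<Longrightarrow> x / y \<in> E"
  using q_ge by (auto simp: GF_def frob2 power_mult_distrib power_divide)

text \<open>The norm of the quadratic extension \<open>E\<close> over \<open>F\<close>: the product
  of \<open>x\<close> and its conjugate \<open>x ^ q\<close>.\<close>

definition nrm :: "gf2 \<Rightarrow> gf2" where "nrm x = x ^ (q + 1)"

lemma nrm_mult: "nrm (x * y) = nrm x * nrm y" and nrm_divide: "nrm (x / y) = nrm x / nrm y"
  and nrm_0 [simp]: "nrm 0 = 0" and nrm_1 [simp]: "nrm 1 = 1" and nrm_eq_0 [simp]: "nrm x = 0 \<longleftrightarrow> x = 0"
  unfolding nrm_def by (auto simp: power_mult_distrib power_divide)

lemma nrm_F: "x \<in> E \<Longrightarrow> nrm x \<in> F"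
proof -
  assume "x \<in> E"
  then have "x ^ (q * q) = x" by (simp add: GF_def power2_eq_square)
  then show "nrm x \<in> F"
    by (simp add: GF_def nrm_def power_mult_distrib power_mult[symmetric] mult.commute)
qed

text \<open>The fibre is the root set of \<open>X^(q+1) + c\<close>, whose derivative
  \<open>X^q\<close> vanishes only at 0. Roots lie in \<open>E\<close> automatically: raising
  \<open>z^(q+1) = c\<close> to the power \<open>q\<close> gives
  \<open>z^q * z^(q^2) = c = z^q * z\<close>, and \<open>z^q\<close> cancels.\<close>

lemma card_fibre:
  assumes c: "c \<in> F" "c \<noteq> 0"
  shows "card {z \<in> E. nrm z = c} = q + 1"
proof -
  let ?p = "monom 1 (q + 1) + [:c:] :: gf2 poly"
  have "z \<in> E" if z: "nrm z = c" for z
  proof -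
    have "z ^ q * z ^ (q\<^sup>2) = (nrm z) ^ q"
      by (simp add: nrm_def power_mult_distrib power2_eq_square power_mult)
    also have "\<dots> = z ^ q * z" using c z by (simp add: GF_def nrm_def mult.commute)
    finally show ?thesis using z c by (auto simp: GF_def nrm_def)
  qed
  then have roots: "{z. poly ?p z = 0} = {z \<in> E. nrm z = c}" by (auto simp: poly_monom nrm_def)
  have deg: "degree ?p = q + 1"
    by (subst degree_add_eq_left) (auto simp: degree_monom_eq)
  have pd: "pderiv ?p = monom 1 q"
    using q_even by (simp add: pderiv_add pderiv_monom gf2_of_nat_even pderiv_pCons)
  have "card {z. poly ?p z = 0} = degree ?p"
  proof (rule card_roots_separable)
    show "?p \<noteq> 0" using deg by (metis Suc_eq_plus1 degree_0 nat.distinct(1))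
    fix z assume "poly ?p z = 0"
    then have "z \<noteq> 0" using c by (auto simp: poly_monom)
    then show "poly (pderiv ?p) z \<noteq> 0" unfolding pd by (simp add: poly_monom)
  qed
  then show ?thesis by (simp only: roots deg)
qed

section \<open>The projective norm graph\<close>

definition NV :: "(gf2 \<times> gf2) set" where "NV = E \<times> (F - {0})"

text \<open>Adjacency in the projective norm graph of Alon, Ronyai and Szabo. In characteristic two
  \<open>A + A = 0\<close> while second coordinates in \<open>NV\<close> are nonzero, so there are
  no loops and the graph is regular.\<close>

definition adj :: "gf2 \<times> gf2 \<Rightarrow> gf2 \<times> gf2 \<Rightarrow> bool" where
  "adj u v \<longleftrightarrow> nrm (fst u + fst v) = snd u * snd v"

lemma adj_sym: "adj u v \<longleftrightarrow> adj v u"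
  by (simp add: adj_def add.commute mult.commute)

lemma finite_NV: "finite NV" using card_E card_F by (simp add: NV_def)

lemma card_NV: "card NV = q\<^sup>2 * (q - 1)"
  using card_E card_F F_closed by (simp add: NV_def card_cartesian_product)

lemma adj_irrefl: "u \<in> NV \<Longrightarrow> \<not> adj u u"
  by (auto simp: NV_def adj_def)

text \<open>Every first coordinate \<open>B\<close> other than \<open>A\<close> determines the
  second one as \<open>nrm (A + B) / a\<close>.\<close>

lemma degree_NV:
  assumes "u \<in> NV"
  shows "card {v \<in> NV. adj u v} = q\<^sup>2 - 1"
proof -
  obtain A a where u: "u = (A, a)" "A \<in> E" "a \<in> F" "a \<noteq> 0" using assms by (auto simp: NV_def)
  have "bij_betw (\<lambda>B. (B, nrm (A + B) / a)) (E - {A}) {v \<in> NV. adj u v}"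
  proof (rule bij_betw_byWitness[where f' = fst])
    show "\<forall>w\<in>{v \<in> NV. adj u v}. (fst w, nrm (A + fst w) / a) = w"
      using u by (auto simp: adj_def)
    have "nrm (A + B) / a \<in> F" if "B \<in> E" for B
      using u that by (intro F_closed nrm_F E_closed)
    then show "(\<lambda>B. (B, nrm (A + B) / a)) ` (E - {A}) \<subseteq> {v \<in> NV. adj u v}"
      using u by (auto simp: NV_def adj_def)
    show "fst ` {v \<in> NV. adj u v} \<subseteq> E - {A}"
      using u by (auto simp: NV_def adj_def)
  qed simp
  then have "card {v \<in> NV. adj u v} = card (E - {A})" by (rule bij_betw_same_card[symmetric])
  then show ?thesis using u card_E by simp
qed

text \<open>For different first coordinates \<open>A\<close>, \<open>B\<close>, a common neighbour
  \<open>(C, c)\<close> is determined by the ratio \<open>z = (A + C) / (B + C)\<close>, which runs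
  through the elements of norm \<open>a / b\<close> other than 1; the value 1 has that norm exactly
  if \<open>a = b\<close>. The indicators write the square of the adjacency matrix as a combination
  of the all-ones matrix, two block matrices and the identity.\<close>

lemma codegree_NV:
  assumes "u \<in> NV" "v \<in> NV"
  shows "real (card {w \<in> NV. adj u w \<and> adj v w}) = real (q + 1)
    - real (q + 1) * of_bool (fst u = fst v) - of_bool (snd u = snd v) + (real q)\<^sup>2 * of_bool (u = v)"
proof -
  obtain A a where u: "u = (A, a)" "A \<in> E" "a \<in> F" "a \<noteq> 0" using assms by (auto simp: NV_def)
  obtain B b where v: "v = (B, b)" "B \<in> E" "b \<in> F" "b \<noteq> 0" using assms by (auto simp: NV_def)
  show ?thesis
  proof (cases "A = B")
    case True
    show ?thesis
    proof (cases "a = b")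
      case True
      then have "u = v" using u v \<open>A = B\<close> by simp
      then have "card {w \<in> NV. adj u w \<and> adj v w} = q\<^sup>2 - 1" using degree_NV[OF assms(1)] by simp
      moreover have "q\<^sup>2 \<ge> 1" using q_ge by simp
      ultimately show ?thesis using \<open>u = v\<close> by (simp add: of_nat_diff)
    next
      case False
      then have empty: "{w \<in> NV. adj u w \<and> adj v w} = {}"
        using u v \<open>A = B\<close> by (auto simp: NV_def adj_def)
      show ?thesis unfolding empty using u v \<open>A = B\<close> False by simp
    qed
  next
    case False
    let ?Z = "{z \<in> E. nrm z = a / b} - {1}"
    let ?g = "\<lambda>z. (A + z * B) / (z + 1)"
    let ?h = "\<lambda>w. (A + fst w) / (B + fst w)"
    have g1: "A + ?g z = z * (A + B) / (z + 1)" "B + ?g z = (A + B) / (z + 1)" if "z \<noteq> 1" for z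
      using that by (simp_all add: field_simps add_ac)
    have "bij_betw (\<lambda>z. (?g z, nrm (A + ?g z) / a)) ?Z {w \<in> NV. adj u w \<and> adj v w}"
    proof (rule bij_betw_byWitness[where f' = ?h])
      show "\<forall>z\<in>?Z. ?h (?g z, nrm (A + ?g z) / a) = z"
        using False by (auto simp: g1)
      show "\<forall>w\<in>{w \<in> NV. adj u w \<and> adj v w}. (?g (?h w), nrm (A + ?g (?h w)) / a) = w"
      proof
        fix w assume w: "w \<in> {w \<in> NV. adj u w \<and> adj v w}"
        obtain C c where wc: "w = (C, c)" "c \<noteq> 0" "nrm (A + C) = a * c" "nrm (B + C) = b * c"
          using w u v by (cases w) (auto simp: NV_def adj_def)
        have ne: "B + C \<noteq> 0" using wc v by auto
        have "?h w + 1 = (A + B) / (B + C)" using ne by (simp add: wc field_simps add_ac)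
        moreover have "A + ?h w * B = C * (A + B) / (B + C)" using ne by (simp add: wc field_simps add_ac)
        ultimately have "?g (?h w) = C" using False ne by simp
        then show "(?g (?h w), nrm (A + ?g (?h w)) / a) = w" using wc u by simp
      qed
      show "(\<lambda>z. (?g z, nrm (A + ?g z) / a)) ` ?Z \<subseteq> {w \<in> NV. adj u w \<and> adj v w}"
      proof clarify
        fix z assume z: "z \<in> E" "nrm z = a / b" "z \<noteq> 1"
        have z0: "z \<noteq> 0" using z(2) u v by auto
        have gE: "?g z \<in> E" using u v z by (intro E_closed) auto
        have n1: "nrm (A + ?g z) \<noteq> 0" using z z0 False by (simp add: g1)
        have n2: "nrm (A + ?g z) = (a / b) * nrm (B + ?g z)"
          using z by (simp add: g1 nrm_mult nrm_divide)
        have "(?g z, nrm (A + ?g z) / a) \<in> NV"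
          using gE n1 u by (auto simp: NV_def intro!: F_closed nrm_F E_closed)
        moreover have "adj u (?g z, nrm (A + ?g z) / a)" using u by (simp add: adj_def)
        moreover have "adj v (?g z, nrm (A + ?g z) / a)" using u v by (simp add: adj_def n2)
        ultimately show "(?g z, nrm (A + ?g z) / a) \<in> NV \<and> adj u (?g z, nrm (A + ?g z) / a) \<and>
          adj v (?g z, nrm (A + ?g z) / a)" by blast
      qed
      show "?h ` {w \<in> NV. adj u w \<and> adj v w} \<subseteq> ?Z"
      proof clarify
        fix C c assume w: "(C, c) \<in> NV" "adj u (C, c)" "adj v (C, c)"
        then have wc: "C \<in> E" "c \<noteq> 0" "nrm (A + C) = a * c" "nrm (B + C) = b * c"
          using u v by (auto simp: NV_def adj_def)
        have ne: "B + C \<noteq> 0" using wc v by auto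
        have "?h (C, c) \<in> E" using u v wc by (auto intro!: E_closed)
        moreover have "nrm (?h (C, c)) = a / b" using wc by (simp add: nrm_divide)
        moreover have "?h (C, c) \<noteq> 1" using ne False by (simp add: divide_eq_1_iff)
        ultimately show "?h (C, c) \<in> ?Z" by blast
      qed
    qed
    then have "card {w \<in> NV. adj u w \<and> adj v w} = card ?Z" by (rule bij_betw_same_card[symmetric])
    also have "\<dots> = q + 1 - of_bool (a = b)"
    proof -
      have c: "card {z \<in> E. nrm z = a / b} = q + 1" using u v by (intro card_fibre F_closed) auto
      have "1 \<in> {z \<in> E. nrm z = a / b} \<longleftrightarrow> a = b" using v E_closed by auto
      then show ?thesis using c by (cases "a = b") auto
    qed
    finally show ?thesis using False u v by auto
  qed
qed

lemma nrm_add: "nrm (x + y) = x ^ q * x + x ^ q * y + x * y ^ q + y ^ q * y"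
  by (simp add: nrm_def frob algebra_simps)

text \<open>Adding the two equations cancels \<open>w^q * w\<close> and leaves \<open>w^q\<close> as
  an affine function of \<open>w\<close>. Substituting this into one of them gives a quadratic
  equation with leading coefficient \<open>D^q\<close>, which is nonzero, so three solutions are too
  many.\<close>

lemma two_norm_equations:
  assumes xy: "d \<noteq> e" and "x \<noteq> y" "y \<noteq> z" "x \<noteq> z"
    and "\<And>w. w \<in> {x, y, z} \<Longrightarrow> nrm (w + d) = s \<and> nrm (w + e) = t"
  shows False
proof -
  define D where "D = d + e"
  have D: "D \<noteq> 0" using xy by (simp add: D_def)
  define \<kappa> where "\<kappa> = d ^ q * d + e ^ q * e + s + t"
  have quad: "D ^ q * w\<^sup>2 + (\<kappa> + d * D ^ q + D * d ^ q) * w + (d * \<kappa> + D * (d ^ q * d + s)) = 0"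
    if w: "w \<in> {x, y, z}" for w
  proof -
    have 1: "w ^ q * w + w ^ q * d + w * d ^ q + d ^ q * d = s"
      and 2: "w ^ q * w + w ^ q * e + w * e ^ q + e ^ q * e = t"
      using assms(5)[OF w] by (auto simp: nrm_add)
    have "w ^ q * D + w * D ^ q + \<kappa> = (w ^ q * w + w ^ q * d + w * d ^ q + d ^ q * d + s)
        + (w ^ q * w + w ^ q * e + w * e ^ q + e ^ q * e + t)"
      by (simp add: D_def \<kappa>_def frob algebra_simps)
    then have lin: "w ^ q * D = w * D ^ q + \<kappa>" unfolding 1 2 by (simp add: add.assoc)
    have "(w + d) * (w ^ q * D) + D * (w * d ^ q + d ^ q * d + s) =
       D * (w ^ q * w + w ^ q * d + w * d ^ q + d ^ q * d + s)"
      by (simp add: algebra_simps)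
    then have "(w + d) * (w ^ q * D) + D * (w * d ^ q + d ^ q * d + s) = 0" unfolding 1 by simp
    then show ?thesis unfolding lin by (simp add: algebra_simps power2_eq_square)
  qed
  have three: False if "a * x\<^sup>2 + b * x + c = 0" "a * y\<^sup>2 + b * y + c = 0" "a * z\<^sup>2 + b * z + c = 0" "a \<noteq> 0"
    for a b c :: gf2
  proof -
    \<comment> \<open>The difference of two values of the quadratic, divided by
      \<open>u + v\<close>.\<close>
    have diff: "a * (u + v) + b = 0" if "a * u\<^sup>2 + b * u + c = 0" "a * v\<^sup>2 + b * v + c = 0" "u \<noteq> v" for u v
    proof -
      have "(u + v) * (a * (u + v) + b) = (a * u\<^sup>2 + b * u + c) + (a * v\<^sup>2 + b * v + c)
          + (a * u * v + a * u * v)"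
        by (simp add: algebra_simps power2_eq_square)
      then show ?thesis using that by (simp del: mult_eq_0_iff) simp
    qed
    have "a * (x + y) + b = 0" "a * (x + z) + b = 0" using diff that assms by blast+
    then have "a * (x + y) = a * (x + z)" by simp
    then show False using \<open>a \<noteq> 0\<close> assms by simp
  qed
  show False by (rule three[OF quad quad quad]) (use D in auto)
qed


text \<open>Dividing the equations of \<open>a 0\<close> and \<open>a 1\<close> by that of
  \<open>a 2\<close> eliminates the second coordinates of the \<open>b j\<close>. In terms of
  \<open>y j = 1 / (B j + A 2)\<close> they become two norm equations with the three solutions
  \<open>y 0\<close>, \<open>y 1\<close>, \<open>y 2\<close>.\<close>

lemma K33_free_NV:
  assumes inj: "inj_on a {..<3::nat}" "inj_on b {..<3::nat}"
    and NV: "\<And>i. i < 3 \<Longrightarrow> a i \<in> NV" "\<And>i. i < 3 \<Longrightarrow> b i \<in> NV"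
    and adj: "\<And>i j. i < 3 \<Longrightarrow> j < 3 \<Longrightarrow> adj (a i) (b j)"
  shows False
proof -
  have ne: "a i \<noteq> a j" "b i \<noteq> b j" if "i < 3" "j < 3" "i \<noteq> j" for i j
    using inj that by (auto simp: inj_on_def)
  define A where "A i = fst (a i)" for i
  define B where "B i = fst (b i)" for i
  have eq: "nrm (A i + B j) = snd (a i) * snd (b j)" if "i < 3" "j < 3" for i j
    using adj[OF that] by (simp add: adj_def A_def B_def)
  have nz: "snd (a i) \<noteq> 0" "snd (b i) \<noteq> 0" if "i < 3" for i
    using NV[OF that] by (auto simp: NV_def)
  \<comment> \<open>Equal first coordinates and a common neighbour force equal second
    coordinates.\<close>
  have Ane: "A i \<noteq> A j" if ij: "i < 3" "j < 3" "i \<noteq> j" for i j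
  proof
    assume "A i = A j"
    then have "snd (a i) * snd (b 0) = snd (a j) * snd (b 0)" using eq[of i 0, symmetric] eq[of j 0] ij by simp
    then have "snd (a i) = snd (a j)" using nz(2)[of 0] by simp
    then show False using ne(1)[OF ij] \<open>A i = A j\<close> by (simp add: A_def prod_eq_iff)
  qed
  have Bne: "B i \<noteq> B j" if ij: "i < 3" "j < 3" "i \<noteq> j" for i j
  proof
    assume "B i = B j"
    then have "snd (a 0) * snd (b i) = snd (a 0) * snd (b j)" using eq[of 0 i, symmetric] eq[of 0 j] ij by simp
    then have "snd (b i) = snd (b j)" using nz(1)[of 0] by simp
    then show False using ne(2)[OF ij] \<open>B i = B j\<close> by (simp add: B_def prod_eq_iff)
  qed
  have BA: "B j + A 2 \<noteq> 0" if "j < 3" for j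
    using eq[of 2 j] nz(1)[of 2] nz(2)[OF that] that by (auto simp: add.commute)
  define y where "y j = 1 / (B j + A 2)" for j
  define d where "d i = 1 / (A i + A 2)" for i
  have yne: "y i \<noteq> y j" if "i < 3" "j < 3" "i \<noteq> j" for i j
    using BA that Bne[OF that] by (simp add: y_def)
  have AA: "A 0 + A 2 \<noteq> 0" "A 1 + A 2 \<noteq> 0" using Ane[of 0 2] Ane[of 1 2] by auto
  have d: "d 0 \<noteq> d 1" using AA Ane[of 0 1] by (simp add: d_def)
  have key: "nrm (y j + d i) = snd (a i) / snd (a 2) * nrm (d i)" if ij: "i < 2" "j < 3" for i j
  proof -
    have Ai: "A i + A 2 \<noteq> 0" using Ane[of i 2] ij by auto
    have "y j + d i = (A i + B j) / (B j + A 2) * d i"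
      using BA[OF ij(2)] Ai by (simp add: y_def d_def field_simps add_ac)
    then have "nrm (y j + d i) = nrm (A i + B j) / nrm (A 2 + B j) * nrm (d i)"
      by (simp add: nrm_mult nrm_divide add.commute)
    then show ?thesis using eq[of i j] eq[of 2 j] nz[of j] ij by simp
  qed
  show False
  proof (rule two_norm_equations[OF d])
    show "y 0 \<noteq> y 1" "y 1 \<noteq> y 2" "y 0 \<noteq> y 2" using yne by auto
    show "nrm (w + d 0) = snd (a 0) / snd (a 2) * nrm (d 0) \<and> nrm (w + d 1) = snd (a 1) / snd (a 2) * nrm (d 1)"
      if "w \<in> {y 0, y 1, y 2}" for w
      using that key[of 0] key[of 1] by auto
  qed
qed

end

section \<open>A spectral lower bound for quadratic forms\<close>

text \<open>Spectrally: if all eigenvalues of a symmetric \<open>M\<close> with constant row sums, other than the one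
  of the constant vector, have modulus at most \<open>c\<close>, then \<open>M \<ge> - c\<close> as a quadratic form.\<close>

lemma quadratic_form_lower_bound:
  fixes M :: "'v \<Rightarrow> 'v \<Rightarrow> real"
  assumes V: "finite V" and sym: "\<And>u v. M u v = M v u" and c: "c > 0" and d: "d \<ge> 0"
    and reg: "\<And>u. u \<in> V \<Longrightarrow> (\<Sum>v\<in>V. M u v) = d"
    and spec: "\<And>z. (\<Sum>v\<in>V. z v) = 0 \<Longrightarrow> (\<Sum>u\<in>V. (\<Sum>v\<in>V. M u v * z v)\<^sup>2) \<le> c\<^sup>2 * (\<Sum>v\<in>V. (z v)\<^sup>2)"
  shows "- c * (\<Sum>v\<in>V. (y v)\<^sup>2) \<le> (\<Sum>u\<in>V. \<Sum>v\<in>V. M u v * (y u * y v))"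
proof (cases "V = {}")
  case False
  define n where "n = real (card V)"
  have n: "n > 0" using V False by (simp add: n_def card_gt_0_iff)
  \<comment> \<open>Splits \<open>y\<close> into its mean and a part \<open>z\<close> orthogonal to
    the constants; regularity keeps the two parts from interacting.\<close>
  define a where "a = (\<Sum>v\<in>V. y v) / n"
  define z where "z v = y v - a" for v
  have z0: "(\<Sum>v\<in>V. z v) = 0" using n by (simp add: z_def sum_subtractf a_def n_def)
  define Mz where "Mz u = (\<Sum>v\<in>V. M u v * z v)" for u
  have My: "(\<Sum>v\<in>V. M u v * y v) = a * d + Mz u" if "u \<in> V" for u
    using reg[OF that] by (simp add: Mz_def z_def right_diff_distrib sum_subtractf sum_distrib_right[symmetric])
  have sMz: "(\<Sum>u\<in>V. Mz u) = 0"
  proof -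
    have "(\<Sum>u\<in>V. Mz u) = (\<Sum>v\<in>V. \<Sum>u\<in>V. M u v * z v)" unfolding Mz_def by (rule sum.swap)
    also have "\<dots> = (\<Sum>v\<in>V. d * z v)"
      using reg sym by (intro sum.cong refl) (simp add: sum_distrib_right[symmetric])
    finally show ?thesis using z0 by (simp add: sum_distrib_left[symmetric])
  qed
  have "(\<Sum>u\<in>V. \<Sum>v\<in>V. M u v * (y u * y v)) = (\<Sum>u\<in>V. y u * (\<Sum>v\<in>V. M u v * y v))"
    by (simp add: sum_distrib_left mult_ac)
  also have "\<dots> = (\<Sum>u\<in>V. (a + z u) * (a * d + Mz u))"
    using My by (intro sum.cong) (auto simp: z_def)
  also have "\<dots> = (\<Sum>u\<in>V. a\<^sup>2 * d) + a * (\<Sum>u\<in>V. Mz u) + a * d * (\<Sum>u\<in>V. z u) + (\<Sum>u\<in>V. z u * Mz u)"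
    by (simp add: algebra_simps sum.distrib sum_distrib_left power2_eq_square)
  finally have "(\<Sum>u\<in>V. \<Sum>v\<in>V. M u v * (y u * y v)) = n * (a\<^sup>2 * d) + (\<Sum>u\<in>V. z u * Mz u)"
    by (simp add: sMz z0 n_def)
  moreover have "0 \<le> n * (a\<^sup>2 * d)" using n d by simp
  moreover have "- c * (\<Sum>v\<in>V. (z v)\<^sup>2) \<le> (\<Sum>u\<in>V. z u * Mz u)"
  proof -
    \<comment> \<open>Expanding this square replaces the diagonalisation of \<open>M\<close>: a
      bound on the norm of \<open>M z\<close> gives one on \<open><z, M z>\<close>.\<close>
    have "0 \<le> (\<Sum>u\<in>V. (Mz u + c * z u)\<^sup>2)" by (simp add: sum_nonneg)
    also have "\<dots> = (\<Sum>u\<in>V. (Mz u)\<^sup>2) + 2 * c * (\<Sum>u\<in>V. z u * Mz u) + c\<^sup>2 * (\<Sum>u\<in>V. (z u)\<^sup>2)"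
      by (simp add: power2_sum sum.distrib sum_distrib_left power_mult_distrib mult_ac)
    also have "(\<Sum>u\<in>V. (Mz u)\<^sup>2) \<le> c\<^sup>2 * (\<Sum>v\<in>V. (z v)\<^sup>2)" unfolding Mz_def by (rule spec[OF z0])
    finally have "0 \<le> 2 * c * (c * (\<Sum>v\<in>V. (z v)\<^sup>2) + (\<Sum>u\<in>V. z u * Mz u))"
      by (simp add: algebra_simps power2_eq_square)
    then have "0 \<le> c * (\<Sum>v\<in>V. (z v)\<^sup>2) + (\<Sum>u\<in>V. z u * Mz u)" using c by (simp add: zero_le_mult_iff)
    then show ?thesis by simp
  qed
  moreover have "(\<Sum>v\<in>V. (z v)\<^sup>2) \<le> (\<Sum>v\<in>V. (y v)\<^sup>2)"
  proof -
    have "(\<Sum>v\<in>V. (y v)\<^sup>2) = (\<Sum>v\<in>V. (z v)\<^sup>2 + 2 * a * z v + a\<^sup>2)"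
      by (intro sum.cong refl) (simp add: z_def power2_eq_square algebra_simps)
    also have "\<dots> = (\<Sum>v\<in>V. (z v)\<^sup>2) + 2 * a * (\<Sum>v\<in>V. z v) + n * a\<^sup>2"
      by (simp add: sum.distrib sum_distrib_left n_def)
    finally have "(\<Sum>v\<in>V. (y v)\<^sup>2) = (\<Sum>v\<in>V. (z v)\<^sup>2) + 2 * a * (\<Sum>v\<in>V. z v) + n * a\<^sup>2" .
    then show ?thesis using z0 n by simp
  qed
  then have "c * (\<Sum>v\<in>V. (z v)\<^sup>2) \<le> c * (\<Sum>v\<in>V. (y v)\<^sup>2)" using c by simp
  ultimately show ?thesis by simp
qed simp

text \<open>Grouped by the values of \<open>h\<close>, the sum is a sum of squares of class sums.
  These are the block matrices subtracted in \<open>codegree_NV\<close>.\<close>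

lemma sum_same_class_nonneg:
  fixes z :: "'v \<Rightarrow> real"
  assumes "finite V"
  shows "0 \<le> (\<Sum>u\<in>V. \<Sum>v\<in>V. z u * z v * of_bool (h u = h v))"
proof -
  have "(\<Sum>u\<in>V. \<Sum>v\<in>V. z u * z v * of_bool (h u = h v)) = (\<Sum>u\<in>V. z u * (\<Sum>v | v \<in> V \<and> h v = h u. z v))"
    unfolding sum.inter_filter[OF assms] sum_distrib_left by (intro sum.cong refl) auto
  also have "\<dots> = (\<Sum>k\<in>h ` V. \<Sum>u | u \<in> V \<and> h u = k. z u * (\<Sum>v | v \<in> V \<and> h v = h u. z v))"
    by (rule sum.image_gen[OF assms])
  also have "\<dots> = (\<Sum>k\<in>h ` V. (\<Sum>u | u \<in> V \<and> h u = k. z u)\<^sup>2)"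
    by (intro sum.cong refl) (simp add: power2_eq_square sum_distrib_right)
  finally show ?thesis by (simp add: sum_nonneg)
qed

lemma sum_adjacent_pairs:
  fixes f :: "'v set \<Rightarrow> real"
  assumes V: "finite V" and sym: "\<And>u v. R u v \<Longrightarrow> R v u" and irrefl: "\<And>u. u \<in> V \<Longrightarrow> \<not> R u u"
  shows "(\<Sum>u\<in>V. \<Sum>v\<in>V. of_bool (R u v) * f {u, v}) = 2 * (\<Sum>e\<in>{{u, v} | u v. u \<in> V \<and> v \<in> V \<and> R u v}. f e)"
proof -
  define A where "A = {(u, v) \<in> V \<times> V. R u v}"
  let ?h = "\<lambda>(u, v). {u, v}"
  have finA: "finite A" using V by (auto simp: A_def intro: finite_subset[of _ "V \<times> V"])
  have "(\<Sum>u\<in>V. \<Sum>v\<in>V. of_bool (R u v) * f {u, v}) = (\<Sum>p\<in>V \<times> V. of_bool (p \<in> A) * f (?h p))"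
    unfolding sum.cartesian_product by (intro sum.cong) (auto simp: A_def)
  also have "\<dots> = (\<Sum>p\<in>A. f (?h p))"
    using V by (intro sum.mono_neutral_cong_right) (auto simp: A_def)
  also have "\<dots> = (\<Sum>e\<in>?h ` A. \<Sum>p | p \<in> A \<and> ?h p = e. f (?h p))"
    by (rule sum.image_gen[OF finA])
  also have "\<dots> = (\<Sum>e\<in>?h ` A. 2 * f e)"
  proof (rule sum.cong[OF refl])
    fix e assume "e \<in> ?h ` A"
    then obtain u v where e: "e = {u, v}" "u \<in> V" "v \<in> V" "R u v" by (auto simp: A_def)
    then have "u \<noteq> v" using irrefl by blast
    have "{p. p \<in> A \<and> ?h p = e} = {(u, v), (v, u)}"
      using e sym by (auto simp: A_def doubleton_eq_iff)
    then show "(\<Sum>p | p \<in> A \<and> ?h p = e. f (?h p)) = 2 * f e"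
      using \<open>u \<noteq> v\<close> e(1) by (simp add: insert_commute)
  qed
  also have "?h ` A = {{u, v} | u v. u \<in> V \<and> v \<in> V \<and> R u v}" by (auto simp: A_def)
  finally show ?thesis by (simp add: sum_distrib_left)
qed

context field_pair
begin

definition norm_graph :: "(gf2 \<times> gf2) ugraph" where
  "norm_graph = Graph NV {{u, v} | u v. u \<in> NV \<and> v \<in> NV \<and> adj u v}"

lemma norm_graph_simple: "simple_graph norm_graph"
  unfolding simple_graph_def norm_graph_def
proof (intro conjI ballI)
  fix e assume "e \<in> edges (Graph NV {{u, v} | u v. u \<in> NV \<and> v \<in> NV \<and> adj u v})"
  then obtain u v where "e = {u, v}" "u \<in> NV" "v \<in> NV" "adj u v" by auto
  moreover have "u \<noteq> v" using calculation adj_irrefl by blast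
  ultimately show "e \<subseteq> verts (Graph NV {{u, v} | u v. u \<in> NV \<and> v \<in> NV \<and> adj u v})" "card e = 2" by auto
qed (simp add: finite_NV)

lemma norm_graph_edge: "{u, v} \<in> edges norm_graph \<Longrightarrow> u \<in> NV \<and> v \<in> NV \<and> adj u v"
  by (auto simp: norm_graph_def doubleton_eq_iff adj_sym)

lemma norm_graph_free: "free_of (complete_bipartite_graph 3 3) norm_graph"
proof (rule free_of_K33I)
  fix a b :: "nat \<Rightarrow> gf2 \<times> gf2"
  assume inj: "inj_on a {..<3}" "inj_on b {..<3}"
    and e: "\<And>i j. i < 3 \<Longrightarrow> j < 3 \<Longrightarrow> {a i, b j} \<in> edges norm_graph"
  show False
    by (rule K33_free_NV[OF inj]) (use norm_graph_edge[OF e] in \<open>blast intro: zero_less_numeral\<close>)+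
qed

lemma adj_row_sum: "u \<in> NV \<Longrightarrow> (\<Sum>v\<in>NV. of_bool (adj u v)) = (real q)\<^sup>2 - 1"
proof -
  assume u: "u \<in> NV"
  have "(\<Sum>v\<in>NV. of_bool (adj u v)) = real (card {v \<in> NV. adj u v})"
    using finite_NV by (simp add: Int_def)
  also have "\<dots> = (real q)\<^sup>2 - 1"
  proof -
    have "q\<^sup>2 \<ge> 1" using q_ge by simp
    then show ?thesis using degree_NV[OF u] by (simp add: of_nat_diff)
  qed
  finally show ?thesis .
qed

text \<open>For \<open>z\<close> of sum zero the squared norm of the image is the quadratic form of
  the codegrees. There the all-ones part vanishes, the block parts only decrease the value, and
  \<open>q^2\<close> times the identity remains.\<close>

lemma adj_form_lower_bound:
  "- real q * (\<Sum>v\<in>NV. (y v)\<^sup>2) \<le> (\<Sum>u\<in>NV. \<Sum>v\<in>NV. of_bool (adj u v) * (y u * y v))"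
proof (rule quadratic_form_lower_bound[OF finite_NV _ _ _ adj_row_sum])
  show "of_bool (adj u v) = (of_bool (adj v u) :: real)" for u v by (simp add: adj_sym)
  show "real q > 0" using q_ge by simp
  have "1 \<le> (real q)\<^sup>2" using q_ge by (intro one_le_power) simp
  then show "0 \<le> (real q)\<^sup>2 - 1" by simp
  fix z :: "gf2 \<times> gf2 \<Rightarrow> real" assume z: "(\<Sum>v\<in>NV. z v) = 0"
  have "(\<Sum>w\<in>NV. (\<Sum>u\<in>NV. of_bool (adj w u) * z u)\<^sup>2) =
      (\<Sum>w\<in>NV. \<Sum>u\<in>NV. \<Sum>v\<in>NV. z u * z v * of_bool (adj u w \<and> adj v w))"
    unfolding power2_eq_square sum_product
    by (intro sum.cong refl) (auto simp: adj_sym)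
  also have "\<dots> = (\<Sum>u\<in>NV. \<Sum>w\<in>NV. \<Sum>v\<in>NV. z u * z v * of_bool (adj u w \<and> adj v w))"
    by (rule sum.swap)
  also have "\<dots> = (\<Sum>u\<in>NV. \<Sum>v\<in>NV. \<Sum>w\<in>NV. z u * z v * of_bool (adj u w \<and> adj v w))"
    by (intro sum.cong refl sum.swap)
  also have "\<dots> = (\<Sum>u\<in>NV. \<Sum>v\<in>NV. z u * z v * real (card {w \<in> NV. adj u w \<and> adj v w}))"
    using finite_NV by (simp add: sum_distrib_left[symmetric] Int_def)
  also have "\<dots> = (\<Sum>u\<in>NV. \<Sum>v\<in>NV. real (q + 1) * (z u * z v)
      - real (q + 1) * (z u * z v * of_bool (fst u = fst v))
      - z u * z v * of_bool (snd u = snd v) + (real q)\<^sup>2 * (z u * z v * of_bool (u = v)))"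
    by (intro sum.cong refl) (simp only: codegree_NV, simp add: algebra_simps)
  also have "\<dots> = real (q + 1) * (\<Sum>u\<in>NV. \<Sum>v\<in>NV. z u * z v)
      - real (q + 1) * (\<Sum>u\<in>NV. \<Sum>v\<in>NV. z u * z v * of_bool (fst u = fst v))
      - (\<Sum>u\<in>NV. \<Sum>v\<in>NV. z u * z v * of_bool (snd u = snd v))
      + (real q)\<^sup>2 * (\<Sum>u\<in>NV. \<Sum>v\<in>NV. z u * z v * of_bool (u = v))"
    by (simp only: sum.distrib sum_subtractf sum_distrib_left)
  also have "(\<Sum>u\<in>NV. \<Sum>v\<in>NV. z u * z v) = 0"
    using z by (simp add: sum_product[symmetric])
  also have "(\<Sum>u\<in>NV. \<Sum>v\<in>NV. z u * z v * of_bool (u = v)) = (\<Sum>u\<in>NV. (z u)\<^sup>2)"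
  proof (rule sum.cong[OF refl])
    fix u assume u: "u \<in> NV"
    have "(\<Sum>v\<in>NV. z u * z v * of_bool (u = v)) = (\<Sum>v\<in>NV. if v = u then z u * z v else 0)"
      by (intro sum.cong) auto
    then show "(\<Sum>v\<in>NV. z u * z v * of_bool (u = v)) = (z u)\<^sup>2"
      using finite_NV u by (simp add: power2_eq_square)
  qed
  finally show "(\<Sum>w\<in>NV. (\<Sum>u\<in>NV. of_bool (adj w u) * z u)\<^sup>2) \<le> (real q)\<^sup>2 * (\<Sum>v\<in>NV. (z v)\<^sup>2)"
    using mult_nonneg_nonneg[of "real (q + 1)", OF _ sum_same_class_nonneg[OF finite_NV, of z fst]]
      sum_same_class_nonneg[OF finite_NV, of z snd]
    by simp
qed

lemma attains_K33:
  "\<exists>e. real q ^ 5 / 8 \<le> real e \<and> real e \<le> real q ^ 5 / 2 \<and>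
    attains (complete_bipartite_graph 3 3) e (real q ^ 4)"
proof -
  let ?N = "real (card NV)"
  have N: "?N = (real q)\<^sup>2 * (real q - 1)" using q_ge by (simp add: card_NV of_nat_diff)
  have form: "(\<Sum>u\<in>NV. \<Sum>v\<in>NV. of_bool (adj u v) * f {u, v}) = 2 * (\<Sum>e\<in>edges norm_graph. f e)"
    for f :: "_ \<Rightarrow> real"
    unfolding norm_graph_def using sum_adjacent_pairs[OF finite_NV, of adj f] adj_sym adj_irrefl by auto
  have m: "real (card (edges norm_graph)) = ?N * ((real q)\<^sup>2 - 1) / 2"
    using form[of "\<lambda>_. 1"] by (simp add: adj_row_sum)
  have "surplus norm_graph \<le> real q ^ 4"
  proof -
    obtain s where s: "\<And>v. s v \<in> {1, -1 :: real}" "surplus norm_graph = - cut_form norm_graph s / 2"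
      using surplus_attained[OF norm_graph_simple] by blast
    have sq: "(s v)\<^sup>2 = 1" for v using s(1)[of v] by auto
    have "2 * cut_form norm_graph s = (\<Sum>u\<in>NV. \<Sum>v\<in>NV. of_bool (adj u v) * (\<Prod>w\<in>{u, v}. s w))"
      unfolding cut_form_def by (rule form[symmetric])
    also have "\<dots> = (\<Sum>u\<in>NV. \<Sum>v\<in>NV. of_bool (adj u v) * (s u * s v))"
    proof (intro sum.cong refl)
      fix u v assume "u \<in> NV" "v \<in> NV"
      then show "of_bool (adj u v) * (\<Prod>w\<in>{u, v}. s w) = of_bool (adj u v) * (s u * s v)"
        using adj_irrefl[of u] by (cases "u = v") auto
    qed
    also have "\<dots> \<ge> - real q * (\<Sum>v\<in>NV. (s v)\<^sup>2)" by (rule adj_form_lower_bound)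
    finally have "- (real q * ?N) \<le> 2 * cut_form norm_graph s" by (simp add: sq)
    then have "surplus norm_graph \<le> real q * ?N / 4" using s(2) by simp
    also have "\<dots> \<le> real q * ?N" by simp
    also have "\<dots> = real q ^ 3 * (real q - 1)" unfolding N by (simp add: power2_eq_square power3_eq_cube)
    also have "\<dots> \<le> real q ^ 3 * real q" by (intro mult_left_mono) auto
    also have "\<dots> = real q ^ 4" by (simp add: power_eq_if[of _ 4] power3_eq_cube)
    finally show ?thesis .
  qed
  then have "attains (complete_bipartite_graph 3 3) (card (edges norm_graph)) (real q ^ 4)"
    using attainsI[OF norm_graph_simple K33_graph(1) norm_graph_free] by blast
  moreover have "real q ^ 5 / 8 \<le> real (card (edges norm_graph))"
  proof -
    have q2: "real q \<ge> 2" using q_ge by simp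
    then have "2 * 2 \<le> real q * real q" by (intro mult_mono) auto
    \<comment> \<open>Already for \<open>q = 2\<close> at most half is lost in each of
      \<open>q^2 - 1\<close> and \<open>q - 1\<close>; with the 2 from counting edges twice this
      gives \<open>q ^ 5 / 8\<close>.\<close>
    then have "(real q)\<^sup>2 / 2 \<le> (real q)\<^sup>2 - 1" by (simp add: power2_eq_square)
    then have "((real q)\<^sup>2 * (real q / 2)) * ((real q)\<^sup>2 / 2) \<le> ?N * ((real q)\<^sup>2 - 1)"
      unfolding N using q2 by (intro mult_mono) auto
    moreover have "((real q)\<^sup>2 * (real q / 2)) * ((real q)\<^sup>2 / 2) = real q ^ 5 / 4"
      by (simp add: power_eq_if[of _ 5] power2_eq_square power_eq_if[of _ 4] power3_eq_cube)
    ultimately show ?thesis unfolding m by linarith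
  qed
  moreover have "real (card (edges norm_graph)) \<le> real q ^ 5 / 2"
  proof -
    have "?N * ((real q)\<^sup>2 - 1) \<le> ((real q)\<^sup>2 * real q) * (real q)\<^sup>2"
      unfolding N using q_ge by (intro mult_mono) (auto simp: one_le_power)
    also have "\<dots> = real q ^ 5"
      by (simp add: power_eq_if[of _ 5] power2_eq_square power_eq_if[of _ 4] power3_eq_cube)
    finally show ?thesis unfolding m by simp
  qed
  ultimately show ?thesis by blast
qed

end

section \<open>Conclusion for graphs containing a triangle or a \<open>K_{3,3}\<close>\<close>

lemma sp_upper_bound:
  assumes H: "simple_graph H" and K: "simple_graph K" "linked K" "card (verts K) \<ge> 3" "contains_copy H K"
    and fam: "\<And>k. k \<ge> 4 \<Longrightarrow> \<exists>e. (2 ^ k) ^ 5 / 8 \<le> real e \<and> real e \<le> (2 ^ k) ^ 5 / 2 \<and>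
      attains K e ((2 ^ k) ^ 4)"
  shows "\<exists>C>0. \<forall>m\<ge>1. sp m H \<le> ereal (C * real m powr (4/5))"
proof -
  obtain C where "C > 0" "\<And>m. m \<ge> 1 \<Longrightarrow> attains K m (C * real m powr (4/5))"
    using attains_of_family[OF K(1-3) fam] by blast
  then show ?thesis using sp_le_of_attains[OF _ H K(1,4)] by blast
qed

theorem theorem2p3:
  fixes H :: "'a ugraph" and v :: 'a
  assumes "simple_graph H"
    and "v \<in> verts H"
    and "nontrivial (delete_vertex H v)"
    and "bipartite (delete_vertex H v)"
    and "(\<lambda>n. real (ex n (delete_vertex H v))) \<in> O(\<lambda>n. real n powr (3/2))"
  shows "(\<exists>C>0. \<forall>m\<ge>1. sp m H \<ge> ereal (C * real m powr (4/5))) \<and>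
    (contains_copy H (complete_graph 3) \<or> contains_copy H (complete_bipartite_graph 3 3) \<longrightarrow>
      (\<exists>C'>0. \<forall>m\<ge>1. sp m H \<le> ereal (C' * real m powr (4/5))))"
proof (intro conjI impI)
  show "\<exists>C>0. \<forall>m\<ge>1. sp m H \<ge> ereal (C * real m powr (4/5))"
    by (rule sp_lower_bound[OF assms(1,2,5)])
  assume "contains_copy H (complete_graph 3) \<or> contains_copy H (complete_bipartite_graph 3 3)"
  then show "\<exists>C'>0. \<forall>m\<ge>1. sp m H \<le> ereal (C' * real m powr (4/5))"
  proof
    assume copy: "contains_copy H (complete_graph 3)"
    show ?thesis
    proof (rule sp_upper_bound[OF assms(1) triangle_graph(1,2) _ copy])
      fix k :: nat assume k: "k \<ge> 4"
      interpret field_pair k "2 ^ k" by unfold_locales (use k in auto)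
      have "(2::nat) ^ 4 \<le> 2 ^ k" using k by (intro power_increasing) auto
      then have "(16::nat) \<le> 2 ^ k" by simp
      \<comment> \<open>The remaining hypothesis, closure under \<open>x * y - z\<close>, is closure
        under sums and products because subtraction is addition here.\<close>
      from attains_triangle_field[OF card_F(2,1) this]
      show "\<exists>e. (2 ^ k) ^ 5 / 8 \<le> real e \<and> real e \<le> (2 ^ k) ^ 5 / 2 \<and>
          attains (complete_graph 3) e ((2 ^ k) ^ 4)"
        by (simp add: F_closed)
    qed (simp add: triangle_graph(3))
  next
    assume copy: "contains_copy H (complete_bipartite_graph 3 3)"
    show ?thesis
    proof (rule sp_upper_bound[OF assms(1) K33_graph copy])
      fix k :: nat assume "k \<ge> 4"
      then interpret field_pair k "2 ^ k" by unfold_locales auto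
      show "\<exists>e. (2 ^ k) ^ 5 / 8 \<le> real e \<and> real e \<le> (2 ^ k) ^ 5 / 2 \<and>
          attains (complete_bipartite_graph 3 3) e ((2 ^ k) ^ 4)"
        using attains_K33 by simp
    qed
  qed
qed

end
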